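(* Fix $\ell\in\mathbb{Z}_{>0}$. Let $\mathcal{F}_\ell$ be the abstract Fock space, i.e. the $\mathbb{Z}[t^{\frac12},t^{-\frac12}]$-module given by generators $|\lambda\rangle$, $\lambda\in\mathfrak{a}_{\mathbb{Z}}^*$, and the straightening relations recalled in the context, with the bar involution $\overline{\phantom{T}}\colon\mathcal{F}_\ell\to\mathcal{F}_\ell$ recalled in the context. Let $(\mathfrak{a}_{\mathbb{Z}}^* )^+$ be the set of dominant integral weights, partially ordered by the dominance order, and let $\mathcal{L}=\{|\lambda\rangle\ :\ \lambda\in(\mathfrak{a}_{\mathbb{Z}}^* )^+\}$. Then $\mathcal{L}$ is a basis of $\mathcal{F}_\ell$, and $$\big((\mathfrak{a}_{\mathbb{Z}}^* )^+,\ \mathcal{F}_\ell,\ \mathcal{L},\ \overline{\phantom{T}}\colon\mathcal{F}_\ell\to\mathcal{F}_\ell\big)$$ is a KL-module.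
   Context: Root data: $W_0$ is a finite Weyl group with simple reflections $s_1,\dots,s_n$ acting on a lattice of weights $\mathfrak{a}_{\mathbb{Z}}^*$ (for example $\mathfrak{a}_{\mathbb{Z}}^*=\mathrm{Hom}(T,\mathbb{C}^\times)$ and $W_0=N(T)/T$ for a maximal torus $T$ of a reductive algebraic group $G$). $R^+$ is the set of positive roots, $\alpha_1,\dots,\alpha_n$ are the simple roots, $\alpha_1^\vee,\dots,\alpha_n^\vee$ the simple coroots, $\rho=\frac12\sum_{\alpha\in R^+}\alpha$, $w_0$ is the longest element of $W_0$ and $\ell(w_0)=\mathrm{Card}(R^+)$ its length (not to be confused with the fixed integer $\ell$). The dot action of $W_0$ on $\mathfrak{a}_{\mathbb{Z}}^*$ is $w\circ\lambda=w(\lambda+\rho)-\rho$. Dominant weights: $(\mathfrak{a}_{\mathbb{Z}}^* )^+=\{\lambda\in\mathfrak{a}_{\mathbb{Z}}^*: \langle\lambda+\rho,\alpha_i^\vee\rangle>0 \text{ for } i=1,\dots,n\}$, with the dominance order $\mu\le\lambda$ iff $\mu\in\lambda-\sum_{\alpha\in R^+}\mathbb{Z}_{\ge0}\alpha$. Abstract Fock space: $\mathcal{F}_\ell$ is the $\mathbb{Z}[t^{\frac12},t^{-\frac12}]$-module generated by symbols $|\lambda\rangle$, $\lambda\in\mathfrak{a}_{\mathbb{Z}}^*$, subject to the following relations for $\lambda\in\mathfrak{a}_{\mathbb{Z}}^*$ and $i\in\{1,\dots,n\}$: - $|s_i\circ\lambda\rangle=-|\lambda\rangle$ if $\langle\lambda+\rho,\alpha_i^\vee\rangle\in\ell\mathbb{Z}_{\ge0}$;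 - $|s_i\circ\lambda\rangle=-t^{\frac12}|\lambda\rangle$ if $0<\langle\lambda+\rho,\alpha_i^\vee\rangle<\ell$; - $|s_i\circ\lambda\rangle=-t^{\frac12}|s_i\circ\lambda^{(1)}\rangle-|\lambda^{(1)}\rangle-t^{\frac12}|\lambda\rangle$ if $\langle\lambda+\rho,\alpha_i^\vee\rangle>\ell$ and $\langle\lambda+\rho,\alpha_i^\vee\rangle\notin\ell\mathbb{Z}$, where $\lambda^{(1)}=\lambda-j\alpha_i$ if $\langle\lambda+\rho,\alpha_i^\vee\rangle=k\ell+j$ with $k\in\mathbb{Z}_{>0}$, $j\in\{1,\dots,\ell-1\}$. Bar involution on $\mathcal{F}_\ell$: the $\mathbb{Z}$-linear involution $\overline{\phantom{T}}\colon\mathcal{F}_\ell\to\mathcal{F}_\ell$, semilinear for the ring involution $\overline{t^{\frac12}}=t^{-\frac12}$ of $\mathbb{Z}[t^{\frac12},t^{-\frac12}]$, given by $$\overline{|\lambda\rangle}=(-1)^{\ell(w_0)}(t^{-\frac12})^{\ell(w_0)-N_\lambda}\,|w_0\circ\lambda\rangle,\qquad N_\lambda=\mathrm{Card}\{\alpha\in R^+: \langle\lambda+\rho,\alpha^\vee\rangle\in\ell\mathbb{Z}\}.$$ KL-module: a KL-module over $\mathbb{Z}[t^{\frac12},t^{-\frac12}]$ is a tuple $(\Lambda,M,\{T_w\}_{w\in\Lambda},\overline{\phantom{T}}\colon M\to M)$ where (a) $\Lambda$ is a partially ordered set such that $\{v\in\Lambda: v\le w\}$ is finite for each $w\in\Lambda$;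 (b) $M$ is a free $\mathbb{Z}[t^{\frac12},t^{-\frac12}]$-module with basis $\{T_w: w\in\Lambda\}$; (c) $\overline{\phantom{T}}\colon M\to M$ is a $\mathbb{Z}$-module homomorphism such that $\overline{a\cdot m}=\overline{a}\cdot\overline{m}$ and $\overline{\overline{m}}=m$ for $m\in M$, $a\in\mathbb{Z}[t^{\frac12},t^{-\frac12}]$, and $\overline{T_w}=T_w+\sum_{v<w}a_{vw}T_v$ with $a_{vw}\in\mathbb{Z}[t^{\frac12},t^{-\frac12}]$, for $w\in\Lambda$.
   Formalization: The relation |λ⟩ = 0 is added whenever ⟨λ+ρ, α_i^∨⟩ = 0; the stated relation gives only 2|λ⟩ = 0 there, which leaves 2-torsion (already for SL_2, λ = −ρ), so the literal module is not free. *)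

theory Defs
  imports Complex_Main "HOL-Library.Poly_Mapping" "HOL-Algebra.Module" "HOL-Algebra.AbelCoset"
begin

section \<open>Root data and the dot action\<close>

text \<open>
  The lattice of weights is a subset of the real vector space that it spans, so that half the sum
  of the positive roots is available. \<^term>\<open>coroot D \<alpha> x\<close> is the pairing of \<open>x\<close> with the coroot
  of \<open>\<alpha>\<close>; the simple roots are \<open>simple D i\<close> for \<open>1 \<le> i \<le> nsimple D\<close>.
\<close>

record 'v root_data =
  weights :: "'v set"
  roots :: "'v set"
  coroot :: "'v \<Rightarrow> 'v \<Rightarrow> real"
  nsimple :: nat
  simple :: "nat \<Rightarrow> 'v"

definition reflection :: "'v::real_vector root_data \<Rightarrow> 'v \<Rightarrow> 'v \<Rightarrow> 'v" where
  "reflection D \<alpha> x = x - coroot D \<alpha> x *\<^sub>R \<alpha>"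

definition pos_roots :: "'v::real_vector root_data \<Rightarrow> 'v set" where
  "pos_roots D = {\<beta> \<in> roots D. \<exists>c :: nat \<Rightarrow> nat. \<beta> = (\<Sum>i = 1..nsimple D. real (c i) *\<^sub>R simple D i)}"

text \<open>A reduced root datum together with a choice of simple roots.\<close>

locale root_datum =
  fixes D :: "'v::real_vector root_data"
  assumes lattice: "\<exists>B. finite B \<and> independent B \<and> span B = UNIV \<and>
      weights D = {\<Sum>b\<in>B. real_of_int (c b) *\<^sub>R b | c. True}"
    and finite_roots: "finite (roots D)"
    and roots_weights: "roots D \<subseteq> weights D"
    and coroot_linear: "\<alpha> \<in> roots D \<Longrightarrow> linear (coroot D \<alpha>)"
    and coroot_integral: "\<alpha> \<in> roots D \<Longrightarrow> x \<in> weights D \<Longrightarrow> coroot D \<alpha> x \<in> \<int>"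
    and coroot_self: "\<alpha> \<in> roots D \<Longrightarrow> coroot D \<alpha> \<alpha> = 2"
    and coroot_inj: "inj_on (coroot D) (roots D)"
    and reflection_roots: "\<alpha> \<in> roots D \<Longrightarrow> reflection D \<alpha> ` roots D = roots D"
    and reflection_coroots: "\<alpha> \<in> roots D \<Longrightarrow>
      (\<lambda>f x. f x - f \<alpha> * coroot D \<alpha> x) ` coroot D ` roots D = coroot D ` roots D"
    and reduced: "\<alpha> \<in> roots D \<Longrightarrow> c *\<^sub>R \<alpha> \<in> roots D \<Longrightarrow> c = 1 \<or> c = -1"
    and simple_inj: "inj_on (simple D) {1..nsimple D}"
    and simple_roots: "simple D ` {1..nsimple D} \<subseteq> roots D"
    and simple_independent: "independent (simple D ` {1..nsimple D})"
    and simple_base: "\<beta> \<in> roots D \<Longrightarrow> \<beta> \<in> pos_roots D \<or> - \<beta> \<in> pos_roots D"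

definition simple_refl :: "'v::real_vector root_data \<Rightarrow> nat \<Rightarrow> 'v \<Rightarrow> 'v" where
  "simple_refl D i = reflection D (simple D i)"

definition word_prod :: "'v::real_vector root_data \<Rightarrow> nat list \<Rightarrow> 'v \<Rightarrow> 'v" where
  "word_prod D is = foldr (\<lambda>i w. simple_refl D i \<circ> w) is id"

definition weyl_group :: "'v::real_vector root_data \<Rightarrow> ('v \<Rightarrow> 'v) set" where
  "weyl_group D = word_prod D ` lists {1..nsimple D}"

definition weyl_length :: "'v::real_vector root_data \<Rightarrow> ('v \<Rightarrow> 'v) \<Rightarrow> nat" where
  "weyl_length D w = (LEAST k. \<exists>is \<in> lists {1..nsimple D}. length is = k \<and> word_prod D is = w)"

definition longest :: "'v::real_vector root_data \<Rightarrow> 'v \<Rightarrow> 'v" where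
  "longest D = (THE w. w \<in> weyl_group D \<and> (\<forall>v \<in> weyl_group D. weyl_length D v \<le> weyl_length D w))"

definition rho :: "'v::real_vector root_data \<Rightarrow> 'v" where
  "rho D = (1/2) *\<^sub>R (\<Sum>\<alpha> \<in> pos_roots D. \<alpha>)"

definition dot :: "'v::real_vector root_data \<Rightarrow> ('v \<Rightarrow> 'v) \<Rightarrow> 'v \<Rightarrow> 'v" where
  "dot D w \<mu> = w (\<mu> + rho D) - rho D"

definition shifted_pairing :: "'v::real_vector root_data \<Rightarrow> 'v \<Rightarrow> 'v \<Rightarrow> real" where
  "shifted_pairing D \<mu> \<alpha> = coroot D \<alpha> (\<mu> + rho D)"

definition dominant :: "'v::real_vector root_data \<Rightarrow> 'v set" where
  "dominant D = {\<mu> \<in> weights D. \<forall>i \<in> {1..nsimple D}. shifted_pairing D \<mu> (simple D i) > 0}"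

definition dominance_order :: "'v::real_vector root_data \<Rightarrow> ('v \<times> 'v) set" where
  "dominance_order D = {(\<nu>, \<mu>). \<nu> \<in> dominant D \<and> \<mu> \<in> dominant D \<and>
     (\<exists>c :: 'v \<Rightarrow> nat. \<nu> = \<mu> - (\<Sum>\<alpha> \<in> pos_roots D. real (c \<alpha>) *\<^sub>R \<alpha>))}"

section \<open>Laurent polynomials\<close>

text \<open>
  The ring of Laurent polynomials in \<open>t\<^bsup>1/2\<^esup>\<close> with integer coefficients is the group ring of the
  integers; the key \<open>k\<close> stands for the exponent of \<open>t\<^bsup>1/2\<^esup>\<close>.
\<close>

type_synonym laurent = "int \<Rightarrow>\<^sub>0 int"

definition t_half :: laurent where
  "t_half = Poly_Mapping.single 1 1"

definition t_half_inv :: laurent where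
  "t_half_inv = Poly_Mapping.single (-1) 1"

definition laurent_bar :: "laurent \<Rightarrow> laurent" where
  "laurent_bar = Poly_Mapping.map_key uminus"

definition laurent_ring :: "laurent ring" where
  "laurent_ring = \<lparr>carrier = UNIV, mult = (*), one = 1, zero = 0, add = (+)\<rparr>"

section \<open>Free modules, quotients and generators and relations\<close>

text \<open>
  The record type of modules extends that of rings; the fields \<^const>\<open>mult\<close> and \<^const>\<open>one\<close> play no
  role for modules and are left undefined.
\<close>

definition free_module :: "'i set \<Rightarrow> (laurent, 'i \<Rightarrow>\<^sub>0 laurent) module" where
  "free_module X = \<lparr>carrier = {f. Poly_Mapping.keys f \<subseteq> X}, mult = undefined, one = undefined,
     zero = 0, add = (+), smult = (\<lambda>a. Poly_Mapping.map ((*) a))\<rparr>"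

definition submodule_generated ::
    "('r, 'x) ring_scheme \<Rightarrow> ('r, 'm, 'y) module_scheme \<Rightarrow> 'm set \<Rightarrow> 'm set" where
  "submodule_generated R M S = \<Inter>{N. submodule N R M \<and> S \<subseteq> N}"

definition quotient_module ::
    "('r, 'm, 'y) module_scheme \<Rightarrow> 'm set \<Rightarrow> ('r, 'm set) module" where
  "quotient_module M N = \<lparr>carrier = a_rcosets\<^bsub>M\<^esub> N, mult = undefined, one = undefined,
     zero = N, add = (<+>\<^bsub>M\<^esub>), smult = (\<lambda>a C. \<Union>m \<in> C. N +>\<^bsub>M\<^esub> (a \<odot>\<^bsub>M\<^esub> m))\<rparr>"

definition is_basis ::
    "('r, 'x) ring_scheme \<Rightarrow> ('r, 'm, 'y) module_scheme \<Rightarrow> 'i set \<Rightarrow> ('i \<Rightarrow> 'm) \<Rightarrow> bool" where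
  "is_basis R M I T \<longleftrightarrow> T \<in> I \<rightarrow> carrier M \<and>
     (\<forall>m \<in> carrier M. \<exists>!c. c \<in> I \<rightarrow> carrier R \<and> (\<forall>i. i \<notin> I \<longrightarrow> c i = \<zero>\<^bsub>R\<^esub>) \<and>
        finite {i. c i \<noteq> \<zero>\<^bsub>R\<^esub>} \<and> m = (\<Oplus>\<^bsub>M\<^esub> i \<in> {i. c i \<noteq> \<zero>\<^bsub>R\<^esub>}. c i \<odot>\<^bsub>M\<^esub> T i))"

section \<open>KL-modules\<close>

text \<open>The partial order on \<open>\<Lambda>\<close> is the set \<open>r\<close> of pairs \<open>(v, w)\<close> with \<open>v \<le> w\<close>.\<close>

definition KL_module :: "'i set \<Rightarrow> ('i \<times> 'i) set \<Rightarrow> (laurent, 'm, 'y) module_scheme \<Rightarrow>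
    ('i \<Rightarrow> 'm) \<Rightarrow> ('m \<Rightarrow> 'm) \<Rightarrow> bool" where
  "KL_module \<Lambda> r M T bar \<longleftrightarrow>
     partial_order_on \<Lambda> r \<and> (\<forall>w \<in> \<Lambda>. finite {v \<in> \<Lambda>. (v, w) \<in> r}) \<and>
     Module.module laurent_ring M \<and> is_basis laurent_ring M \<Lambda> T \<and>
     bar \<in> hom (add_monoid M) (add_monoid M) \<and>
     (\<forall>a. \<forall>m \<in> carrier M. bar (a \<odot>\<^bsub>M\<^esub> m) = laurent_bar a \<odot>\<^bsub>M\<^esub> bar m) \<and>
     (\<forall>m \<in> carrier M. bar (bar m) = m) \<and>
     (\<forall>w \<in> \<Lambda>. \<exists>a :: 'i \<Rightarrow> laurent. bar (T w) =
        T w \<oplus>\<^bsub>M\<^esub> (\<Oplus>\<^bsub>M\<^esub> v \<in> {v \<in> \<Lambda>. (v, w) \<in> r \<and> v \<noteq> w}. a v \<odot>\<^bsub>M\<^esub> T v))"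

section \<open>The abstract Fock space\<close>

definition symbol :: "'v \<Rightarrow> 'v \<Rightarrow>\<^sub>0 laurent" where
  "symbol \<mu> = Poly_Mapping.single \<mu> 1"

text \<open>
  Every relation \<open>x = y\<close> is encoded as the element \<open>x - y\<close> of the free module on the symbols. If
  \<open>\<langle>\<mu> + \<rho>, \<alpha>\<^sub>i\<^sup>\<or>\<rangle> = 0\<close>, then \<open>s\<^sub>i \<circ> \<mu> = \<mu>\<close> and the first straightening relation becomes
  \<open>|\<mu>\<rangle> = -|\<mu>\<rangle>\<close>. It is read as \<open>|\<mu>\<rangle> = 0\<close>, which is the content of \<open>wall_relations\<close>; over the integers
  the bare relation \<open>2|\<mu>\<rangle> = 0\<close> would leave a nonzero element of order 2 (already in rank one),
  and the Fock space would not be free.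
\<close>

definition straightening_relations ::
    "'v::real_vector root_data \<Rightarrow> nat \<Rightarrow> ('v \<Rightarrow>\<^sub>0 laurent) set" where
  "straightening_relations D l =
     (let s = (\<lambda>i. dot D (simple_refl D i));
          p = (\<lambda>\<mu> i. shifted_pairing D \<mu> (simple D i));
          t = (\<lambda>x. t_half \<odot>\<^bsub>free_module (weights D)\<^esub> x)
      in {symbol (s i \<mu>) - (- symbol \<mu>) | \<mu> i.
            \<mu> \<in> weights D \<and> i \<in> {1..nsimple D} \<and> (\<exists>k :: nat. p \<mu> i = real l * real k)}
       \<union> {symbol (s i \<mu>) - (- t (symbol \<mu>)) | \<mu> i.
            \<mu> \<in> weights D \<and> i \<in> {1..nsimple D} \<and> 0 < p \<mu> i \<and> p \<mu> i < real l}
       \<union> {symbol (s i \<mu>) - (- t (symbol (s i \<mu>1)) - symbol \<mu>1 - t (symbol \<mu>)) | \<mu> \<mu>1 i.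
            \<mu> \<in> weights D \<and> i \<in> {1..nsimple D} \<and>
            p \<mu> i > real l \<and> (\<nexists>k :: int. p \<mu> i = real l * real_of_int k) \<and>
            (\<exists>k j :: nat. k > 0 \<and> j \<in> {1..l - 1} \<and> p \<mu> i = real k * real l + real j \<and>
               \<mu>1 = \<mu> - real j *\<^sub>R simple D i)})"

definition wall_relations :: "'v::real_vector root_data \<Rightarrow> ('v \<Rightarrow>\<^sub>0 laurent) set" where
  "wall_relations D = {symbol \<mu> | \<mu> i.
     \<mu> \<in> weights D \<and> i \<in> {1..nsimple D} \<and> shifted_pairing D \<mu> (simple D i) = 0}"

definition fock_submodule :: "'v::real_vector root_data \<Rightarrow> nat \<Rightarrow> ('v \<Rightarrow>\<^sub>0 laurent) set" where
  "fock_submodule D l = submodule_generated laurent_ring (free_module (weights D))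
     (straightening_relations D l \<union> wall_relations D)"

definition fock :: "'v::real_vector root_data \<Rightarrow> nat \<Rightarrow> (laurent, ('v \<Rightarrow>\<^sub>0 laurent) set) module" where
  "fock D l = quotient_module (free_module (weights D)) (fock_submodule D l)"

definition ket :: "'v::real_vector root_data \<Rightarrow> nat \<Rightarrow> 'v \<Rightarrow> ('v \<Rightarrow>\<^sub>0 laurent) set" where
  "ket D l \<mu> = fock_submodule D l +>\<^bsub>free_module (weights D)\<^esub> symbol \<mu>"

definition wall_count :: "'v::real_vector root_data \<Rightarrow> nat \<Rightarrow> 'v \<Rightarrow> nat" where
  "wall_count D l \<mu> =
     card {\<alpha> \<in> pos_roots D. \<exists>k :: int. shifted_pairing D \<mu> \<alpha> = real l * real_of_int k}"

text \<open>
  Involutivity is not part of the following specification: it belongs to \<^const>\<open>KL_module\<close>. Maps are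
  \<^const>\<open>extensional\<close> so that equality of functions is equality on the Fock space. The subtraction
  of natural numbers does not truncate, because \<open>\<ell>(w\<^sub>0)\<close> is the number of positive roots.
\<close>

definition is_fock_bar :: "'v::real_vector root_data \<Rightarrow> nat \<Rightarrow>
    (('v \<Rightarrow>\<^sub>0 laurent) set \<Rightarrow> ('v \<Rightarrow>\<^sub>0 laurent) set) \<Rightarrow> bool" where
  "is_fock_bar D l b \<longleftrightarrow>
     b \<in> extensional (carrier (fock D l)) \<and>
     b \<in> hom (add_monoid (fock D l)) (add_monoid (fock D l)) \<and>
     (\<forall>a. \<forall>m \<in> carrier (fock D l).
        b (a \<odot>\<^bsub>fock D l\<^esub> m) = laurent_bar a \<odot>\<^bsub>fock D l\<^esub> b m) \<and>
     (\<forall>\<mu> \<in> weights D. b (ket D l \<mu>) =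
        ((- 1) ^ weyl_length D (longest D) *
           t_half_inv ^ (weyl_length D (longest D) - wall_count D l \<mu>))
          \<odot>\<^bsub>fock D l\<^esub> ket D l (dot D (longest D) \<mu>))"

definition fock_bar :: "'v::real_vector root_data \<Rightarrow> nat \<Rightarrow>
    ('v \<Rightarrow>\<^sub>0 laurent) set \<Rightarrow> ('v \<Rightarrow>\<^sub>0 laurent) set" where
  "fock_bar D l = (THE b. is_fock_bar D l b)"

end

theory Submission
  imports Defs
begin

text \<open>
  Write \<open>q\<close> for the generator \<open>t\<^bsup>1/2\<^esup>\<close>. The dominant kets span because the relations are rewriting rules: a
  weight \<open>\<mu>\<close> for which \<open>\<mu> + \<rho>\<close> is negative on a simple coroot is replaced by weights whose shift by \<open>\<rho>\<close> is
  shorter, and by one whose shift has the same length and is negative on fewer positive roots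
  (\<open>straighten\<close>). Along a reduced word of \<open>w\<^sub>0\<close> the rules express \<open>|w\<^sub>0 \<circ> \<xi>\<rangle>\<close> for dominant \<open>\<xi>\<close> as \<open>c |\<xi>\<rangle>\<close> plus lower
  dominant kets, where \<open>c\<close> is a product of factors \<open>-1\<close> and \<open>- q\<close>, one for each positive root (\<open>triangular\<close>);
  the normalising factor of the bar involution is the inverse of \<open>c\<close> (\<open>coef_prod\<close>). The bar involution
  exists because its formula on symbols maps every relation to a multiple of a relation
  (\<open>barF_rels\<close>).

  The linear independence of the dominant kets is the deep part: the relations for different simple
  roots must not imply too much. Functionals on the free module of symbols are constructed that
  vanish on the relations and separate dominant weights. They come from the affine Hecke algebra,
  which enters only through operators on functions on the extended affine Weyl group, that is, on
  alcoves. The left operators \<open>Lop\<close> and the right operators \<open>Rop\<close> of simple affine reflections commute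
  (\<open>Lop_Rop_commute\<close>). Alternating sums over the finite Weyl group kill the image of \<open>Lop + q\<close> for a finite
  simple reflection (\<open>sign_sum_Lop\<close>), and hence this image lies in a space \<open>K\<close> that is stable under right
  operators.

  Every alcove \<open>A\<close> has a vector \<open>e(A)\<close> with respect to a base alcove far out in the dominant chamber: a delta
  function at the position of \<open>A\<close> relative to that base, carried back to the fundamental alcove by
  inverse left operators (\<open>transport\<close>, \<open>periodic\<close>). These vectors behave like the elements of the periodic
  Hecke module: to cross a wall of \<open>A\<close> is to apply a right operator or its inverse, according to the
  direction of the wall (\<open>cross\<close>). Modulo \<open>K\<close> they satisfy \<open>e(s\<^sub>i A) + q e(A) = 0\<close> in the strip next to the wall
  of \<open>\<alpha>\<^sub>i\<close> (\<open>rel0_strip\<close>), and induction on the strip gives the four-term relation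
  \<open>e(s\<^sub>i A) + q e(A) + e(r A) + q e(s\<^sub>i r A) = 0\<close>, where \<open>r\<close> is the reflection in the lower boundary of the strip of
  \<open>A\<close> (\<open>rel_strip\<close>). These are the straightening relations of alcoves. A weight \<open>\<mu>\<close> becomes the point
  \<open>(\<mu> + \<rho>) / l\<close>, and the sum over the alcoves around a point, with suitable powers of \<open>q\<close>, satisfies the
  straightening relations of weights, including those on walls (\<open>F_relation_wall\<close>, \<open>F_relation_zero\<close>).

  Each relation holds only for base alcoves that are far enough, but an element of the submodule of
  relations involves finitely many of them, so that it is killed by all functionals with a far
  base alcove (\<open>N_eventually_zero\<close>). At \<open>t = 1\<close> the vector of \<open>A\<close> becomes the delta function at \<open>A\<close>, whatever
  the base alcove is, and the functionals become dual to the dominant points (\<open>F_ev\<close>). Hence all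
  coefficients of a relation between dominant kets are divisible by \<open>q - 1\<close> arbitrarily often, and
  vanish (\<open>independent_if_identity_at_1\<close>, \<open>dominant_independent\<close>).
\<close>

section \<open>Roots, coroots and the invariant form\<close>

context root_datum
begin

abbreviation pairing :: "'v \<Rightarrow> 'v \<Rightarrow> real" (\<open>\<langle>_, _\<rangle>\<close>) where
  "\<langle>x, \<alpha>\<rangle> \<equiv> coroot D \<alpha> x"

abbreviation refl :: "'v \<Rightarrow> 'v \<Rightarrow> 'v" where
  "refl \<equiv> reflection D"

abbreviation R where "R \<equiv> roots D"
abbreviation P where "P \<equiv> pos_roots D"
abbreviation W where "W \<equiv> weyl_group D"
definition I where "I = {1..nsimple D}"
abbreviation s where "s \<equiv> simple_refl D"
abbreviation sr where "sr \<equiv> simple D"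

lemma refl_def: "refl \<alpha> x = x - \<langle>x, \<alpha>\<rangle> *\<^sub>R \<alpha>"
  by (simp add: reflection_def)

lemma s_def: "s i = refl (sr i)"
  by (simp add: simple_refl_def)

lemma pairing_simps:
  assumes "\<alpha> \<in> R"
  shows "\<langle>x + y, \<alpha>\<rangle> = \<langle>x, \<alpha>\<rangle> + \<langle>y, \<alpha>\<rangle>" "\<langle>x - y, \<alpha>\<rangle> = \<langle>x, \<alpha>\<rangle> - \<langle>y, \<alpha>\<rangle>"
    "\<langle>c *\<^sub>R x, \<alpha>\<rangle> = c * \<langle>x, \<alpha>\<rangle>" "\<langle>- x, \<alpha>\<rangle> = - \<langle>x, \<alpha>\<rangle>" "\<langle>0, \<alpha>\<rangle> = 0"
    "\<langle>sum f A, \<alpha>\<rangle> = (\<Sum>a\<in>A. \<langle>f a, \<alpha>\<rangle>)"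
  using coroot_linear[OF assms]
  by (simp_all add: linear_add linear_diff linear_scale linear_neg linear_0 linear_sum)

lemma pairing_int: "\<alpha> \<in> R \<Longrightarrow> x \<in> weights D \<Longrightarrow> \<langle>x, \<alpha>\<rangle> \<in> \<int>"
  by (rule coroot_integral)

lemma root_pairing_int: "\<alpha> \<in> R \<Longrightarrow> \<beta> \<in> R \<Longrightarrow> \<langle>\<beta>, \<alpha>\<rangle> \<in> \<int>"
  using roots_weights by (auto intro: coroot_integral)

lemma root_nonzero: "\<alpha> \<in> R \<Longrightarrow> \<alpha> \<noteq> 0"
  using coroot_self[of \<alpha>] pairing_simps(5)[of \<alpha>] by auto

lemma refl_linear: "\<alpha> \<in> R \<Longrightarrow> linear (refl \<alpha>)"
  by (rule linearI) (auto simp: refl_def pairing_simps algebra_simps)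

lemma refl_invol: "\<alpha> \<in> R \<Longrightarrow> refl \<alpha> (refl \<alpha> x) = x"
  by (simp add: refl_def pairing_simps coroot_self algebra_simps flip: scaleR_left.add)

lemma refl_self: "\<alpha> \<in> R \<Longrightarrow> refl \<alpha> \<alpha> = - \<alpha>"
  by (simp add: refl_def coroot_self scaleR_2)

lemma refl_root: "\<alpha> \<in> R \<Longrightarrow> \<beta> \<in> R \<Longrightarrow> refl \<alpha> \<beta> \<in> R"
  using reflection_roots by blast

lemma uminus_root: "\<alpha> \<in> R \<Longrightarrow> - \<alpha> \<in> R"
  using refl_root[of \<alpha> \<alpha>] by (simp add: refl_self)

lemma finite_arith_progression:
  fixes a v :: "'a::real_vector"
  assumes "finite S" "\<And>k::nat. a + (real k * c) *\<^sub>R v \<in> S" "c \<noteq> 0"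
  shows "v = 0"
proof (rule ccontr)
  assume "v \<noteq> 0"
  then have "inj (\<lambda>k::nat. a + (real k * c) *\<^sub>R v)"
    using assms(3) by (auto intro!: injI)
  moreover have "range (\<lambda>k::nat. a + (real k * c) *\<^sub>R v) \<subseteq> S" using assms(2) by auto
  ultimately show False
    using assms(1) finite_imageD finite_subset infinite_UNIV_nat by blast
qed

text \<open>
  Two different coroots cannot agree on all roots: for \<open>v = \<beta> - \<gamma>\<close> the product of the two
  reflections moves the root \<open>\<gamma> + k v\<close> to \<open>\<gamma> + (k + 2) v\<close>, and there are only finitely many roots.
\<close>

lemma root_eqI_coroots_agree:
  assumes "\<beta> \<in> R" "\<gamma> \<in> R" "\<And>x. x \<in> R \<Longrightarrow> \<langle>x, \<beta>\<rangle> = \<langle>x, \<gamma>\<rangle>"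
  shows "\<beta> = \<gamma>"
proof -
  define v where "v = \<beta> - \<gamma>"
  have v0: "\<langle>v, \<beta>\<rangle> = 0" "\<langle>v, \<gamma>\<rangle> = 0"
    using assms by (simp_all add: v_def pairing_simps coroot_self flip: assms(3)) 
      (metis assms coroot_self diff_self)+
  have g2: "\<langle>\<gamma>, \<beta>\<rangle> = 2" using assms coroot_self by metis
  have step: "\<gamma> + (real k * 2) *\<^sub>R v \<in> R" for k :: nat
  proof (induction k)
    case 0 then show ?case using assms by simp
  next
    case (Suc k)
    have "refl \<beta> (refl \<gamma> (\<gamma> + (real k * 2) *\<^sub>R v)) = \<gamma> + (real (Suc k) * 2) *\<^sub>R v"
      using assms v0 g2
      by (simp add: refl_def pairing_simps coroot_self v_def algebra_simps scaleR_2)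
    then show ?case using Suc assms refl_root by metis
  qed
  have "v = 0" by (rule finite_arith_progression[OF finite_roots step]) simp
  then show ?thesis by (simp add: v_def)
qed

lemma coroot_refl_aux:
  assumes "\<alpha> \<in> R" "\<beta> \<in> R" "x \<in> R"
  shows "\<langle>x, refl \<alpha> \<beta>\<rangle> = \<langle>refl \<alpha> x, \<beta>\<rangle>"
proof -
  let ?b = "refl \<alpha> \<beta>"
  have b: "?b \<in> R" using assms refl_root by blast
  define g where "g = (\<lambda>x. \<langle>x, ?b\<rangle> - \<langle>refl \<alpha> x, \<beta>\<rangle>)"
  have gb: "g ?b = 0" using assms b by (simp add: g_def refl_invol coroot_self)
  have glin: "g (y + c *\<^sub>R z) = g y + c * g z" for y c z
    using assms b by (simp add: g_def refl_def pairing_simps algebra_simps)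
  \<comment> \<open>the product of the two reflections that negate \<open>refl \<alpha> \<beta>\<close> is a transvection\<close>
  have u: "refl ?b (refl \<alpha> (refl \<beta> (refl \<alpha> y))) = y - g y *\<^sub>R ?b" for y
  proof -
    have "refl \<alpha> (refl \<beta> (refl \<alpha> y)) = y - \<langle>refl \<alpha> y, \<beta>\<rangle> *\<^sub>R ?b"
      using assms refl_linear[of \<alpha>] by (simp add: refl_def[of \<beta>] linear_diff linear_scale refl_invol)
    moreover have "refl ?b (y - c *\<^sub>R ?b) = y - (\<langle>y, ?b\<rangle> - c) *\<^sub>R ?b" for c
      unfolding refl_def[of ?b "y - c *\<^sub>R ?b"] pairing_simps[OF b] coroot_self[OF b]
      by (simp add: algebra_simps) (simp flip: scaleR_add_left add: scaleR_2)
    ultimately show ?thesis by (simp add: g_def)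
  qed
  have step: "x + (real k * (-1)) *\<^sub>R (g x *\<^sub>R ?b) \<in> R" for k :: nat
  proof (induction k)
    case 0 then show ?case using assms by simp
  next
    case (Suc k)
    have "refl ?b (refl \<alpha> (refl \<beta> (refl \<alpha> (x + (real k * (-1)) *\<^sub>R (g x *\<^sub>R ?b))))) =
        x + (real (Suc k) * (-1)) *\<^sub>R (g x *\<^sub>R ?b)"
      unfolding u using gb glin[of x "real k * (-1) * g x" ?b] by (simp add: algebra_simps)
    then show ?case using Suc assms b refl_root by metis
  qed
  have "g x *\<^sub>R ?b = 0" by (rule finite_arith_progression[OF finite_roots step]) simp
  then show ?thesis using root_nonzero[OF b] by (simp add: g_def)
qed

text \<open>
  Only the set of coroots is assumed to be stable under the dual reflections. The reflected coroot
  agrees on roots with the coroot of the reflected root, because otherwise a transvection would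
  act on the finite set of roots; the previous lemma then identifies the two.
\<close>

lemma coroot_refl:
  assumes "\<alpha> \<in> R" "\<beta> \<in> R"
  shows "\<langle>x, refl \<alpha> \<beta>\<rangle> = \<langle>refl \<alpha> x, \<beta>\<rangle>"
proof -
  have eq: "(\<lambda>x. \<langle>x, \<beta>\<rangle> - \<langle>\<alpha>, \<beta>\<rangle> * \<langle>x, \<alpha>\<rangle>) = (\<lambda>x. \<langle>refl \<alpha> x, \<beta>\<rangle>)"
    using assms by (auto simp: refl_def pairing_simps)
  have "(\<lambda>x. \<langle>refl \<alpha> x, \<beta>\<rangle>) \<in> coroot D ` R"
    using reflection_coroots[OF assms(1)] assms(2) by (force simp flip: eq)
  then obtain \<gamma> where g: "\<gamma> \<in> R" "coroot D \<gamma> = (\<lambda>x. \<langle>refl \<alpha> x, \<beta>\<rangle>)" by auto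
  have "refl \<alpha> \<beta> = \<gamma>"
    using assms g coroot_refl_aux by (intro root_eqI_coroots_agree) (auto intro: refl_root)
  then show ?thesis using g by metis
qed

lemma coroot_uminus: "\<alpha> \<in> R \<Longrightarrow> \<langle>x, - \<alpha>\<rangle> = - \<langle>x, \<alpha>\<rangle>"
  using coroot_refl[of \<alpha> \<alpha> x] refl_self[of \<alpha>] refl_def[of \<alpha> x] by (simp add: pairing_simps coroot_self)

lemma pairing_refl: "\<alpha> \<in> R \<Longrightarrow> \<beta> \<in> R \<Longrightarrow> \<langle>refl \<alpha> x, \<beta>\<rangle> = \<langle>x, \<beta>\<rangle> - \<langle>x, \<alpha>\<rangle> * \<langle>\<alpha>, \<beta>\<rangle>"
  by (simp add: refl_def pairing_simps)

lemma refl_uminus: "\<alpha> \<in> R \<Longrightarrow> refl (- \<alpha>) = refl \<alpha>"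
  by (auto simp: refl_def coroot_uminus)

lemma refl_conj:
  assumes "\<alpha> \<in> R" "\<beta> \<in> R"
  shows "refl (refl \<alpha> \<beta>) (refl \<alpha> x) = refl \<alpha> (refl \<beta> x)"
  using assms refl_linear[of \<alpha>]
  by (simp add: refl_def[of "refl \<alpha> \<beta>"] refl_def[of \<beta>] coroot_refl refl_invol linear_diff linear_scale)

lemma bij_refl: "\<alpha> \<in> R \<Longrightarrow> bij_betw (refl \<alpha>) R R"
  by (rule bij_betw_byWitness[where f'="refl \<alpha>"]) (auto simp: refl_invol refl_root)

text \<open>
  The invariant scalar product, obtained by summing over all coroots. It is positive on roots and in
  general only semidefinite on the whole space.
\<close>

definition form :: "'v \<Rightarrow> 'v \<Rightarrow> real" where
  "form x y = (\<Sum>\<gamma>\<in>R. \<langle>x, \<gamma>\<rangle> * \<langle>y, \<gamma>\<rangle>)"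

lemma form_simps:
  "form (x + y) z = form x z + form y z" "form z (x + y) = form z x + form z y"
  "form (x - y) z = form x z - form y z" "form z (x - y) = form z x - form z y"
  "form (c *\<^sub>R x) z = c * form x z" "form z (c *\<^sub>R x) = c * form z x"
  "form (- x) z = - form x z" "form z (- x) = - form z x"
  unfolding form_def
  by (simp_all add: pairing_simps algebra_simps sum.distrib sum_subtractf sum_distrib_left sum_negf
      cong: sum.cong)

lemma form_sum: "form z (sum f A) = (\<Sum>a\<in>A. form z (f a))"
proof -
  have "form z (sum f A) = (\<Sum>\<gamma>\<in>R. \<Sum>a\<in>A. \<langle>z, \<gamma>\<rangle> * \<langle>f a, \<gamma>\<rangle>)"
    unfolding form_def by (intro sum.cong refl) (simp add: pairing_simps sum_distrib_left)
  also have "\<dots> = (\<Sum>a\<in>A. \<Sum>\<gamma>\<in>R. \<langle>z, \<gamma>\<rangle> * \<langle>f a, \<gamma>\<rangle>)" by (rule sum.swap)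
  finally show ?thesis by (simp add: form_def)
qed

lemma form_commute: "form x y = form y x"
  by (simp add: form_def mult.commute)

lemma form_refl: "\<alpha> \<in> R \<Longrightarrow> form (refl \<alpha> x) (refl \<alpha> y) = form x y"
  unfolding form_def
  using sum.reindex_bij_betw[OF bij_refl, of \<alpha> "\<lambda>\<gamma>. \<langle>x, \<gamma>\<rangle> * \<langle>y, \<gamma>\<rangle>"]
  by (simp add: coroot_refl cong: sum.cong)

lemma form_root_pos: "\<alpha> \<in> R \<Longrightarrow> form \<alpha> \<alpha> > 0"
  unfolding form_def
  by (rule sum_pos2[OF finite_roots, of \<alpha>]) (auto simp: coroot_self)

lemma form_root: "\<alpha> \<in> R \<Longrightarrow> 2 * form x \<alpha> = \<langle>x, \<alpha>\<rangle> * form \<alpha> \<alpha>"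
  using form_refl[of \<alpha> "x" "\<alpha>"] by (simp add: refl_self form_simps) (simp add: refl_def form_simps)

lemma pairing_sign_symmetric:
  assumes "\<alpha> \<in> R" "\<beta> \<in> R"
  shows "\<langle>\<alpha>, \<beta>\<rangle> > 0 \<longleftrightarrow> \<langle>\<beta>, \<alpha>\<rangle> > 0" "\<langle>\<alpha>, \<beta>\<rangle> = 0 \<longleftrightarrow> \<langle>\<beta>, \<alpha>\<rangle> = 0"
proof -
  have "\<langle>\<alpha>, \<beta>\<rangle> * form \<beta> \<beta> = \<langle>\<beta>, \<alpha>\<rangle> * form \<alpha> \<alpha>"
    using form_root[OF assms(1), of \<beta>] form_root[OF assms(2), of \<alpha>] form_commute by metis
  then show "\<langle>\<alpha>, \<beta>\<rangle> > 0 \<longleftrightarrow> \<langle>\<beta>, \<alpha>\<rangle> > 0" "\<langle>\<alpha>, \<beta>\<rangle> = 0 \<longleftrightarrow> \<langle>\<beta>, \<alpha>\<rangle> = 0"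
    using form_root_pos[OF assms(1)] form_root_pos[OF assms(2)]
    by (metis zero_less_mult_pos2 zero_less_mult_iff less_asym, metis mult_eq_0_iff less_irrefl)
qed

section \<open>Positive roots\<close>

lemma finite_I [simp]: "finite I"
  by (simp add: I_def)

lemma simple_root: "i \<in> I \<Longrightarrow> sr i \<in> R"
  using simple_roots by (auto simp: I_def)

lemma pos_root: "\<beta> \<in> P \<Longrightarrow> \<beta> \<in> R"
  by (simp add: pos_roots_def)

lemma finite_pos: "finite P"
  by (rule finite_subset[OF _ finite_roots]) (auto simp: pos_root)

text \<open>
  The coordinate of a simple root, extended in an arbitrary way beyond the span of the roots.
\<close>

definition simple_coord :: "nat \<Rightarrow> 'v \<Rightarrow> real" where
  "simple_coord i = (SOME g. linear g \<and> (\<forall>j\<in>I. g (sr j) = (if j = i then 1 else 0)))"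

lemma simple_coord: "linear (simple_coord i)" "j \<in> I \<Longrightarrow> simple_coord i (sr j) = (if j = i then 1 else 0)"
proof -
  obtain g :: "'v \<Rightarrow> real" where g: "linear g"
    "\<forall>x \<in> sr ` I. g x = (if inv_into I sr x = i then 1 else 0)"
    using linear_independent_extend[OF simple_independent, of "\<lambda>x. if inv_into I sr x = i then 1 else 0"]
    unfolding I_def by blast
  have "linear g \<and> (\<forall>j\<in>I. g (sr j) = (if j = i then 1 else 0))"
    using g inv_into_f_f[OF simple_inj] unfolding I_def by auto
  then have "linear (simple_coord i) \<and> (\<forall>j\<in>I. simple_coord i (sr j) = (if j = i then 1 else 0))"
    unfolding simple_coord_def by (rule someI[where P="\<lambda>g. linear g \<and> (\<forall>j\<in>I. g (sr j) = (if j = i then 1 else 0))"])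
  then show "linear (simple_coord i)" "j \<in> I \<Longrightarrow> simple_coord i (sr j) = (if j = i then 1 else 0)" by auto
qed

lemma simple_coord_simps: "simple_coord i (x + y) = simple_coord i x + simple_coord i y" "simple_coord i (x - y) = simple_coord i x - simple_coord i y"
  "simple_coord i (c *\<^sub>R x) = c * simple_coord i x" "simple_coord i (- x) = - simple_coord i x" "simple_coord i 0 = 0"
  "simple_coord i (sum f A) = (\<Sum>a\<in>A. simple_coord i (f a))"
  using simple_coord(1)[of i] by (simp_all add: linear_add linear_diff linear_scale linear_neg linear_0 linear_sum)

lemma simple_coord_comb: "i \<in> I \<Longrightarrow> simple_coord i (\<Sum>j\<in>I. c j *\<^sub>R sr j) = c i"
  by (simp add: simple_coord_simps simple_coord if_distrib cong: if_cong)

lemma pos_expand: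
  assumes "\<beta> \<in> P"
  shows "\<beta> = (\<Sum>j\<in>I. simple_coord j \<beta> *\<^sub>R sr j)" "i \<in> I \<Longrightarrow> simple_coord i \<beta> \<ge> 0"
proof -
  obtain c :: "nat \<Rightarrow> nat" where c: "\<beta> = (\<Sum>i\<in>I. real (c i) *\<^sub>R sr i)"
    using assms unfolding pos_roots_def I_def by blast
  have leading_factor: "i \<in> I \<Longrightarrow> simple_coord i \<beta> = real (c i)" for i
    unfolding c by (rule simple_coord_comb)
  show "\<beta> = (\<Sum>j\<in>I. simple_coord j \<beta> *\<^sub>R sr j)" using c leading_factor by simp
  show "i \<in> I \<Longrightarrow> simple_coord i \<beta> \<ge> 0" using leading_factor by simp
qed

lemma pos_or_neg: "\<beta> \<in> R \<Longrightarrow> \<beta> \<in> P \<or> - \<beta> \<in> P"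
  by (rule simple_base)

lemma pos_not_neg: "\<beta> \<in> P \<Longrightarrow> - \<beta> \<notin> P"
proof
  assume b: "\<beta> \<in> P" "- \<beta> \<in> P"
  have "simple_coord i \<beta> = 0" if "i \<in> I" for i
    using pos_expand(2)[OF b(1) that] pos_expand(2)[OF b(2) that] by (simp add: simple_coord_simps)
  then have "(\<Sum>j\<in>I. simple_coord j \<beta> *\<^sub>R sr j) = 0" by simp
  then have "\<beta> = 0" using pos_expand(1)[OF b(1)] by argo
  then show False using b(1) pos_root root_nonzero by blast
qed

lemma uminus_pos_iff: "\<beta> \<in> R \<Longrightarrow> - \<beta> \<in> P \<longleftrightarrow> \<beta> \<notin> P"
  using pos_or_neg pos_not_neg by force

lemma pos_if_simple_coord: "\<beta> \<in> R \<Longrightarrow> i \<in> I \<Longrightarrow> simple_coord i \<beta> > 0 \<Longrightarrow> \<beta> \<in> P"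
  using pos_or_neg[of \<beta>] pos_expand(2)[of "- \<beta>" i] by (auto simp: simple_coord_simps)

lemma simple_pos: "i \<in> I \<Longrightarrow> sr i \<in> P"
  by (rule pos_if_simple_coord[of _ i]) (auto simp: simple_root simple_coord)

text \<open>
  The reflection changes only the coordinate of \<open>\<alpha>\<^sub>i\<close>. As the root system is reduced, some other
  coordinate of \<open>\<beta>\<close> is positive, and it decides the sign of the image.
\<close>

lemma s_pos:
  assumes i: "i \<in> I" and b: "\<beta> \<in> P" "\<beta> \<noteq> sr i"
  shows "s i \<beta> \<in> P"
proof -
  have "\<exists>j\<in>I. j \<noteq> i \<and> simple_coord j \<beta> \<noteq> 0"
  proof (rule ccontr)
    assume "\<not> ?thesis"
    then have "(\<Sum>j\<in>I. simple_coord j \<beta> *\<^sub>R sr j) = (\<Sum>j\<in>I. if j = i then simple_coord i \<beta> *\<^sub>R sr i else 0)"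
      by (intro sum.cong) auto
    also have "\<dots> = simple_coord i \<beta> *\<^sub>R sr i" using i by simp
    finally have e: "simple_coord i \<beta> *\<^sub>R sr i = \<beta>" using pos_expand(1)[OF b(1)] by argo
    then have "simple_coord i \<beta> = 1 \<or> simple_coord i \<beta> = -1"
      using reduced[OF simple_root[OF i], of "simple_coord i \<beta>"] pos_root[OF b(1)] unfolding e by blast
    then have "simple_coord i \<beta> = 1" using pos_expand(2)[OF b(1) i] by auto
    then show False using e b(2) by simp
  qed
  then obtain j where j: "j \<in> I" "j \<noteq> i" "simple_coord j \<beta> \<noteq> 0" by blast
  have "simple_coord j (s i \<beta>) = simple_coord j \<beta>" using i j by (simp add: s_def refl_def simple_coord_simps simple_coord)
  then show ?thesis
    using j pos_expand(2)[OF b(1) j(1)] i b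
    by (intro pos_if_simple_coord[of _ j]) (auto simp: s_def intro: refl_root simple_root pos_root)
qed

lemma s_invol: "i \<in> I \<Longrightarrow> s i (s i x) = x"
  by (simp add: s_def refl_invol simple_root)

lemma s_simple: "i \<in> I \<Longrightarrow> s i (sr i) = - sr i"
  by (simp add: s_def refl_self simple_root)

lemma s_root: "i \<in> I \<Longrightarrow> \<beta> \<in> R \<Longrightarrow> s i \<beta> \<in> R"
  by (simp add: s_def refl_root simple_root)

lemma s_linear: "i \<in> I \<Longrightarrow> linear (s i)"
  by (simp add: s_def refl_linear simple_root)

lemma s_not_simple: "i \<in> I \<Longrightarrow> \<beta> \<in> P \<Longrightarrow> s i \<beta> \<noteq> sr i"
  by (metis s_invol s_simple pos_not_neg simple_pos)

lemma s_bij_pos: "i \<in> I \<Longrightarrow> bij_betw (s i) (P - {sr i}) (P - {sr i})"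
  by (rule bij_betw_byWitness[where f'="s i"]) (auto simp: s_invol s_pos s_not_simple)

text \<open>
  The reflection permutes the positive roots other than \<open>\<alpha>\<^sub>i\<close>, so that their sum is orthogonal to the
  simple coroot.
\<close>

lemma rho_simple:
  assumes i: "i \<in> I"
  shows "\<langle>rho D, sr i\<rangle> = 1"
proof -
  define S where "S = (\<Sum>\<alpha>\<in>P - {sr i}. \<alpha>)"
  have tot: "(\<Sum>\<alpha>\<in>P. \<alpha>) = sr i + S"
    unfolding S_def using sum.remove[OF finite_pos simple_pos[OF i]] by auto
  have "s i S = (\<Sum>\<alpha>\<in>P - {sr i}. s i \<alpha>)"
    unfolding S_def using s_linear[OF i] by (simp add: linear_sum)
  also have "\<dots> = S" unfolding S_def
    by (rule sum.reindex_bij_betw[OF s_bij_pos[OF i]])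
  finally have "\<langle>S, sr i\<rangle> *\<^sub>R sr i = 0" by (simp add: s_def refl_def)
  then have "\<langle>S, sr i\<rangle> = 0" using root_nonzero simple_root[OF i] by simp
  then show ?thesis using simple_root[OF i]
    by (simp add: rho_def tot pairing_simps coroot_self)
qed

lemma form_pos_expand: "\<beta> \<in> P \<Longrightarrow> form y \<beta> = (\<Sum>j\<in>I. simple_coord j \<beta> * form y (sr j))"
proof -
  assume b: "\<beta> \<in> P"
  have "form y \<beta> = form y (\<Sum>j\<in>I. simple_coord j \<beta> *\<^sub>R sr j)" using pos_expand(1)[OF b] by (rule arg_cong)
  then show ?thesis by (simp add: form_sum form_simps)
qed

lemma form_sign: "\<alpha> \<in> R \<Longrightarrow> form y \<alpha> > 0 \<longleftrightarrow> \<langle>y, \<alpha>\<rangle> > 0" "\<alpha> \<in> R \<Longrightarrow> form y \<alpha> \<ge> 0 \<longleftrightarrow> \<langle>y, \<alpha>\<rangle> \<ge> 0"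
proof -
  assume a: "\<alpha> \<in> R"
  define c where "c = form \<alpha> \<alpha> / 2"
  have "form y \<alpha> = \<langle>y, \<alpha>\<rangle> * c" using form_root[OF a, of y] by (simp add: c_def)
  moreover have "c > 0" using form_root_pos[OF a] by (simp add: c_def)
  ultimately show "form y \<alpha> > 0 \<longleftrightarrow> \<langle>y, \<alpha>\<rangle> > 0" "form y \<alpha> \<ge> 0 \<longleftrightarrow> \<langle>y, \<alpha>\<rangle> \<ge> 0"
    by (simp_all add: zero_less_mult_iff zero_le_mult_iff)
qed

lemma pos_simple_coord_pos: "\<beta> \<in> P \<Longrightarrow> \<exists>j\<in>I. simple_coord j \<beta> > 0"
proof (rule ccontr)
  assume b: "\<beta> \<in> P" "\<not> (\<exists>j\<in>I. simple_coord j \<beta> > 0)"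
  then have "simple_coord j \<beta> = 0" if "j \<in> I" for j
    using pos_expand(2)[OF b(1) that] that b(2) by force
  then have "(\<Sum>j\<in>I. simple_coord j \<beta> *\<^sub>R sr j) = 0" by simp
  then have "\<beta> = 0" using pos_expand(1)[OF b(1)] by argo
  then show False using b(1) pos_root root_nonzero by blast
qed

text \<open>
  A pairing with a coroot is a positive multiple of a value of the invariant form, and the form is
  linear in the root, which has nonnegative coordinates.
\<close>

lemma dominant_pairing_pos:
  assumes "\<And>i. i \<in> I \<Longrightarrow> \<langle>y, sr i\<rangle> > 0" "\<beta> \<in> P"
  shows "\<langle>y, \<beta>\<rangle> > 0"
proof -
  obtain j where j: "j \<in> I" "simple_coord j \<beta> > 0" using pos_simple_coord_pos assms(2) by blast
  have f: "form y (sr i) > 0" if "i \<in> I" for i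
    using form_sign(1)[OF simple_root[OF that]] assms(1)[OF that] by blast
  have "0 < (\<Sum>j\<in>I. simple_coord j \<beta> * form y (sr j))"
  proof (rule sum_pos2[of _ j])
    show "0 \<le> simple_coord i \<beta> * form y (sr i)" if "i \<in> I" for i
      using f[OF that] pos_expand(2)[OF assms(2) that] by simp
  qed (use j f in auto)
  then show ?thesis using form_pos_expand[OF assms(2)] form_sign(1) pos_root assms(2) by metis
qed

lemma rho_pos: "\<beta> \<in> P \<Longrightarrow> \<langle>rho D, \<beta>\<rangle> > 0"
  by (rule dominant_pairing_pos) (auto simp: rho_simple)

end

section \<open>The Weyl group, inversions and the longest element\<close>

context root_datum
begin

lemma word_prod_simps [simp]:
  "word_prod D [] = id" "word_prod D (i # is) = s i \<circ> word_prod D is"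
  by (simp_all add: word_prod_def)

lemma word_prod_append: "word_prod D (is @ js) = word_prod D is \<circ> word_prod D js"
  by (induction "is") (auto simp: comp_assoc)

lemma W_word: "w \<in> W \<longleftrightarrow> (\<exists>is. set is \<subseteq> I \<and> w = word_prod D is)"
  unfolding weyl_group_def I_def[symmetric] by (auto simp: in_lists_conv_set subset_iff image_iff Bex_def)

lemma id_W: "id \<in> W"
  using W_word by (intro iffD2[OF W_word] exI[of _ "[]"]) auto

lemma W_induct [consumes 1, case_names id step]:
  assumes "w \<in> W" "Q id" "\<And>i w. i \<in> I \<Longrightarrow> w \<in> W \<Longrightarrow> Q w \<Longrightarrow> Q (s i \<circ> w)"
  shows "Q w"
proof -
  have "set is \<subseteq> I \<Longrightarrow> Q (word_prod D is)" for "is"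
  proof (induction "is")
    case Nil show ?case using assms(2) by (simp add: id_def)
  next
    case (Cons i "is")
    then have "word_prod D is \<in> W" using W_word by auto
    then show ?case using Cons assms(3) by (simp add: comp_def)
  qed
  then show ?thesis using assms(1) unfolding W_word by blast
qed

lemma s_W: "i \<in> I \<Longrightarrow> s i \<in> W"
  by (intro iffD2[OF W_word] exI[of _ "[i]"]) auto

lemma comp_W: "v \<in> W \<Longrightarrow> w \<in> W \<Longrightarrow> v \<circ> w \<in> W"
  by (auto simp: W_word simp flip: word_prod_append) (metis set_append Un_subset_iff)

lemma s_comp_s: "i \<in> I \<Longrightarrow> s i \<circ> s i = id"
  by (auto simp: s_invol)

lemma W_inverse: "w \<in> W \<Longrightarrow> \<exists>v\<in>W. v \<circ> w = id \<and> w \<circ> v = id"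
proof (induction rule: W_induct)
  case (step i w)
  then obtain v where v: "v \<in> W" "v \<circ> w = id" "w \<circ> v = id" by blast
  have "(v \<circ> s i) \<circ> (s i \<circ> w) = v \<circ> (s i \<circ> s i) \<circ> w" "(s i \<circ> w) \<circ> (v \<circ> s i) = s i \<circ> (w \<circ> v) \<circ> s i"
    by (simp_all add: comp_assoc)
  then have "(v \<circ> s i) \<circ> (s i \<circ> w) = id" "(s i \<circ> w) \<circ> (v \<circ> s i) = id"
    using v s_comp_s[OF step(1)] by simp_all
  then show ?case using comp_W[OF v(1) s_W[OF step(1)]] by blast
next
  case id
  show ?case by (rule bexI[OF _ id_W]) simp
qed

lemma W_bij: "w \<in> W \<Longrightarrow> bij w"
  using W_inverse o_bij by metis

abbreviation winv :: "('v \<Rightarrow> 'v) \<Rightarrow> 'v \<Rightarrow> 'v" where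
  "winv \<equiv> inv_into UNIV"

lemma inv_W: "w \<in> W \<Longrightarrow> winv w \<in> W"
  using W_inverse inv_unique_comp by metis

lemma W_inv_simps: "w \<in> W \<Longrightarrow> w (winv w x) = x" "w \<in> W \<Longrightarrow> winv w (w x) = x"
  using W_bij by (auto simp: bij_is_surj surj_f_inv_f bij_is_inj)

lemma W_linear: "w \<in> W \<Longrightarrow> linear w"
proof (induction rule: W_induct)
  case (step i w)
  then show ?case using linear_compose[OF step(3) s_linear[OF step(1)]] by (simp add: comp_def)
qed (rule linear_id)

lemma W_simps:
  assumes "w \<in> W"
  shows "w (x + y) = w x + w y" "w (x - y) = w x - w y" "w (c *\<^sub>R x) = c *\<^sub>R w x" "w (- x) = - w x"
    "w 0 = 0" "w (sum f A) = (\<Sum>a\<in>A. w (f a))"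
  using W_linear[OF assms]
  by (simp_all add: linear_add linear_diff linear_scale linear_neg linear_0 linear_sum)

lemma W_root: "w \<in> W \<Longrightarrow> \<beta> \<in> R \<Longrightarrow> w \<beta> \<in> R"
  by (induction rule: W_induct) (auto simp: s_root)

lemma W_pairing: "w \<in> W \<Longrightarrow> \<beta> \<in> R \<Longrightarrow> \<langle>w x, w \<beta>\<rangle> = \<langle>x, \<beta>\<rangle>"
  by (induction rule: W_induct) (auto simp: s_def coroot_refl refl_invol simple_root W_root)

lemma W_pairing_inv: "w \<in> W \<Longrightarrow> \<beta> \<in> R \<Longrightarrow> \<langle>w x, \<beta>\<rangle> = \<langle>x, winv w \<beta>\<rangle>"
  using W_pairing[of w "winv w \<beta>" x] by (simp add: W_inv_simps W_root inv_W)

lemma W_refl: "w \<in> W \<Longrightarrow> \<beta> \<in> R \<Longrightarrow> w (refl \<beta> x) = refl (w \<beta>) (w x)"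
  by (simp add: refl_def W_simps W_pairing)

lemma W_form: "w \<in> W \<Longrightarrow> form (w x) (w y) = form x y"
  by (induction rule: W_induct) (auto simp: s_def form_refl simple_root)

definition inversions :: "('v \<Rightarrow> 'v) \<Rightarrow> 'v set" where
  "inversions w = {\<beta> \<in> P. w \<beta> \<notin> P}"

lemma finite_inversions: "finite (inversions w)"
  by (simp add: inversions_def finite_pos)

lemma inversions_iff: "w \<in> W \<Longrightarrow> \<beta> \<in> P \<Longrightarrow> \<beta> \<in> inversions w \<longleftrightarrow> - w \<beta> \<in> P"
  by (simp add: inversions_def uminus_pos_iff W_root pos_root)

lemma s_pos_iff: "i \<in> I \<Longrightarrow> \<beta> \<in> R \<Longrightarrow> \<beta> \<noteq> sr i \<Longrightarrow> \<beta> \<noteq> - sr i \<Longrightarrow> s i \<beta> \<in> P \<longleftrightarrow> \<beta> \<in> P"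
  using s_pos[of i \<beta>] s_pos[of i "- \<beta>"] s_linear[of i] uminus_pos_iff s_root
  by (metis linear_neg minus_minus)

text \<open>
  A simple reflection changes the sign of no positive root other than \<open>\<alpha>\<^sub>i\<close>, so only the root that \<open>w\<close>
  maps to \<open>\<alpha>\<^sub>i\<close> is added to the inversions.
\<close>

lemma inversions_step:
  assumes i: "i \<in> I" and w: "w \<in> W" and p: "winv w (sr i) \<in> P"
  shows "inversions (s i \<circ> w) = insert (winv w (sr i)) (inversions w)" "winv w (sr i) \<notin> inversions w"
proof -
  have a: "s i (w \<beta>) \<in> P \<longleftrightarrow> w \<beta> \<in> P" if "\<beta> \<in> P" "\<beta> \<noteq> winv w (sr i)" for \<beta>
  proof (rule s_pos_iff[OF i W_root[OF w pos_root[OF that(1)]]])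
    show "w \<beta> \<noteq> sr i" using that w W_inv_simps by metis
    show "w \<beta> \<noteq> - sr i"
    proof
      assume "w \<beta> = - sr i"
      then have "\<beta> = - winv w (sr i)" using w W_inv_simps W_simps(4)[OF inv_W[OF w]] by metis
      then show False using p that(1) pos_not_neg by force
    qed
  qed
  have b: "w (winv w (sr i)) \<in> P" "s i (w (winv w (sr i))) \<notin> P"
    using i w by (simp_all add: W_inv_simps simple_pos s_simple pos_not_neg)
  show "inversions (s i \<circ> w) = insert (winv w (sr i)) (inversions w)" "winv w (sr i) \<notin> inversions w"
    using a b p by (auto simp: inversions_def)
qed

lemma card_inversions_step:
  assumes i: "i \<in> I" and w: "w \<in> W"
  shows "winv w (sr i) \<in> P \<Longrightarrow> card (inversions (s i \<circ> w)) = Suc (card (inversions w))"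
    "winv w (sr i) \<notin> P \<Longrightarrow> card (inversions w) = Suc (card (inversions (s i \<circ> w)))"
proof -
  show "winv w (sr i) \<in> P \<Longrightarrow> card (inversions (s i \<circ> w)) = Suc (card (inversions w))"
    using inversions_step[OF i w] by (simp add: finite_inversions)
  assume n: "winv w (sr i) \<notin> P"
  let ?v = "s i \<circ> w"
  have v: "?v \<in> W" using i w by (simp add: comp_W s_W)
  have "?v (- winv w (sr i)) = sr i"
    using i w by (simp add: W_simps W_inv_simps s_simple s_linear linear_neg)
  then have iv: "winv ?v (sr i) = - winv w (sr i)" using W_inv_simps(2)[OF v] by metis
  have "s i \<circ> ?v = w" using s_comp_s[OF i] by (simp flip: comp_assoc)
  moreover have "winv ?v (sr i) \<in> P"
    unfolding iv using n uminus_pos_iff W_root[OF inv_W[OF w] simple_root[OF i]] by blast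
  ultimately show "card (inversions w) = Suc (card (inversions ?v))"
    using inversions_step[OF i v] by (simp add: finite_inversions)
qed

text \<open>
  The exchange property, in the form that reflects in an arbitrary positive root: some letter of
  the word negates the current root, and the two cancel.
\<close>

lemma exchange:
  "set is \<subseteq> I \<Longrightarrow> \<beta> \<in> P \<Longrightarrow> winv (word_prod D is) \<beta> \<notin> P \<Longrightarrow>
    \<exists>js. set js \<subseteq> I \<and> length is = Suc (length js) \<and> refl \<beta> \<circ> word_prod D is = word_prod D js"
proof (induction "is" arbitrary: \<beta>)
  case Nil then show ?case by (simp add: inv_id[unfolded id_def] id_def)
next
  case (Cons j vs)
  let ?v = "word_prod D vs"
  have j: "j \<in> I" and v: "?v \<in> W" using Cons W_word by auto
  have iv: "winv (s j \<circ> ?v) \<beta> = winv ?v (s j \<beta>)"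
    using W_inv_simps[OF v] s_invol[OF j] W_inv_simps(2)[OF comp_W[OF s_W[OF j] v]]
    by (metis comp_apply)
  show ?case
  proof (cases "\<beta> = sr j")
    case True
    then have "refl \<beta> \<circ> word_prod D (j # vs) = ?v"
      using s_comp_s[OF j] by (simp add: s_def flip: comp_assoc)
    then show ?thesis using Cons.prems(1) by (intro exI[of _ vs] conjI) (simp_all add: comp_def)
  next
    case False
    then have sb: "s j \<beta> \<in> P" using s_pos j Cons.prems by blast
    then obtain js where js: "set js \<subseteq> I" "length vs = Suc (length js)"
      "refl (s j \<beta>) \<circ> ?v = word_prod D js"
      using Cons.IH[of "s j \<beta>"] Cons.prems iv by (auto simp: comp_def)
    have "refl \<beta> (s j x) = s j (refl (s j \<beta>) x)" for x
      using refl_conj[of "sr j" "s j \<beta>" x] j sb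
      by (simp add: s_def simple_root pos_root refl_invol)
    then have "refl \<beta> \<circ> word_prod D (j # vs) = word_prod D (j # js)"
      using js(3) by (auto simp: fun_eq_iff)
    then show ?thesis using js j by (intro exI[of _ "j # js"]) (simp add: comp_def)
  qed
qed

lemma reduced_word:
  "w \<in> W \<Longrightarrow> \<exists>is. set is \<subseteq> I \<and> w = word_prod D is \<and> length is = card (inversions w)"
proof (induction rule: W_induct)
  case id then show ?case by (intro exI[of _ "[]"]) (auto simp: inversions_def)
next
  case (step i w)
  then obtain "is" where "is": "set is \<subseteq> I" "w = word_prod D is" "length is = card (inversions w)"
    by blast
  show ?case
  proof (cases "winv w (sr i) \<in> P")
    case True
    have "card (inversions (s i \<circ> w)) = Suc (length is)"
      using card_inversions_step(1)[OF step(1,2) True] "is"(3) by simp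
    then show ?thesis using "is"(1,2) step(1) by (intro exI[of _ "i # is"] conjI) (simp_all add: comp_def)
  next
    case False
    then obtain js where "set js \<subseteq> I" "length is = Suc (length js)" "s i \<circ> w = word_prod D js"
      using exchange[OF "is"(1) simple_pos[OF step(1)]] "is"(2) by (auto simp: s_def)
    then show ?thesis using False "is" step card_inversions_step(2)[OF step(1,2)] by auto
  qed
qed

lemma card_inversions_word: "set is \<subseteq> I \<Longrightarrow> card (inversions (word_prod D is)) \<le> length is"
proof (induction "is")
  case Nil then show ?case by (simp add: inversions_def)
next
  case (Cons i "is")
  then have "i \<in> I" "word_prod D is \<in> W" using W_word by auto
  from card_inversions_step[OF this] Cons show ?case
    by (cases "winv (word_prod D is) (sr i) \<in> P") (simp_all add: comp_def)
qed

lemma weyl_length: "w \<in> W \<Longrightarrow> weyl_length D w = card (inversions w)"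
  unfolding weyl_length_def I_def[symmetric]
proof (rule Least_equality)
  assume "w \<in> W"
  then show "\<exists>is\<in>lists I. length is = card (inversions w) \<and> word_prod D is = w"
    using reduced_word by (metis in_listsI subsetD)
  show "\<exists>is\<in>lists I. length is = k \<and> word_prod D is = w \<Longrightarrow> card (inversions w) \<le> k" for k
    using card_inversions_word by (metis in_listsD subsetI)
qed

text \<open>
  The length of a reduced word is the number of inversions.
\<close>

lemma no_inversions_id: "w \<in> W \<Longrightarrow> inversions w = {} \<Longrightarrow> w = id"
  using reduced_word[of w] by auto

lemma no_inversions_idI: "w \<in> W \<Longrightarrow> (\<And>\<beta>. \<beta> \<in> P \<Longrightarrow> w \<beta> \<in> P) \<Longrightarrow> w = id"
  by (rule no_inversions_id) (auto simp: inversions_def)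

lemma finite_W: "finite W"
proof (rule inj_on_finite[of "\<lambda>w. restrict w R" _ "R \<rightarrow>\<^sub>E R"])
  show "inj_on (\<lambda>w. restrict w R) W"
  proof (rule inj_onI)
    fix v w assume vw: "v \<in> W" "w \<in> W" "restrict v R = restrict w R"
    have "winv v \<circ> w = id"
    proof (rule no_inversions_idI)
      fix \<beta> assume b: "\<beta> \<in> P"
      then have "w \<beta> = v \<beta>" using vw(3) pos_root by (metis restrict_apply)
      then show "(winv v \<circ> w) \<beta> \<in> P" using b vw by (simp add: W_inv_simps)
    qed (use vw in \<open>simp add: comp_W inv_W\<close>)
    then have "w x = v x" for x using W_inv_simps(1)[OF vw(1)] by (metis comp_apply id_apply)
    then show "v = w" by auto
  qed
  show "(\<lambda>w. restrict w R) ` W \<subseteq> R \<rightarrow>\<^sub>E R" by (auto simp: W_root)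
qed (simp add: finite_PiE finite_roots)

lemma W_neg_pos:
  assumes "w \<in> W" "\<And>i. i \<in> I \<Longrightarrow> w (sr i) \<notin> P" "\<beta> \<in> P"
  shows "- w \<beta> \<in> P"
proof (rule ccontr)
  assume "- w \<beta> \<notin> P"
  then have wp: "w \<beta> \<in> P" using assms uminus_pos_iff W_root pos_root by blast
  have "w \<beta> = (\<Sum>j\<in>I. simple_coord j \<beta> *\<^sub>R w (sr j))"
    using arg_cong[OF pos_expand(1)[OF assms(3)], of w] assms(1) by (simp add: W_simps)
  then have "simple_coord i (w \<beta>) = (\<Sum>j\<in>I. simple_coord j \<beta> * simple_coord i (w (sr j)))" for i
    by (metis (no_types, lifting) simple_coord_simps(3,6) sum.cong)
  moreover have "simple_coord i (w (sr j)) \<le> 0" if "i \<in> I" "j \<in> I" for i j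
    using pos_expand(2)[of "- w (sr j)" i] that assms uminus_pos_iff W_root simple_root
    by (metis simple_coord_simps(4) neg_0_le_iff_le)
  ultimately have "simple_coord i (w \<beta>) \<le> 0" if "i \<in> I" for i
    using that pos_expand(2)[OF assms(3)] by (auto intro!: sum_nonpos mult_nonneg_nonpos)
  then show False using pos_simple_coord_pos[OF wp] by force
qed

definition w0 :: "'v \<Rightarrow> 'v" where "w0 = longest D"

lemma full_inversions_unique:
  assumes "v \<in> W" "w \<in> W" "inversions v = P" "inversions w = P"
  shows "v = w"
proof -
  have "winv v \<circ> w = id"
  proof (rule no_inversions_idI)
    fix \<beta> assume b: "\<beta> \<in> P"
    then have wb: "- w \<beta> \<in> P" using assms inversions_iff by blast
    define \<gamma> where "\<gamma> = winv v (w \<beta>)"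
    have g: "\<gamma> \<in> R" "v \<gamma> = w \<beta>"
      using assms b by (auto simp: \<gamma>_def W_root inv_W pos_root W_inv_simps)
    have "\<gamma> \<in> P"
    proof (rule ccontr)
      assume "\<gamma> \<notin> P"
      then have "- v (- \<gamma>) \<in> P" using assms g inversions_iff uminus_pos_iff by blast
      then show False using wb g assms pos_not_neg by (auto simp: W_simps)
    qed
    then show "(winv v \<circ> w) \<beta> \<in> P" by (simp add: \<gamma>_def)
  qed (use assms in \<open>simp add: comp_W inv_W\<close>)
  then show ?thesis using W_inv_simps(1)[OF assms(1)] by (metis comp_apply id_apply ext)
qed

lemma exists_full_inversions: "\<exists>w\<in>W. inversions w = P"
proof -
  let ?f = "\<lambda>w. card (inversions w)"
  have "Max (?f ` W) \<in> ?f ` W" using finite_W id_W by (intro Max_in) auto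
  then obtain w where w0: "w \<in> W" "?f w = Max (?f ` W)" by force
  have w: "w \<in> W" "\<And>v. v \<in> W \<Longrightarrow> card (inversions v) \<le> card (inversions w)"
    using w0 finite_W by auto
  have "winv w (sr i) \<notin> P" if "i \<in> I" for i
    using card_inversions_step(1)[OF that w(1)] w(2)[OF comp_W[OF s_W[OF that] w(1)]] by auto
  then have n: "- winv w \<beta> \<in> P" if "\<beta> \<in> P" for \<beta>
    using W_neg_pos[OF inv_W[OF w(1)]] that by blast
  have "w \<beta> \<notin> P" if "\<beta> \<in> P" for \<beta>
    using n[of "w \<beta>"] that w pos_not_neg by (auto simp: W_inv_simps)
  then show ?thesis using w by (auto simp: inversions_def intro!: bexI[of _ w])
qed

lemma w0: "w0 \<in> W" "inversions w0 = P"
proof -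
  obtain w where w: "w \<in> W" "inversions w = P" using exists_full_inversions by blast
  have le: "card (inversions v) \<le> card P" for v
    by (rule card_mono[OF finite_pos]) (auto simp: inversions_def)
  have "longest D = w"
    unfolding longest_def
  proof (rule the_equality)
    show "w \<in> W \<and> (\<forall>v\<in>W. weyl_length D v \<le> weyl_length D w)"
      using w le by (simp add: weyl_length)
  next
    fix v assume v: "v \<in> W \<and> (\<forall>u\<in>W. weyl_length D u \<le> weyl_length D v)"
    then have "card P \<le> card (inversions v)" using w by (metis weyl_length)
    moreover have "inversions v \<subseteq> P" by (auto simp: inversions_def)
    ultimately have "inversions v = P" using card_seteq[OF finite_pos] by blast
    then show "v = w" using v w full_inversions_unique by blast
  qed
  then show "w0 \<in> W" "inversions w0 = P" using w by (simp_all add: w0_def)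
qed

lemma length_w0: "weyl_length D (longest D) = card P"
  using w0 weyl_length by (simp add: w0_def)

lemma w0_neg: "\<beta> \<in> P \<Longrightarrow> - w0 \<beta> \<in> P"
  using w0 inversions_iff by blast

lemma w0_invol: "w0 (w0 x) = x"
proof -
  have "w0 \<circ> w0 = id"
  proof (rule no_inversions_idI)
    fix \<beta> assume "\<beta> \<in> P"
    then have "- w0 (- w0 \<beta>) \<in> P" using w0_neg by blast
    then show "(w0 \<circ> w0) \<beta> \<in> P" by (simp add: W_simps[OF w0(1)])
  qed (simp add: comp_W w0)
  then show ?thesis by (metis comp_apply id_apply)
qed

text \<open>
  The reflection in \<open>- w\<^sub>0 \<alpha>\<^sub>i\<close> is the conjugate of \<open>s\<^sub>i\<close> by \<open>w\<^sub>0\<close> and therefore makes only one positive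
  root negative. As it is not the identity, it makes some simple root negative, so the root is simple.
\<close>

lemma w0_simple:
  assumes i: "i \<in> I"
  shows "\<exists>j\<in>I. w0 (sr i) = - sr j \<and> (\<forall>x. w0 (s i x) = s j (w0 x)) \<and> (\<forall>x. \<langle>w0 x, sr j\<rangle> = - \<langle>x, sr i\<rangle>)"
proof -
  define \<beta> where "\<beta> = - w0 (sr i)"
  have b: "\<beta> \<in> P" "w0 \<beta> = - sr i"
    using i w0_neg simple_pos by (auto simp: \<beta>_def W_simps[OF w0(1)] w0_invol)
  have conj: "w0 (s i x) = refl \<beta> (w0 x)" for x
    using W_refl[OF w0(1) simple_root[OF i]] refl_uminus[OF W_root[OF w0(1) simple_root[OF i]]]
    by (simp add: s_def \<beta>_def)
  have rw: "refl \<beta> = w0 \<circ> s i \<circ> w0" using conj by (auto simp: w0_invol)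
  have rW: "refl \<beta> \<in> W" unfolding rw using i w0 by (simp add: comp_W s_W)
  have inv: "\<gamma> = \<beta>" if g: "\<gamma> \<in> P" "refl \<beta> \<gamma> \<notin> P" for \<gamma>
  proof (rule ccontr)
    assume ne: "\<gamma> \<noteq> \<beta>"
    define \<delta> where "\<delta> = - w0 \<gamma>"
    have d: "\<delta> \<in> P" using g w0_neg by (simp add: \<delta>_def)
    have "w0 \<delta> = - \<gamma>" by (simp add: \<delta>_def W_simps[OF w0(1)] w0_invol)
    then have "\<delta> \<noteq> sr i" using ne by (auto simp: \<beta>_def)
    then have "- w0 (s i \<delta>) \<in> P" using s_pos i d w0_neg by blast
    then have "w0 (s i (w0 \<gamma>)) \<in> P"
      using i by (simp add: \<delta>_def linear_neg s_linear W_simps[OF w0(1)])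
    then show False using g(2) rw by simp
  qed
  have "\<exists>j\<in>I. refl \<beta> (sr j) \<notin> P"
  proof (rule ccontr)
    assume a: "\<not> ?thesis"
    then have "winv (refl \<beta>) (sr j) = refl \<beta> (sr j)" for j
      using refl_invol[OF pos_root[OF b(1)]] by (metis inv_equality)
    then have s: "card (inversions (s j \<circ> refl \<beta>)) = Suc (card (inversions (refl \<beta>)))" if "j \<in> I" for j
      using card_inversions_step(1)[OF that rW] a that by auto
    obtain "is" where "is": "set is \<subseteq> I" "refl \<beta> = word_prod D is" "length is = card (inversions (refl \<beta>))"
      using reduced_word[OF rW] by blast
    show False
    proof (cases "is")
      case Nil
      then have "refl \<beta> \<beta> = \<beta>" using "is" by simp
      then show False using refl_self[OF pos_root[OF b(1)]] b(1) pos_not_neg by metis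
    next
      case (Cons j js)
      then have "s j \<circ> refl \<beta> = word_prod D js"
        using "is" s_comp_s[of j] by (auto simp flip: comp_assoc)
      then have "card (inversions (s j \<circ> refl \<beta>)) \<le> length js"
        using card_inversions_word Cons "is" by auto
      then show False using s[of j] Cons "is" by auto
    qed
  qed
  then obtain j where j: "j \<in> I" "refl \<beta> (sr j) \<notin> P" by blast
  then have "sr j = \<beta>" using inv simple_pos by blast
  then have e: "w0 (sr i) = - sr j" by (simp add: \<beta>_def)
  have "\<langle>w0 x, sr j\<rangle> = - \<langle>x, sr i\<rangle>" for x
    using W_pairing[OF w0(1) simple_root[OF i], of x] coroot_uminus[OF simple_root[OF j(1)]] e by simp
  then show ?thesis using j e conj \<open>sr j = \<beta>\<close> by (intro bexI[of _ j]) (auto simp: s_def)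
qed

end

section \<open>Affine roots and the walls of the fundamental alcove\<close>

text \<open>
  A line in a suitable direction through a vector that is good for all but one of the functionals
  meets the bad hyperplanes in finitely many points.
\<close>

lemma generic_vector:
  fixes F :: "('a::real_vector \<Rightarrow> real) set"
  assumes "finite F" "\<And>f. f \<in> F \<Longrightarrow> linear f \<and> (\<exists>u. f u \<noteq> 0)"
  shows "\<exists>v. \<forall>f\<in>F. f v \<noteq> 0"
  using assms
proof (induction F)
  case (insert f F)
  then obtain v where v: "\<And>g. g \<in> F \<Longrightarrow> g v \<noteq> 0" by (metis insertCI)
  obtain u where u: "f u \<noteq> 0" using insert.prems by blast
  have lin: "linear g" if "g \<in> insert f F" for g using insert.prems that by blast
  show ?case
  proof (cases "f v = 0")
    case True
    have "finite ((\<lambda>g. - g v / g u) ` F \<union> {0})" using insert.hyps by simp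
    then obtain c :: real where c: "c \<notin> (\<lambda>g. - g v / g u) ` F \<union> {0}"
      using ex_new_if_finite infinite_UNIV_char_0 by blast
    have "g (v + c *\<^sub>R u) \<noteq> 0" if g: "g \<in> insert f F" for g
    proof (cases "g = f")
      case True then show ?thesis using \<open>f v = 0\<close> u c lin[OF g] by (simp add: linear_add linear_scale)
    next
      case False
      then have gF: "g \<in> F" using g by simp
      show ?thesis
      proof
        assume "g (v + c *\<^sub>R u) = 0"
        then have e: "g v + c * g u = 0" using lin[OF g] by (simp add: linear_add linear_scale)
        then have "g u \<noteq> 0" using v[OF gF] by auto
        then have "c = - g v / g u" using e by (simp add: field_simps)
        then show False using c gF by blast
      qed
    qed
    then show ?thesis by blast
  qed (use v in blast)
qed simp

lemma eventually_not_int: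
  fixes a d :: real
  assumes "d \<noteq> 0"
  shows "eventually (\<lambda>\<epsilon>. a + \<epsilon> * d \<notin> \<int>) (at_right 0)"
proof (cases "d > 0")
  case True
  define b where "b = (of_int \<lfloor>a\<rfloor> + 1 - a) / d"
  have "b > 0" using True by (simp add: b_def)
  moreover have "a + \<epsilon> * d \<notin> \<int>" if "0 < \<epsilon>" "\<epsilon> < b" for \<epsilon>
  proof
    assume "a + \<epsilon> * d \<in> \<int>"
    then obtain n :: int where n: "a + \<epsilon> * d = of_int n" by (elim Ints_cases)
    have "0 < \<epsilon> * d" "\<epsilon> * d < of_int \<lfloor>a\<rfloor> + 1 - a"
      using that True by (simp_all add: b_def field_simps)
    then have "of_int \<lfloor>a\<rfloor> < (of_int n :: real)" "(of_int n :: real) < of_int \<lfloor>a\<rfloor> + 1"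
      using n of_int_floor_le[of a] by linarith+
    then have "\<lfloor>a\<rfloor> < n" "n < \<lfloor>a\<rfloor> + 1"
      using of_int_less_iff[where 'a=real, of n "\<lfloor>a\<rfloor> + 1"] by simp_all
    then show False by simp
  qed
  ultimately show ?thesis by (auto simp: eventually_at_right_field)
next
  case False
  then have d: "d < 0" using assms by simp
  define b where "b = (a + 1 - of_int \<lceil>a\<rceil>) / (- d)"
  have "a + 1 - of_int \<lceil>a\<rceil> > 0" by linarith
  then have "b > 0" using d by (simp add: b_def field_simps)
  moreover have "a + \<epsilon> * d \<notin> \<int>" if "0 < \<epsilon>" "\<epsilon> < b" for \<epsilon>
  proof
    assume "a + \<epsilon> * d \<in> \<int>"
    then obtain n :: int where n: "a + \<epsilon> * d = of_int n" by (elim Ints_cases)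
    have "\<epsilon> * d < 0" "\<epsilon> * (- d) < a + 1 - of_int \<lceil>a\<rceil>"
      using that d by (simp_all add: b_def field_simps mult_less_0_iff)
    then have "of_int n < (of_int \<lceil>a\<rceil> :: real)" "of_int \<lceil>a\<rceil> - 1 < (of_int n :: real)"
      using n le_of_int_ceiling[of a] by linarith+
    then have "n < \<lceil>a\<rceil>" "\<lceil>a\<rceil> - 1 < n"
      using of_int_less_iff[where 'a=real, of "\<lceil>a\<rceil> - 1" n] by simp_all
    then show False by simp
  qed
  ultimately show ?thesis by (auto simp: eventually_at_right_field)
qed

context root_datum
begin

text \<open>
  Building \<open>w\<close> up letter by letter, the root becomes negative at some letter, and just before that it
  has been moved to a simple root.
\<close>

lemma root_conj_simple:
  "w \<in> W \<Longrightarrow> \<beta> \<in> P \<Longrightarrow> w \<beta> \<notin> P \<Longrightarrow> \<exists>u\<in>W. \<exists>i\<in>I. \<beta> = u (sr i)"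
proof (induction rule: W_induct)
  case (step i w)
  show ?case
  proof (cases "w \<beta> \<in> P")
    case True
    then have "w \<beta> = sr i" using step s_pos[of i "w \<beta>"] by auto
    then have "\<beta> = winv w (sr i)" using step W_inv_simps by metis
    then show ?thesis using step inv_W by blast
  qed (use step in blast)
qed simp

lemma refl_W: "\<beta> \<in> R \<Longrightarrow> refl \<beta> \<in> W"
proof -
  have pos: "refl \<beta> \<in> W" if b: "\<beta> \<in> P" for \<beta>
  proof -
    have "w0 \<beta> \<notin> P" using w0_neg[OF b] pos_not_neg by force
    then obtain u i where u: "u \<in> W" "i \<in> I" "\<beta> = u (sr i)"
      using root_conj_simple[OF w0(1) b] by blast
    have "refl \<beta> = u \<circ> s i \<circ> winv u"
      using u by (auto simp: s_def W_refl simple_root W_inv_simps)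
    then show ?thesis using u by (simp add: comp_W s_W inv_W)
  qed
  assume "\<beta> \<in> R"
  then consider "\<beta> \<in> P" | "- \<beta> \<in> P" using pos_or_neg by blast
  then show ?thesis using pos refl_uminus \<open>\<beta> \<in> R\<close> by cases metis+
qed

text \<open>
  The pair \<open>(\<alpha>, k)\<close> stands for the affine function \<open>x \<mapsto> \<langle>x, \<alpha>\<rangle> + k\<close>, whose zeros form an affine
  hyperplane; \<open>arefl\<close> is the reflection in it, and \<open>AR\<close> is the set of all affine roots.
\<close>

definition val :: "'v \<times> int \<Rightarrow> 'v \<Rightarrow> real" where
  "val a x = \<langle>x, fst a\<rangle> + of_int (snd a)"

definition AR :: "('v \<times> int) set" where
  "AR = R \<times> UNIV"

definition arefl :: "'v \<times> int \<Rightarrow> 'v \<Rightarrow> 'v" where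
  "arefl a x = x - val a x *\<^sub>R fst a"

definition aneg :: "'v \<times> int \<Rightarrow> 'v \<times> int" where
  "aneg a = (- fst a, - snd a)"

lemma AR_iff: "a \<in> AR \<longleftrightarrow> fst a \<in> R"
  by (auto simp: AR_def mem_Times_iff)

lemma aneg_AR: "a \<in> AR \<Longrightarrow> aneg a \<in> AR"
  by (simp add: AR_iff aneg_def uminus_root)

lemma val_aneg: "a \<in> AR \<Longrightarrow> val (aneg a) x = - val a x"
  by (simp add: val_def aneg_def AR_iff coroot_uminus)

lemma arefl_aneg: "a \<in> AR \<Longrightarrow> arefl (aneg a) = arefl a"
  by (rule ext) (simp add: arefl_def val_aneg, simp add: aneg_def)

lemma aneg_aneg: "aneg (aneg a) = a"
  by (simp add: aneg_def)

lemma val_arefl: "a \<in> AR \<Longrightarrow> b \<in> AR \<Longrightarrow> val b (arefl a x) = val b x - val a x * \<langle>fst a, fst b\<rangle>"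
  by (simp add: val_def arefl_def AR_iff pairing_simps)

lemma val_arefl_self: "a \<in> AR \<Longrightarrow> val a (arefl a x) = - val a x"
  by (subst val_arefl) (auto simp: AR_iff coroot_self)

lemma arefl_invol: "a \<in> AR \<Longrightarrow> arefl a (arefl a x) = x"
  by (simp add: arefl_def[of a "arefl a x"] val_arefl_self) (simp add: arefl_def)

lemma val_inj:
  assumes "a \<in> AR" "b \<in> AR" "\<And>x. val a x = val b x"
  shows "a = b"
proof -
  have "snd a = snd b" using assms(3)[of 0] assms(1,2) by (simp add: val_def AR_iff pairing_simps)
  moreover have "coroot D (fst a) = coroot D (fst b)"
    using assms(3) calculation by (auto simp: val_def)
  ultimately show ?thesis
    using coroot_inj assms(1,2) by (metis AR_iff inj_onD prod_eqI)
qed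

text \<open>
  The extended affine Weyl group. All translations that preserve the set of affine hyperplanes are
  admitted, in particular those by multiples of simple roots and by \<open>2\<rho>\<close>.
\<close>

definition Wext :: "('v \<Rightarrow> 'v) set" where
  "Wext = {A. \<exists>w\<in>W. \<exists>b. (\<forall>\<alpha>\<in>R. \<langle>b, \<alpha>\<rangle> \<in> \<int>) \<and> A = (\<lambda>x. w x + b)}"

lemma WextI: "w \<in> W \<Longrightarrow> (\<And>\<alpha>. \<alpha> \<in> R \<Longrightarrow> \<langle>b, \<alpha>\<rangle> \<in> \<int>) \<Longrightarrow> (\<And>x. A x = w x + b) \<Longrightarrow> A \<in> Wext"
  by (auto simp: Wext_def fun_eq_iff)

lemma WextE:
  assumes "A \<in> Wext"
  obtains w b where "w \<in> W" "\<And>\<alpha>. \<alpha> \<in> R \<Longrightarrow> \<langle>b, \<alpha>\<rangle> \<in> \<int>" "\<And>x. A x = w x + b"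
  using assms by (auto simp: Wext_def)

lemma W_Wext: "w \<in> W \<Longrightarrow> w \<in> Wext"
  by (rule WextI[of w 0]) (auto simp: pairing_simps)

lemma id_Wext: "id \<in> Wext"
  by (intro W_Wext id_W)

lemma comp_Wext: "A \<in> Wext \<Longrightarrow> B \<in> Wext \<Longrightarrow> A \<circ> B \<in> Wext"
proof -
  assume "A \<in> Wext" "B \<in> Wext"
  then obtain w b v c where w: "w \<in> W" "\<And>\<alpha>. \<alpha> \<in> R \<Longrightarrow> \<langle>b, \<alpha>\<rangle> \<in> \<int>" "\<And>x. A x = w x + b"
    and v: "v \<in> W" "\<And>\<alpha>. \<alpha> \<in> R \<Longrightarrow> \<langle>c, \<alpha>\<rangle> \<in> \<int>" "\<And>x. B x = v x + c"
    by (metis WextE)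
  show ?thesis
  proof (rule WextI[of "w \<circ> v" "w c + b"])
    show "w \<circ> v \<in> W" using w v by (rule_tac comp_W)
    show "\<langle>w c + b, \<alpha>\<rangle> \<in> \<int>" if "\<alpha> \<in> R" for \<alpha>
      using that w v by (simp add: pairing_simps W_pairing_inv W_root inv_W)
    show "(A \<circ> B) x = (w \<circ> v) x + (w c + b)" for x
      using w v by (simp add: W_simps(1)[OF w(1)])
  qed
qed

lemma Wext_inverse: "A \<in> Wext \<Longrightarrow> bij A \<and> winv A \<in> Wext"
proof -
  assume "A \<in> Wext"
  then obtain w b where w: "w \<in> W" "\<And>\<alpha>. \<alpha> \<in> R \<Longrightarrow> \<langle>b, \<alpha>\<rangle> \<in> \<int>" "\<And>x. A x = w x + b"
    by (metis WextE)
  define B where "B = (\<lambda>x. winv w x + - winv w b)"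
  have iw: "winv w \<in> W" using w inv_W by blast
  have BA: "B \<circ> A = id" "A \<circ> B = id"
    using w by (auto simp: B_def W_simps(1)[OF iw] W_simps(1,2,4)[OF w(1)] W_inv_simps)
  have "B \<in> Wext"
  proof (rule WextI[OF iw])
    show "\<langle>- winv w b, \<alpha>\<rangle> \<in> \<int>" if "\<alpha> \<in> R" for \<alpha>
      using w(2)[OF W_root[OF w(1) that]] W_pairing[OF w(1) that, of "winv w b"] that w(1)
      by (simp add: pairing_simps W_inv_simps)
  qed (simp add: B_def)
  then show ?thesis using BA o_bij inv_unique_comp by metis
qed

lemma Wext_inv_simps: "A \<in> Wext \<Longrightarrow> A (winv A x) = x" "A \<in> Wext \<Longrightarrow> winv A (A x) = x"
  using Wext_inverse by (auto simp: bij_is_surj surj_f_inv_f bij_is_inj)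

lemma inv_Wext: "A \<in> Wext \<Longrightarrow> winv A \<in> Wext"
  using Wext_inverse by blast

lemma winv_comp: "A \<in> Wext \<Longrightarrow> B \<in> Wext \<Longrightarrow> winv (A \<circ> B) = winv B \<circ> winv A"
  using Wext_inverse by (simp add: o_inv_distrib)

lemma arefl_Wext: "a \<in> AR \<Longrightarrow> arefl a \<in> Wext"
proof (rule WextI[of "refl (fst a)" "- (of_int (snd a) *\<^sub>R fst a)"])
  assume a: "a \<in> AR"
  then show "refl (fst a) \<in> W" by (simp add: AR_iff refl_W)
  show "\<langle>- (of_int (snd a) *\<^sub>R fst a), \<alpha>\<rangle> \<in> \<int>" if "\<alpha> \<in> R" for \<alpha>
    using a that root_pairing_int[OF that, of "fst a"] by (simp add: pairing_simps AR_iff)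
qed (simp add: arefl_def refl_def val_def algebra_simps)

lemma winv_arefl: "a \<in> AR \<Longrightarrow> winv (arefl a) = arefl a"
  by (rule inv_equality) (auto simp: arefl_invol)

text \<open>
  The affine root \<open>a \<circ> A\<close>, found as the pair that represents this affine function.
\<close>

definition pull :: "('v \<Rightarrow> 'v) \<Rightarrow> 'v \<times> int \<Rightarrow> 'v \<times> int" where
  "pull A a = (SOME b. b \<in> AR \<and> (\<forall>x. val b x = val a (A x)))"

lemma pull_exists:
  assumes "A \<in> Wext" "a \<in> AR"
  shows "\<exists>b. b \<in> AR \<and> (\<forall>x. val b x = val a (A x))"
proof -
  obtain w c where w: "w \<in> W" "\<And>\<alpha>. \<alpha> \<in> R \<Longrightarrow> \<langle>c, \<alpha>\<rangle> \<in> \<int>" "\<And>x. A x = w x + c"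
    using assms WextE by metis
  have fa: "fst a \<in> R" using assms by (simp add: AR_iff)
  then obtain n :: int where n: "\<langle>c, fst a\<rangle> = of_int n" using w(2) by (meson Ints_cases)
  have "(winv w (fst a), snd a + n) \<in> AR" using fa w by (simp add: AR_iff W_root inv_W)
  moreover have "val (winv w (fst a), snd a + n) x = val a (A x)" for x
    using n fa w by (simp add: val_def pairing_simps W_pairing_inv)
  ultimately show ?thesis by blast
qed

lemma pull:
  assumes "A \<in> Wext" "a \<in> AR"
  shows "pull A a \<in> AR" "val (pull A a) x = val a (A x)"
proof -
  have "pull A a \<in> AR \<and> (\<forall>x. val (pull A a) x = val a (A x))"
    unfolding pull_def by (rule someI_ex[OF pull_exists[OF assms]])
  then show "pull A a \<in> AR" "val (pull A a) x = val a (A x)" by blast+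
qed

lemma pull_unique: "A \<in> Wext \<Longrightarrow> a \<in> AR \<Longrightarrow> b \<in> AR \<Longrightarrow> (\<And>x. val b x = val a (A x)) \<Longrightarrow> pull A a = b"
  by (rule val_inj) (simp_all add: pull)

lemma fst_pull:
  assumes "A \<in> Wext" "a \<in> AR" "w \<in> W" "\<And>x. A x = w x + c"
  shows "fst (pull A a) = winv w (fst a)"
proof -
  have fa: "fst a \<in> R" using assms by (simp add: AR_iff)
  obtain v b where v: "v \<in> W" "\<And>\<alpha>. \<alpha> \<in> R \<Longrightarrow> \<langle>b, \<alpha>\<rangle> \<in> \<int>" "\<And>x. A x = v x + b"
    using assms WextE by metis
  have "b = c" using v(3)[of 0] assms(4)[of 0] W_simps(5)[OF v(1)] W_simps(5)[OF assms(3)] by simp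
  then obtain n :: int where n: "\<langle>c, fst a\<rangle> = of_int n" using fa v(2) by (meson Ints_cases)
  have "pull A a = (winv w (fst a), snd a + n)"
  proof (rule pull_unique[OF assms(1,2)])
    show "(winv w (fst a), snd a + n) \<in> AR" using fa assms by (simp add: AR_iff W_root inv_W)
    show "val (winv w (fst a), snd a + n) x = val a (A x)" for x
      using n fa assms by (simp add: val_def pairing_simps W_pairing_inv)
  qed
  then show ?thesis by simp
qed

lemma arefl_pull:
  assumes "A \<in> Wext" "a \<in> AR"
  shows "arefl a \<circ> A = A \<circ> arefl (pull A a)"
proof
  fix x
  obtain w c where w: "w \<in> W" "\<And>\<alpha>. \<alpha> \<in> R \<Longrightarrow> \<langle>c, \<alpha>\<rangle> \<in> \<int>" "\<And>x. A x = w x + c"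
    using assms WextE by metis
  have "A (arefl (pull A a) x) = w x - val (pull A a) x *\<^sub>R w (fst (pull A a)) + c"
    unfolding arefl_def w(3) W_simps(2,3)[OF w(1)] ..
  also have "\<dots> = w x - val a (A x) *\<^sub>R w (winv w (fst a)) + c"
    unfolding fst_pull[OF assms w(1,3)] pull(2)[OF assms] ..
  also have "\<dots> = arefl a (A x)" using w by (simp add: arefl_def W_inv_simps)
  finally show "(arefl a \<circ> A) x = (A \<circ> arefl (pull A a)) x" by simp
qed

lemma pull_winv:
  assumes "A \<in> Wext" "a \<in> AR"
  shows "pull (winv A) (pull A a) = a" "pull A (pull (winv A) a) = a"
  using assms by (auto intro!: pull_unique simp: pull inv_Wext Wext_inv_simps)

lemma pull_aneg: "A \<in> Wext \<Longrightarrow> a \<in> AR \<Longrightarrow> pull A (aneg a) = aneg (pull A a)"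
  by (rule pull_unique) (auto simp: aneg_AR pull val_aneg)

text \<open>
  A point in the interior of the fundamental alcove on which different coroots take different values.
  With the bound \<open>1/2\<close> differences of these values lie strictly between \<open>-1\<close> and \<open>1\<close>, and none of them is an
  integer.
\<close>

definition good_point :: "'v \<Rightarrow> bool" where
  "good_point p \<longleftrightarrow> (\<forall>\<beta>\<in>P. \<langle>p, \<beta>\<rangle> > 0) \<and> (\<forall>\<gamma>\<in>R. \<bar>\<langle>p, \<gamma>\<rangle>\<bar> < 1/2) \<and>
    (\<forall>\<gamma>\<in>R. \<forall>\<delta>\<in>R. \<gamma> \<noteq> \<delta> \<longrightarrow> \<langle>p, \<gamma>\<rangle> \<noteq> \<langle>p, \<delta>\<rangle>)"

lemma exists_good_point: "\<exists>p. good_point p"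
proof -
  let ?F = "(\<lambda>(\<gamma>, \<delta>). (\<lambda>x. \<langle>x, \<gamma>\<rangle> - \<langle>x, \<delta>\<rangle>)) ` {(\<gamma>, \<delta>). \<gamma> \<in> R \<and> \<delta> \<in> R \<and> \<gamma> \<noteq> \<delta>}"
  have fin: "finite {(\<gamma>, \<delta>). \<gamma> \<in> R \<and> \<delta> \<in> R \<and> \<gamma> \<noteq> \<delta>}"
    by (rule finite_subset[of _ "R \<times> R"]) (auto simp: finite_roots)
  have "\<exists>v. \<forall>f\<in>?F. f v \<noteq> 0"
  proof (rule generic_vector)
    fix f assume "f \<in> ?F"
    then obtain \<gamma> \<delta> where f: "\<gamma> \<in> R" "\<delta> \<in> R" "\<gamma> \<noteq> \<delta>" "f = (\<lambda>x. \<langle>x, \<gamma>\<rangle> - \<langle>x, \<delta>\<rangle>)" by auto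
    have "coroot D \<gamma> \<noteq> coroot D \<delta>" using f coroot_inj by (metis inj_onD)
    then have "\<exists>u. f u \<noteq> 0" by (auto simp: f(4) fun_eq_iff)
    moreover have "linear f" by (rule linearI) (auto simp: f pairing_simps algebra_simps)
    ultimately show "linear f \<and> (\<exists>u. f u \<noteq> 0)" by blast
  qed (use fin in simp)
  then obtain v where v: "\<langle>v, \<gamma>\<rangle> \<noteq> \<langle>v, \<delta>\<rangle>" if "\<gamma> \<in> R" "\<delta> \<in> R" "\<gamma> \<noteq> \<delta>" for \<gamma> \<delta> by fastforce
  have 1: "\<forall>\<^sub>F \<epsilon> in at_right 0. \<forall>\<beta>\<in>P. \<langle>rho D + \<epsilon> *\<^sub>R v, \<beta>\<rangle> > 0"
  proof (rule eventually_ball_finite[OF finite_pos], rule ballI)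
    fix \<beta> assume b: "\<beta> \<in> P"
    have "((\<lambda>\<epsilon>. \<langle>rho D, \<beta>\<rangle> + \<epsilon> * \<langle>v, \<beta>\<rangle>) \<longlongrightarrow> \<langle>rho D, \<beta>\<rangle> + 0 * \<langle>v, \<beta>\<rangle>) (at_right 0)"
      by (intro tendsto_intros)
    then have "\<forall>\<^sub>F \<epsilon> in at_right 0. \<langle>rho D, \<beta>\<rangle> + \<epsilon> * \<langle>v, \<beta>\<rangle> > 0"
      using rho_pos[OF b] by (intro order_tendstoD(1)) auto
    then show "\<forall>\<^sub>F \<epsilon> in at_right 0. \<langle>rho D + \<epsilon> *\<^sub>R v, \<beta>\<rangle> > 0"
      using pos_root[OF b] by (simp add: pairing_simps)
  qed
  have 2: "\<forall>\<^sub>F \<epsilon> in at_right 0. \<forall>x\<in>{(\<gamma>, \<delta>). \<gamma> \<in> R \<and> \<delta> \<in> R \<and> \<gamma> \<noteq> \<delta>}.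
      \<langle>rho D + \<epsilon> *\<^sub>R v, fst x\<rangle> \<noteq> \<langle>rho D + \<epsilon> *\<^sub>R v, snd x\<rangle>"
  proof (rule eventually_ball_finite[OF fin], clarify)
    fix \<gamma> \<delta> assume g: "\<gamma> \<in> R" "\<delta> \<in> R" "\<gamma> \<noteq> \<delta>"
    have "\<forall>\<^sub>F \<epsilon> in at_right 0. (\<langle>rho D, \<gamma>\<rangle> - \<langle>rho D, \<delta>\<rangle>) + \<epsilon> * (\<langle>v, \<gamma>\<rangle> - \<langle>v, \<delta>\<rangle>) \<notin> \<int>"
      using v[OF g] by (intro eventually_not_int) simp
    then show "\<forall>\<^sub>F \<epsilon> in at_right 0. \<langle>rho D + \<epsilon> *\<^sub>R v, fst (\<gamma>, \<delta>)\<rangle> \<noteq> \<langle>rho D + \<epsilon> *\<^sub>R v, snd (\<gamma>, \<delta>)\<rangle>"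
    proof eventually_elim
      case (elim \<epsilon>)
      then show ?case using g by (auto simp: pairing_simps algebra_simps)
    qed
  qed
  obtain \<epsilon> where e: "\<forall>\<beta>\<in>P. \<langle>rho D + \<epsilon> *\<^sub>R v, \<beta>\<rangle> > 0"
    "\<forall>x\<in>{(\<gamma>, \<delta>). \<gamma> \<in> R \<and> \<delta> \<in> R \<and> \<gamma> \<noteq> \<delta>}. \<langle>rho D + \<epsilon> *\<^sub>R v, fst x\<rangle> \<noteq> \<langle>rho D + \<epsilon> *\<^sub>R v, snd x\<rangle>"
    using eventually_happens[OF eventually_conj[OF 1 2]] by auto
  define p where "p = rho D + \<epsilon> *\<^sub>R v"
  define K where "K = 1 + (\<Sum>\<gamma>\<in>R. \<bar>\<langle>p, \<gamma>\<rangle>\<bar>)"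
  have K: "K > 0" "\<gamma> \<in> R \<Longrightarrow> \<bar>\<langle>p, \<gamma>\<rangle>\<bar> < K" for \<gamma>
    using member_le_sum[of \<gamma> R "\<lambda>\<gamma>. \<bar>\<langle>p, \<gamma>\<rangle>\<bar>"] finite_roots
    by (auto simp: K_def intro!: add_pos_nonneg sum_nonneg)
  have "good_point ((1 / (2 * K)) *\<^sub>R p)"
    unfolding good_point_def
  proof (intro conjI ballI impI)
    show "\<langle>(1 / (2 * K)) *\<^sub>R p, \<beta>\<rangle> > 0" if "\<beta> \<in> P" for \<beta>
      using e(1) that K(1) pos_root[OF that] by (simp add: pairing_simps(3) flip: p_def)
    show "\<bar>\<langle>(1 / (2 * K)) *\<^sub>R p, \<gamma>\<rangle>\<bar> < 1 / 2" if "\<gamma> \<in> R" for \<gamma>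
      using K(1) K(2)[OF that] that by (simp add: pairing_simps abs_mult divide_simps)
    show "\<langle>(1 / (2 * K)) *\<^sub>R p, \<gamma>\<rangle> \<noteq> \<langle>(1 / (2 * K)) *\<^sub>R p, \<delta>\<rangle>" if "\<gamma> \<in> R" "\<delta> \<in> R" "\<gamma> \<noteq> \<delta>" for \<gamma> \<delta>
      using e(2) that K(1) by (auto simp: pairing_simps p_def)
  qed
  then show ?thesis by blast
qed

definition p0 :: 'v where "p0 = (SOME p. good_point p)"

lemma p0:
  "\<beta> \<in> P \<Longrightarrow> \<langle>p0, \<beta>\<rangle> > 0" "\<gamma> \<in> R \<Longrightarrow> \<bar>\<langle>p0, \<gamma>\<rangle>\<bar> < 1/2"
  "\<gamma> \<in> R \<Longrightarrow> \<delta> \<in> R \<Longrightarrow> \<gamma> \<noteq> \<delta> \<Longrightarrow> \<langle>p0, \<gamma>\<rangle> \<noteq> \<langle>p0, \<delta>\<rangle>"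
proof -
  have "good_point p0" unfolding p0_def by (rule someI_ex[OF exists_good_point])
  then show "\<beta> \<in> P \<Longrightarrow> \<langle>p0, \<beta>\<rangle> > 0" "\<gamma> \<in> R \<Longrightarrow> \<bar>\<langle>p0, \<gamma>\<rangle>\<bar> < 1/2"
    "\<gamma> \<in> R \<Longrightarrow> \<delta> \<in> R \<Longrightarrow> \<gamma> \<noteq> \<delta> \<Longrightarrow> \<langle>p0, \<gamma>\<rangle> \<noteq> \<langle>p0, \<delta>\<rangle>"
    unfolding good_point_def by blast+
qed

lemma p0_pos_iff: "\<gamma> \<in> R \<Longrightarrow> \<langle>p0, \<gamma>\<rangle> > 0 \<longleftrightarrow> \<gamma> \<in> P"
  using p0(1)[of \<gamma>] p0(1)[of "- \<gamma>"] pos_or_neg[of \<gamma>] by (auto simp: coroot_uminus)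

text \<open>
  Differences of pairings are kept away from the integers, and not only the pairings themselves, so
  that one root has the strictly largest pairing. The case of two opposite roots shows that a generic
  point lies on no affine hyperplane.
\<close>

definition generic :: "'v \<Rightarrow> bool" where
  "generic z \<longleftrightarrow> (\<forall>\<gamma>\<in>R. \<forall>\<delta>\<in>R. \<gamma> \<noteq> \<delta> \<longrightarrow> \<langle>z, \<gamma>\<rangle> - \<langle>z, \<delta>\<rangle> \<notin> \<int>)"

lemma generic_p0: "generic p0"
  unfolding generic_def
proof (intro ballI impI)
  fix \<gamma> \<delta> assume g: "\<gamma> \<in> R" "\<delta> \<in> R" "\<gamma> \<noteq> \<delta>"
  show "\<langle>p0, \<gamma>\<rangle> - \<langle>p0, \<delta>\<rangle> \<notin> \<int>"
  proof
    assume "\<langle>p0, \<gamma>\<rangle> - \<langle>p0, \<delta>\<rangle> \<in> \<int>"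
    then obtain n :: int where n: "\<langle>p0, \<gamma>\<rangle> - \<langle>p0, \<delta>\<rangle> = of_int n" by (elim Ints_cases)
    then have "\<bar>of_int n :: real\<bar> < 1" using p0(2)[OF g(1)] p0(2)[OF g(2)] by linarith
    then have "n = 0" by linarith
    then show False using n p0(3)[OF g] by simp
  qed
qed

lemma generic_Wext:
  assumes "A \<in> Wext" "generic z"
  shows "generic (A z)"
  unfolding generic_def
proof (intro ballI impI)
  fix \<gamma> \<delta> assume g: "\<gamma> \<in> R" "\<delta> \<in> R" "\<gamma> \<noteq> \<delta>"
  obtain w c where w: "w \<in> W" "\<And>\<alpha>. \<alpha> \<in> R \<Longrightarrow> \<langle>c, \<alpha>\<rangle> \<in> \<int>" "\<And>x. A x = w x + c"
    using assms WextE by metis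
  have "\<langle>z, winv w \<gamma>\<rangle> - \<langle>z, winv w \<delta>\<rangle> \<notin> \<int>"
    using assms(2) g w unfolding generic_def by (metis W_inv_simps(1) W_root inv_W)
  moreover have "\<langle>A z, \<gamma>\<rangle> - \<langle>A z, \<delta>\<rangle> = (\<langle>z, winv w \<gamma>\<rangle> - \<langle>z, winv w \<delta>\<rangle>) + (\<langle>c, \<gamma>\<rangle> - \<langle>c, \<delta>\<rangle>)"
    using g w by (simp add: pairing_simps W_pairing_inv)
  moreover have "\<langle>c, \<gamma>\<rangle> - \<langle>c, \<delta>\<rangle> \<in> \<int>" using w(2) g by simp
  ultimately show "\<langle>A z, \<gamma>\<rangle> - \<langle>A z, \<delta>\<rangle> \<notin> \<int>"
    by (metis Ints_diff add_diff_cancel_right')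
qed

lemma generic_val:
  assumes "generic z" "a \<in> AR"
  shows "val a z \<noteq> 0"
proof
  assume "val a z = 0"
  then have z: "\<langle>z, fst a\<rangle> = - of_int (snd a)" by (simp add: val_def)
  have a: "fst a \<in> R" using assms by (simp add: AR_iff)
  have "fst a \<noteq> - fst a" using coroot_self[OF a] pairing_simps(4)[OF a, of "fst a"] by auto
  then have "\<langle>z, fst a\<rangle> - \<langle>z, - fst a\<rangle> \<notin> \<int>" using assms(1) a uminus_root by (simp add: generic_def)
  then show False using a z by (simp add: coroot_uminus)
qed

lemma val_p0_Wext: "A \<in> Wext \<Longrightarrow> a \<in> AR \<Longrightarrow> val a (A p0) \<noteq> 0"
  using generic_val[OF generic_Wext[OF _ generic_p0]] .

lemma val_p0: "a \<in> AR \<Longrightarrow> val a p0 \<noteq> 0"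
  by (intro generic_val generic_p0)

lemma val_p0_pos_iff:
  assumes "a \<in> AR"
  shows "val a p0 > 0 \<longleftrightarrow> snd a \<ge> 1 \<or> (snd a = 0 \<and> fst a \<in> P)"
proof -
  have a: "fst a \<in> R" using assms by (simp add: AR_iff)
  consider "snd a \<ge> 1" | "snd a = 0" | "snd a \<le> -1" by linarith
  then show ?thesis
  proof cases
    case 1
    then have "(of_int (snd a) :: real) \<ge> 1" by simp
    then have "val a p0 > 0" using p0(2)[OF a] unfolding val_def by linarith
    then show ?thesis using 1 by simp
  next
    case 2 then show ?thesis using p0_pos_iff[OF a] by (simp add: val_def)
  next
    case 3
    then have "(of_int (snd a) :: real) \<le> -1" by linarith
    then have "\<not> val a p0 > 0" using p0(2)[OF a] unfolding val_def by linarith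
    then show ?thesis using 3 by auto
  qed
qed

text \<open>
  The simple affine roots, characterised by the property that no other hyperplane separates the
  fundamental alcove from its mirror image. It is this property that the Hecke operators use.
\<close>

definition S :: "('v \<times> int) set" where
  "S = {a \<in> AR. val a p0 > 0 \<and> (\<forall>b\<in>AR. val b p0 > 0 \<longrightarrow> val b (arefl a p0) < 0 \<longrightarrow> b = a)}"

lemma S_AR: "a \<in> S \<Longrightarrow> a \<in> AR" and S_pos: "a \<in> S \<Longrightarrow> val a p0 > 0"
  unfolding S_def by blast+

lemma S_sign:
  assumes "a \<in> S" "b \<in> AR" "b \<noteq> a" "b \<noteq> aneg a"
  shows "val b (arefl a p0) < 0 \<longleftrightarrow> val b p0 < 0"
proof -
  have nz: "val b p0 \<noteq> 0" "val b (arefl a p0) \<noteq> 0"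
    using assms S_AR val_p0 val_p0_Wext arefl_Wext by auto
  have "aneg b \<noteq> a" using assms(4) aneg_aneg by metis
  moreover have uniq: "val c p0 > 0 \<Longrightarrow> val c (arefl a p0) < 0 \<Longrightarrow> c \<in> AR \<Longrightarrow> c = a" for c
    using assms(1) unfolding S_def by blast
  ultimately have "\<not> (val b p0 > 0 \<and> val b (arefl a p0) < 0)"
    "\<not> (val b p0 < 0 \<and> val b (arefl a p0) > 0)"
    using uniq[of b] uniq[of "aneg b"] assms(2,3) aneg_AR[OF assms(2)] val_aneg[OF assms(2)] by auto
  then show ?thesis using nz by linarith
qed

lemma simple_S: "i \<in> I \<Longrightarrow> (sr i, 0) \<in> S"
  unfolding S_def mem_Collect_eq
proof (intro conjI ballI impI)
  assume i: "i \<in> I"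
  show A: "(sr i, 0) \<in> AR" using i by (simp add: AR_iff simple_root)
  show "val (sr i, 0) p0 > 0" using p0(1)[OF simple_pos[OF i]] by (simp add: val_def)
  fix b assume b: "b \<in> AR" "val b p0 > 0" "val b (arefl (sr i, 0) p0) < 0"
  have fb: "fst b \<in> R" using b by (simp add: AR_iff)
  have "arefl (sr i, 0) = s i" by (rule ext) (simp add: arefl_def s_def refl_def val_def)
  then have neg: "\<langle>p0, s i (fst b)\<rangle> + of_int (snd b) < 0"
    using b(3) i fb by (simp add: val_def s_def coroot_refl simple_root)
  then have "(of_int (snd b) :: real) < 1"
    using p0(2)[OF s_root[OF i fb]] by linarith
  then have b0: "snd b = 0" "fst b \<in> P" using b val_p0_pos_iff[OF b(1)] by auto
  then have "s i (fst b) \<notin> P" using neg p0(1)[of "s i (fst b)"] by auto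
  then have "fst b = sr i" using s_pos[OF i b0(2)] by blast
  then show "b = (sr i, 0)" using b0 by (simp add: prod_eq_iff)
qed

text \<open>
  A point outside the fundamental alcove lies behind one of its walls. Beyond a finite wall this is
  clear; for a dominant generic point the wall is that of the root \<open>\<theta>\<close> whose coroot takes the
  largest value there. Maximality replaces the classification of affine diagrams: the coroot of
  the reflection of any positive root in \<open>\<theta>\<close> is again bounded by that maximum.
\<close>

lemma descent:
  assumes g: "generic z" and a: "a \<in> AR" "val a p0 > 0" "val a z < 0"
  shows "\<exists>b\<in>S. val b z < 0"
proof (cases "\<exists>i\<in>I. \<langle>z, sr i\<rangle> < 0")
  case True
  then show ?thesis using simple_S by (force simp: val_def)
next
  case False
  have zs: "\<langle>z, sr i\<rangle> > 0" if "i \<in> I" for i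
    using generic_val[OF g, of "(sr i, 0)"] False that by (force simp: val_def AR_iff simple_root)
  have zp: "\<beta> \<in> P \<Longrightarrow> \<langle>z, \<beta>\<rangle> > 0" for \<beta> using dominant_pairing_pos zs by blast
  obtain \<alpha> k where ak: "a = (\<alpha>, k)" by fastforce
  have al: "\<alpha> \<in> R" using a ak by (simp add: AR_iff)
  have nP: "- \<alpha> \<in> P" and k1: "k \<ge> 1"
  proof -
    have "\<alpha> \<notin> P"
    proof
      assume "\<alpha> \<in> P"
      then have "k \<ge> 0" "\<langle>z, \<alpha>\<rangle> > 0" using a val_p0_pos_iff[OF a(1)] ak zp by auto
      then show False using a ak by (simp add: val_def)
    qed
    then show "- \<alpha> \<in> P" "k \<ge> 1" using al pos_or_neg a val_p0_pos_iff[OF a(1)] ak by auto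
  qed
  have "(of_int k :: real) \<ge> 1" using k1 by simp
  then have big: "\<langle>z, - \<alpha>\<rangle> > 1" using a(3) ak al by (simp add: val_def coroot_uminus)
  obtain \<theta> where t: "\<theta> \<in> R" "\<And>\<delta>. \<delta> \<in> R \<Longrightarrow> \<langle>z, \<delta>\<rangle> \<le> \<langle>z, \<theta>\<rangle>"
  proof -
    have "Max ((\<lambda>\<delta>. \<langle>z, \<delta>\<rangle>) ` R) \<in> (\<lambda>\<delta>. \<langle>z, \<delta>\<rangle>) ` R" using al finite_roots by (intro Max_in) auto
    then obtain \<theta> where "\<theta> \<in> R" "\<langle>z, \<theta>\<rangle> = Max ((\<lambda>\<delta>. \<langle>z, \<delta>\<rangle>) ` R)" by force
    then show thesis using that[of \<theta>] finite_roots by simp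
  qed
  have uniq: "\<delta> = \<theta>" if "\<delta> \<in> R" "\<langle>z, \<delta>\<rangle> = \<langle>z, \<theta>\<rangle>" for \<delta>
    using g that t(1) unfolding generic_def by (metis Ints_0 diff_self)
  define c where "c = \<langle>z, \<theta>\<rangle>"
  have c1: "c > 1" using big t(2)[OF uminus_root[OF al]] by (simp add: c_def)
  have tP: "\<theta> \<in> P"
  proof (rule ccontr)
    assume "\<theta> \<notin> P"
    then have "\<langle>z, - \<theta>\<rangle> > 0" using zp pos_or_neg t(1) by blast
    then show False using c1 t(1) by (simp add: c_def coroot_uminus)
  qed
  \<comment> \<open>the wall of the fundamental alcove that is not a finite one\<close>
  let ?b = "(- \<theta>, 1::int)"
  have bAR: "?b \<in> AR" using t by (simp add: AR_iff uminus_root)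
  have "val ?b z < 0" using c1 t(1) by (simp add: val_def coroot_uminus c_def)
  moreover have "?b \<in> S"
    unfolding S_def mem_Collect_eq
  proof (intro conjI ballI impI)
    show "?b \<in> AR" by (rule bAR)
    show "val ?b p0 > 0" using val_p0_pos_iff[OF bAR] by simp
    fix d assume d: "d \<in> AR" "val d p0 > 0" "val d (arefl ?b p0) < 0"
    obtain \<gamma> m where gm: "d = (\<gamma>, m)" by fastforce
    have gR: "\<gamma> \<in> R" using d gm by (simp add: AR_iff)
    obtain n :: int where n: "\<langle>\<theta>, \<gamma>\<rangle> = of_int n" using root_pairing_int[OF gR t(1)] by (elim Ints_cases)
    have rr: "refl \<theta> \<gamma> \<in> R" "\<langle>x, refl \<theta> \<gamma>\<rangle> = \<langle>x, \<gamma>\<rangle> - \<langle>x, \<theta>\<rangle> * of_int n" for x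
      using t gR n by (simp_all add: refl_root coroot_refl pairing_refl)
    have vd: "\<langle>p0, refl \<theta> \<gamma>\<rangle> + of_int (n + m) < 0"
      using d(3) val_arefl[OF bAR d(1), of p0] gm t(1) gR rr(2)[of p0] n
      by (simp add: val_def coroot_uminus pairing_simps algebra_simps)
    have nm0: "n + m \<le> 0"
    proof (rule ccontr)
      assume "\<not> n + m \<le> 0"
      then have "(of_int (n + m) :: real) \<ge> 1" by linarith
      then show False using vd p0(2)[OF rr(1)] by linarith
    qed
    show "d = ?b"
    proof (cases "\<gamma> \<in> P")
      case True
      then have m0: "m \<ge> 0" using d val_p0_pos_iff[OF d(1)] gm by auto
      have "\<langle>z, \<theta>\<rangle> - \<langle>z, \<gamma>\<rangle> * \<langle>\<gamma>, \<theta>\<rangle> \<le> \<langle>z, \<theta>\<rangle>"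
        using t(2)[OF refl_root[OF gR t(1)]] gR t(1) by (simp add: coroot_refl pairing_refl)
      then have "\<langle>\<gamma>, \<theta>\<rangle> \<ge> 0" using zp[OF True] by (simp add: zero_le_mult_iff)
      then have "n \<ge> 0" using pairing_sign_symmetric[OF gR t(1)] n
        by (metis less_eq_real_def of_int_0_le_iff)
      then have nm: "n = 0" "m = 0" using nm0 m0 by auto
      then have "val d p0 < 0" using vd rr(2)[of p0] gm by (simp add: val_def)
      then show ?thesis using d(2) by simp
    next
      case False
      define \<delta> where "\<delta> = - \<gamma>"
      have dP: "\<delta> \<in> P" using False gR pos_or_neg by (auto simp: \<delta>_def)
      have dz: "\<langle>z, \<gamma>\<rangle> = - \<langle>z, \<delta>\<rangle>" using gR by (simp add: \<delta>_def coroot_uminus)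
      have m1: "m \<ge> 1" using d val_p0_pos_iff[OF d(1)] gm False by auto
      have dc: "\<langle>z, \<delta>\<rangle> \<le> c" using t(2) dP pos_root by (simp add: c_def)
      have rc: "\<langle>z, refl \<theta> \<gamma>\<rangle> \<le> c" "\<langle>z, refl \<theta> \<gamma>\<rangle> = - \<langle>z, \<delta>\<rangle> - c * of_int n"
        using t(2)[OF rr(1)] rr(2)[of z] dz unfolding c_def by argo+
      \<comment> \<open>otherwise the reflected root would exceed the maximum\<close>
      have "n \<ge> -2"
      proof (rule ccontr)
        assume "\<not> ?thesis"
        then have "- (of_int n :: real) \<ge> 3" by linarith
        then have "c * (- of_int n) \<ge> c * 3" using c1 by (intro mult_left_mono) auto
        then show False using rc dc c1 by (simp add: algebra_simps)
      qed
      then consider "n = -2" | "n = -1" "m = 1" using nm0 m1 by linarith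
      then show ?thesis
      proof cases
        case 1
        then have "\<langle>z, \<delta>\<rangle> = c" using rc dc by simp
        then have dt: "\<delta> = \<theta>" using uniq dP pos_root by (simp add: c_def)
        then have gt: "\<gamma> = - \<theta>" unfolding \<delta>_def by (metis minus_minus)
        have "\<langle>p0, refl \<theta> \<gamma>\<rangle> = \<langle>p0, \<theta>\<rangle>" using rr(2)[of p0] 1 gt t(1) by (simp add: coroot_uminus)
        then have "(of_int (m - 2) :: real) < 0" using vd 1 p0(1)[OF tP] by simp
        then have "m = 1" using m1 by linarith
        then show ?thesis using gm gt by simp
      next
        case 2
        then have "\<langle>z, refl \<theta> \<gamma>\<rangle> \<ge> 0" using rc dc by simp
        then have "refl \<theta> \<gamma> \<in> P"
          using zp[of "- refl \<theta> \<gamma>"] pos_or_neg[OF rr(1)] rr(1) by (auto simp: coroot_uminus)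
        then have "\<langle>p0, refl \<theta> \<gamma>\<rangle> > 0" by (rule p0(1))
        then show ?thesis using vd 2 by simp
      qed
    qed
  qed
  ultimately show ?thesis by blast
qed

text \<open>
  The hyperplanes that separate \<open>z\<close> from the fundamental alcove, each represented by the affine root
  that is negative at \<open>z\<close>. Their number is the measure for all descents towards that alcove.
\<close>

definition Neg :: "'v \<Rightarrow> ('v \<times> int) set" where
  "Neg z = {a \<in> AR. val a p0 > 0 \<and> val a z < 0}"

lemma finite_Neg: "finite (Neg z)"
proof (rule finite_subset)
  show "Neg z \<subseteq> (SIGMA \<alpha>:R. {\<lfloor>- \<langle>p0, \<alpha>\<rangle>\<rfloor>..\<lceil>- \<langle>z, \<alpha>\<rangle>\<rceil>})"
  proof
    fix a assume "a \<in> Neg z"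
    then have "fst a \<in> R" "- \<langle>p0, fst a\<rangle> < of_int (snd a)" "of_int (snd a) < - \<langle>z, fst a\<rangle>"
      by (auto simp: Neg_def AR_iff val_def)
    moreover from this have "\<lfloor>- \<langle>p0, fst a\<rangle>\<rfloor> \<le> snd a" "snd a \<le> \<lceil>- \<langle>z, fst a\<rangle>\<rceil>"
      by linarith+
    ultimately show "a \<in> (SIGMA \<alpha>:R. {\<lfloor>- \<langle>p0, \<alpha>\<rangle>\<rfloor>..\<lceil>- \<langle>z, \<alpha>\<rangle>\<rceil>})"
      by (cases a) simp
  qed
qed (simp add: finite_roots)

lemma Neg_nonempty: "generic z \<Longrightarrow> Neg z \<noteq> {} \<Longrightarrow> \<exists>b\<in>S. val b z < 0"
  using descent unfolding Neg_def by blast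

text \<open>
  Reflecting in a wall of the fundamental alcove that separates \<open>z\<close> from it removes this wall from the
  separating hyperplanes and reflects the other ones.
\<close>

lemma card_Neg_step:
  assumes "b \<in> S" "val b z < 0" "generic z"
  shows "card (Neg (arefl b z)) < card (Neg z)"
proof -
  have b: "b \<in> AR" "arefl b \<in> Wext" using assms S_AR arefl_Wext by auto
  have sub: "pull (arefl b) ` Neg (arefl b z) \<subseteq> Neg z - {b}"
  proof (rule image_subsetI)
    fix a assume a: "a \<in> Neg (arefl b z)"
    then have aR: "a \<in> AR" "val a p0 > 0" "val a (arefl b z) < 0" by (auto simp: Neg_def)
    have ne: "a \<noteq> b" using aR(3) val_arefl_self[OF b(1)] assms(2) by auto
    have ne': "a \<noteq> aneg b" using aR(2) S_pos[OF assms(1)] val_aneg[OF b(1), of p0] by auto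
    have "val a (arefl b p0) > 0"
      using S_sign[OF assms(1) aR(1) ne ne'] aR(2) val_p0_Wext[OF b(2) aR(1)] by linarith
    then have "pull (arefl b) a \<in> Neg z" using aR pull[OF b(2) aR(1)] by (simp add: Neg_def)
    moreover have "pull (arefl b) a \<noteq> b"
    proof
      assume "pull (arefl b) a = b"
      then have "val b (arefl b p0) = val a p0" using pull(2)[OF b(2) aR(1)] arefl_invol[OF b(1)] by metis
      then show False using aR(2) val_arefl_self[OF b(1)] S_pos[OF assms(1)] by simp
    qed
    ultimately show "pull (arefl b) a \<in> Neg z - {b}" by blast
  qed
  have inj: "inj_on (pull (arefl b)) (Neg (arefl b z))"
  proof (rule inj_on_inverseI[where g="pull (arefl b)"])
    fix a assume "a \<in> Neg (arefl b z)"
    then have "a \<in> AR" by (simp add: Neg_def)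
    then show "pull (arefl b) (pull (arefl b) a) = a"
      using pull_winv(1)[OF b(2)] winv_arefl[OF b(1)] by simp
  qed
  have bz: "b \<in> Neg z" using assms S_AR S_pos by (auto simp: Neg_def)
  have "card (Neg (arefl b z)) \<le> card (Neg z - {b})"
    by (rule card_inj_on_le[OF inj sub]) (simp add: finite_Neg)
  also have "\<dots> < card (Neg z)" using bz finite_Neg by (intro psubset_card_mono) auto
  finally show ?thesis .
qed

end

section \<open>Hecke operators on functions on the extended affine Weyl group\<close>

abbreviation q :: laurent where "q \<equiv> t_half"
abbreviation qi :: laurent where "qi \<equiv> t_half_inv"

lemma q_qi [simp]: "q * qi = 1" "qi * q = 1"
  by (simp_all add: t_half_def t_half_inv_def mult_single)

lemma q_qi_left [simp]: "q * (qi * x) = x" "qi * (q * x) = x"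
  by (simp_all flip: mult.assoc)

definition zeta :: laurent where "zeta = qi - q"

context root_datum
begin

abbreviation sa :: "nat \<Rightarrow> 'v \<times> int" where "sa i \<equiv> (sr i, 0)"

text \<open>
  Left multiplication by a generator of the Hecke algebra with the quadratic relation
  \<open>T\<^sup>2 = zeta T + 1\<close>, whose roots are \<open>q\<^sup>-\<^sup>1\<close> and \<open>- q\<close>. Elements of the group are thought of as alcoves,
  and whether the length goes up or down is read off from the image of the base point. Functions
  are zero outside the group, so that equality of functions is equality on the group.
\<close>

definition Lop :: "'v \<times> int \<Rightarrow> (('v \<Rightarrow> 'v) \<Rightarrow> laurent) \<Rightarrow> ('v \<Rightarrow> 'v) \<Rightarrow> laurent" where
  "Lop a v B = (if B \<in> Wext then v (arefl a \<circ> B) + (if val a (B p0) < 0 then zeta * v B else 0) else 0)"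

definition Linv :: "'v \<times> int \<Rightarrow> (('v \<Rightarrow> 'v) \<Rightarrow> laurent) \<Rightarrow> ('v \<Rightarrow> 'v) \<Rightarrow> laurent" where
  "Linv a v B = (if B \<in> Wext then v (arefl a \<circ> B) - (if val a (B p0) > 0 then zeta * v B else 0) else 0)"

definition Rop :: "'v \<times> int \<Rightarrow> (('v \<Rightarrow> 'v) \<Rightarrow> laurent) \<Rightarrow> ('v \<Rightarrow> 'v) \<Rightarrow> laurent" where
  "Rop b v B = (if B \<in> Wext then v (B \<circ> arefl b) + (if val b (winv B p0) < 0 then zeta * v B else 0) else 0)"

definition Rinv :: "'v \<times> int \<Rightarrow> (('v \<Rightarrow> 'v) \<Rightarrow> laurent) \<Rightarrow> ('v \<Rightarrow> 'v) \<Rightarrow> laurent" where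
  "Rinv b v B = (if B \<in> Wext then v (B \<circ> arefl b) - (if val b (winv B p0) > 0 then zeta * v B else 0) else 0)"

definition supp :: "(('v \<Rightarrow> 'v) \<Rightarrow> laurent) \<Rightarrow> bool" where
  "supp v \<longleftrightarrow> (\<forall>B. B \<notin> Wext \<longrightarrow> v B = 0)"

lemma supp_ops: "supp (Lop a v)" "supp (Linv a v)" "supp (Rop b v)" "supp (Rinv b v)"
  by (auto simp: supp_def Lop_def Linv_def Rop_def Rinv_def)

lemma supp_lin: "supp v \<Longrightarrow> supp w \<Longrightarrow> supp (\<lambda>B. c * v B + d * w B)"
  by (simp add: supp_def)

lemma Rop_lin: "Rop b (\<lambda>B. c * v B + d * w B) = (\<lambda>B. c * Rop b v B + d * Rop b w B)"
  by (auto simp: Rop_def fun_eq_iff algebra_simps)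

lemma Rinv_lin: "Rinv b (\<lambda>B. c * v B + d * w B) = (\<lambda>B. c * Rinv b v B + d * Rinv b w B)"
  by (auto simp: Rinv_def fun_eq_iff algebra_simps)

lemma Linv_Lop: "a \<in> AR \<Longrightarrow> supp v \<Longrightarrow> Linv a v = (\<lambda>B. 1 * Lop a v B + (- zeta) * v B)"
  using val_p0_Wext[of _ a] by (force simp: Linv_def Lop_def supp_def fun_eq_iff)

lemma Rinv_Rop: "b \<in> AR \<Longrightarrow> supp v \<Longrightarrow> Rinv b v = (\<lambda>B. 1 * Rop b v B + (- zeta) * v B)"
  using val_p0_Wext[OF inv_Wext, of _ b] by (force simp: Rinv_def Rop_def supp_def fun_eq_iff)

text \<open>
  The two signs involved are affected by the other reflection only when both reflections lead to the
  same element, because a simple affine reflection moves the base point across a single hyperplane.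
  In that exceptional case both signs agree, and both are reversed. The braid relations of the Hecke
  algebra are encoded in this commutation.
\<close>

lemma Lop_Rop_commute:
  assumes a: "a \<in> S" and b: "b \<in> S"
  shows "Lop a (Rop b v) = Rop b (Lop a v)"
proof
  fix B
  show "Lop a (Rop b v) B = Rop b (Lop a v) B"
  proof (cases "B \<in> Wext")
    case B: True
    have aR: "a \<in> AR" and bR: "b \<in> AR" using a b S_AR by auto
    have W1: "arefl a \<circ> B \<in> Wext" "B \<circ> arefl b \<in> Wext"
      using B aR bR by (simp_all add: comp_Wext arefl_Wext)
    define c where "c = pull B a"
    have c: "c \<in> AR" "\<And>x. val c x = val a (B x)" using pull[OF B aR] by (auto simp: c_def)
    define d where "d = pull (winv B) b"
    have d: "d \<in> AR" "\<And>x. val d x = val b (winv B x)" using pull[OF inv_Wext[OF B] bR] by (auto simp: d_def)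
    have cd: "c = b \<longleftrightarrow> d = a" "c = aneg b \<longleftrightarrow> d = aneg a"
    proof -
      have 1: "pull (winv B) c = a" "pull B d = b" using pull_winv[OF B] aR bR by (auto simp: c_def d_def)
      show "c = b \<longleftrightarrow> d = a" using 1 by (auto simp: c_def d_def)
      show "c = aneg b \<longleftrightarrow> d = aneg a"
        using 1 pull_aneg[OF B] pull_aneg[OF inv_Wext[OF B]] aR bR c(1) d(1) c_def d_def aneg_aneg
        by metis
    qed
    define CL where "CL = (val a (B p0) < 0)"
    define CR where "CR = (val b (winv B p0) < 0)"
    define CL' where "CL' = (val a (B (arefl b p0)) < 0)"
    define CR' where "CR' = (val b (winv B (arefl a p0)) < 0)"
    have wi: "winv (arefl a \<circ> B) = winv B \<circ> arefl a" "winv (B \<circ> arefl b) = arefl b \<circ> winv B"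
      using B aR bR by (simp_all add: winv_comp arefl_Wext winv_arefl)
    have lhs: "Lop a (Rop b v) B = v (arefl a \<circ> B \<circ> arefl b) + (if CR' then zeta * v (arefl a \<circ> B) else 0) +
        (if CL then zeta * (v (B \<circ> arefl b) + (if CR then zeta * v B else 0)) else 0)"
      using B W1 wi by (simp add: Lop_def Rop_def CL_def CR_def CR'_def)
    have rhs: "Rop b (Lop a v) B = v (arefl a \<circ> B \<circ> arefl b) + (if CL' then zeta * v (B \<circ> arefl b) else 0) +
        (if CR then zeta * (v (arefl a \<circ> B) + (if CL then zeta * v B else 0)) else 0)"
      unfolding Rop_def[of b "Lop a v"] Lop_def[of a v] CL_def CR_def CL'_def
      using B W1 by (simp add: o_assoc)
    show ?thesis
    proof (cases "c = b \<or> c = aneg b")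
      case False
      then have "CL' = CL" "CR' = CR"
        using S_sign[OF b c(1)] S_sign[OF a d(1)] cd by (auto simp: CL_def CL'_def CR_def CR'_def c d)
      then show ?thesis unfolding lhs rhs by (auto simp: algebra_simps)
    next
      case True
      \<comment> \<open>the exceptional case, in which both reflections lead to the same element\<close>
      then have ab: "arefl a \<circ> B = B \<circ> arefl b"
        using arefl_pull[OF B aR] arefl_aneg[OF bR] by (auto simp: c_def)
      have nz: "val a (B p0) \<noteq> 0" "val b (winv B p0) \<noteq> 0" "val a p0 > 0" "val b p0 > 0"
        using val_p0_Wext B inv_Wext aR bR a b S_pos by auto
      have s1: "CL \<longleftrightarrow> CR"
      proof -
        have "CL \<longleftrightarrow> val c p0 < 0" "CR \<longleftrightarrow> val d p0 < 0" unfolding CL_def CR_def c(2) d(2) by simp_all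
        then show ?thesis
          using True cd nz(3,4) val_aneg[OF aR, of p0] val_aneg[OF bR, of p0] by force
      qed
      have eqs: "B (arefl b p0) = arefl a (B p0)" "winv B (arefl a p0) = arefl b (winv B p0)"
      proof -
        show "B (arefl b p0) = arefl a (B p0)" using fun_cong[OF ab, of p0] by simp
        have "winv (arefl a \<circ> B) = winv (B \<circ> arefl b)" using ab by simp
        then show "winv B (arefl a p0) = arefl b (winv B p0)"
          unfolding wi by (metis comp_apply)
      qed
      then have s2: "CL' \<longleftrightarrow> \<not> CL" "CR' \<longleftrightarrow> \<not> CR"
        using nz(1,2) unfolding CL_def CR_def CL'_def CR'_def eqs val_arefl_self[OF aR] val_arefl_self[OF bR]
        by linarith+
      show ?thesis unfolding lhs rhs using s1 s2 ab by (auto simp: algebra_simps)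
    qed
  qed (simp add: Lop_def Rop_def)
qed

definition delta :: "('v \<Rightarrow> 'v) \<Rightarrow> ('v \<Rightarrow> 'v) \<Rightarrow> laurent" where
  "delta A B = (if B = A then 1 else 0)"

lemma supp_delta: "A \<in> Wext \<Longrightarrow> supp (delta A)"
  by (auto simp: supp_def delta_def)

lemma comp_eq_iff:
  assumes "a \<in> AR"
  shows "arefl a \<circ> B = A \<longleftrightarrow> B = arefl a \<circ> A" "B \<circ> arefl a = A \<longleftrightarrow> B = A \<circ> arefl a"
proof -
  have "arefl a \<circ> arefl a = id" using arefl_invol[OF assms] by (simp add: fun_eq_iff)
  then show "arefl a \<circ> B = A \<longleftrightarrow> B = arefl a \<circ> A" "B \<circ> arefl a = A \<longleftrightarrow> B = A \<circ> arefl a"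
    by (metis comp_assoc comp_id id_comp)+
qed

lemma Rop_delta:
  assumes "A \<in> Wext" "b \<in> AR"
  shows "Rop b (delta A) =
    (\<lambda>B. delta (A \<circ> arefl b) B + (if val b (winv A p0) < 0 then zeta * delta A B else 0))"
proof
  fix B
  have "A \<circ> arefl b \<in> Wext" using assms by (simp add: comp_Wext arefl_Wext)
  then show "Rop b (delta A) B = delta (A \<circ> arefl b) B + (if val b (winv A p0) < 0 then zeta * delta A B else 0)"
    unfolding Rop_def delta_def comp_eq_iff[OF assms(2)] using assms(1)
    by (cases "B = A"; cases "B \<in> Wext") auto
qed

lemma Lop_delta:
  assumes "A \<in> Wext" "a \<in> AR"
  shows "Lop a (delta A) =
    (\<lambda>B. delta (arefl a \<circ> A) B + (if val a (A p0) < 0 then zeta * delta A B else 0))"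
proof
  fix B
  have "arefl a \<circ> A \<in> Wext" using assms by (simp add: comp_Wext arefl_Wext)
  then show "Lop a (delta A) B = delta (arefl a \<circ> A) B + (if val a (A p0) < 0 then zeta * delta A B else 0)"
    unfolding Lop_def delta_def comp_eq_iff[OF assms(2)] using assms(1)
    by (cases "B = A"; cases "B \<in> Wext") auto
qed

lemma Linv_delta:
  assumes "A \<in> Wext" "a \<in> AR" "val a (A p0) < 0"
  shows "Linv a (delta A) = delta (arefl a \<circ> A)"
  using assms by (simp add: Linv_Lop supp_delta Lop_delta)

section \<open>The antispherical functionals\<close>

definition dom_alcove :: "('v \<Rightarrow> 'v) \<Rightarrow> bool" where
  "dom_alcove C \<longleftrightarrow> C \<in> Wext \<and> (\<forall>\<beta>\<in>P. \<langle>C p0, \<beta>\<rangle> > 0)"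

text \<open>
  Summation over a finite Weyl group orbit of alcoves against the sign character of the finite Hecke
  algebra.
\<close>

definition sign_sum :: "('v \<Rightarrow> 'v) \<Rightarrow> (('v \<Rightarrow> 'v) \<Rightarrow> laurent) \<Rightarrow> laurent" where
  "sign_sum C v = (\<Sum>u\<in>W. (- q) ^ card (inversions u) * v (u \<circ> C))"

lemma sign_sum_lin: "sign_sum C (\<lambda>B. c * v B + d * w B) = c * sign_sum C v + d * sign_sum C w"
  by (simp add: sign_sum_def algebra_simps sum.distrib sum_distrib_left)

lemma arefl_sa: "arefl (sa i) = s i"
  by (rule ext) (simp add: arefl_def s_def refl_def val_def)

lemma s_comp_bij: "i \<in> I \<Longrightarrow> bij_betw (\<lambda>u. s i \<circ> u) W W"
  by (rule bij_betw_byWitness[where f'="\<lambda>u. s i \<circ> u"])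
    (auto simp: comp_W s_W s_comp_s simp flip: comp_assoc)

text \<open>
  The generator acts on the sums by the eigenvalue \<open>- q\<close> of the sign character: the terms of \<open>u\<close> and of
  \<open>s\<^sub>i u\<close> cancel.
\<close>

lemma sign_sum_Lop:
  assumes C: "dom_alcove C" and i: "i \<in> I"
  shows "sign_sum C (\<lambda>B. 1 * Lop (sa i) v B + q * v B) = 0"
proof -
  have "sign_sum C (Lop (sa i) v) = (\<Sum>u\<in>W. (- q) ^ card (inversions u) * v (s i \<circ> u \<circ> C)) +
      (\<Sum>u\<in>W. (- q) ^ card (inversions u) * (if val (sa i) (u (C p0)) < 0 then zeta * v (u \<circ> C) else 0))"
    using C unfolding sign_sum_def dom_alcove_def
    by (subst sum.distrib[symmetric], intro sum.cong)
      (auto simp: Lop_def arefl_sa comp_Wext W_Wext comp_assoc algebra_simps)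
  also have "(\<Sum>u\<in>W. (- q) ^ card (inversions u) * v (s i \<circ> u \<circ> C)) =
      (\<Sum>u\<in>W. (- q) ^ card (inversions (s i \<circ> u)) * v (u \<circ> C))"
    using sum.reindex_bij_betw[OF s_comp_bij[OF i], of "\<lambda>u. (- q) ^ card (inversions (s i \<circ> u)) * v (u \<circ> C)"]
    by (simp add: s_comp_s[OF i] flip: comp_assoc)
  finally have "sign_sum C (\<lambda>B. 1 * Lop (sa i) v B + q * v B) =
      (\<Sum>u\<in>W. (- q) ^ card (inversions (s i \<circ> u)) * v (u \<circ> C)) +
      (\<Sum>u\<in>W. (- q) ^ card (inversions u) * (if val (sa i) (u (C p0)) < 0 then zeta * v (u \<circ> C) else 0)) +
      q * (\<Sum>u\<in>W. (- q) ^ card (inversions u) * v (u \<circ> C))"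
    unfolding sign_sum_lin by (simp only: sign_sum_def[of C v] mult_1)
  also have "\<dots> = (\<Sum>u\<in>W. (- q) ^ card (inversions (s i \<circ> u)) * v (u \<circ> C) +
      (- q) ^ card (inversions u) * (if val (sa i) (u (C p0)) < 0 then zeta * v (u \<circ> C) else 0) +
      q * ((- q) ^ card (inversions u) * v (u \<circ> C)))"
    by (simp add: sum.distrib sum_distrib_left)
  also have "\<dots> = 0"
  proof (rule sum.neutral, rule ballI)
    fix u assume u: "u \<in> W"
    have ur: "winv u (sr i) \<in> R" using u i by (simp add: W_root inv_W simple_root)
    have v: "val (sa i) (u (C p0)) = \<langle>C p0, winv u (sr i)\<rangle>"
      using u i by (simp add: val_def W_pairing_inv simple_root)
    show "(- q) ^ card (inversions (s i \<circ> u)) * v (u \<circ> C) +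
      (- q) ^ card (inversions u) * (if val (sa i) (u (C p0)) < 0 then zeta * v (u \<circ> C) else 0) +
      q * ((- q) ^ card (inversions u) * v (u \<circ> C)) = 0"
    proof (cases "winv u (sr i) \<in> P")
      case True
      then have "\<not> val (sa i) (u (C p0)) < 0" using C v by (force simp: dom_alcove_def)
      then show ?thesis using card_inversions_step(1)[OF i u True] by (simp add: algebra_simps)
    next
      case False
      then have "- winv u (sr i) \<in> P" using ur pos_or_neg by blast
      then have "val (sa i) (u (C p0)) < 0"
        using C v coroot_uminus[OF ur] by (force simp: dom_alcove_def)
      moreover have "card (inversions u) = Suc (card (inversions (s i \<circ> u)))"
        by (rule card_inversions_step(2)[OF i u False])
      ultimately show ?thesis by (simp add: algebra_simps zeta_def)
    qed
  qed
  finally show ?thesis .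
qed

text \<open>
  The largest subspace of the common kernel of all sign sums that is stable under the right
  operators. It plays the part of the kernel of the projection to the
  antispherical module.
\<close>

definition K :: "(('v \<Rightarrow> 'v) \<Rightarrow> laurent) set" where
  "K = {v. supp v \<and> (\<forall>bs C. set bs \<subseteq> S \<longrightarrow> dom_alcove C \<longrightarrow> sign_sum C (fold Rop bs v) = 0)}"

lemma fold_Rop_lin: "fold Rop bs (\<lambda>B. c * v B + d * w B) = (\<lambda>B. c * fold Rop bs v B + d * fold Rop bs w B)"
  by (induction bs arbitrary: v w) (simp_all add: Rop_lin)

lemma K_lin: "v \<in> K \<Longrightarrow> w \<in> K \<Longrightarrow> (\<lambda>B. c * v B + d * w B) \<in> K"
  by (simp add: K_def supp_lin fold_Rop_lin sign_sum_lin)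

lemma K_Rop: "b \<in> S \<Longrightarrow> v \<in> K \<Longrightarrow> Rop b v \<in> K"
  unfolding K_def
proof clarify
  assume b: "b \<in> S" and v: "supp v" "\<forall>bs C. set bs \<subseteq> S \<longrightarrow> dom_alcove C \<longrightarrow> sign_sum C (fold Rop bs v) = 0"
  have "sign_sum C (fold Rop bs (Rop b v)) = 0" if "set bs \<subseteq> S" "dom_alcove C" for bs C
    using v(2)[rule_format, of "b # bs" C] b that by simp
  then show "supp (Rop b v) \<and> (\<forall>bs C. set bs \<subseteq> S \<longrightarrow> dom_alcove C \<longrightarrow> sign_sum C (fold Rop bs (Rop b v)) = 0)"
    by (simp add: supp_ops)
qed

lemma K_supp: "v \<in> K \<Longrightarrow> supp v"
  by (simp add: K_def)

lemma K_Rinv: "b \<in> S \<Longrightarrow> v \<in> K \<Longrightarrow> Rinv b v \<in> K"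
  by (simp only: Rinv_Rop[OF S_AR K_supp]) (intro K_lin K_Rop)

lemma K_sign_sum: "v \<in> K \<Longrightarrow> dom_alcove C \<Longrightarrow> sign_sum C v = 0"
  unfolding K_def by (metis (mono_tags, lifting) empty_subsetI fold_Nil id_apply list.set(1) mem_Collect_eq)

text \<open>
  Left operators move past right operators, and the sign sums see only the left end.
\<close>

lemma K_Lop:
  assumes i: "i \<in> I" and v: "supp v"
  shows "(\<lambda>B. 1 * Lop (sa i) v B + q * v B) \<in> K"
proof -
  have comm: "set bs \<subseteq> S \<Longrightarrow> fold Rop bs (Lop (sa i) v) = Lop (sa i) (fold Rop bs v)" for bs v
    using simple_S[OF i] by (induction bs arbitrary: v) (simp_all add: Lop_Rop_commute[symmetric])
  show ?thesis
    unfolding K_def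
    using v by (auto simp only: fold_Rop_lin comm sign_sum_Lop[OF _ i] supp_lin supp_ops)
qed

end

section \<open>Specialisation of Laurent polynomials at \<open>t = 1\<close>\<close>

definition ev :: "laurent \<Rightarrow> int" where
  "ev p = (\<Sum>k\<in>Poly_Mapping.keys p. Poly_Mapping.lookup p k)"

lemma ev_superset:
  "finite A \<Longrightarrow> Poly_Mapping.keys p \<subseteq> A \<Longrightarrow> ev p = (\<Sum>k\<in>A. Poly_Mapping.lookup p k)"
  unfolding ev_def by (rule sum.mono_neutral_left) (auto simp: in_keys_iff)

lemma ev_add: "ev (p + r) = ev p + ev r"
proof -
  let ?A = "Poly_Mapping.keys p \<union> Poly_Mapping.keys r"
  have "ev (p + r) = (\<Sum>k\<in>?A. Poly_Mapping.lookup (p + r) k)"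
    using keys_add[of p r] by (intro ev_superset) auto
  also have "\<dots> = ev p + ev r"
    by (simp add: lookup_add sum.distrib ev_superset[of ?A])
  finally show ?thesis .
qed

lemma ev_uminus: "ev (- p) = - ev p"
  using ev_add[of p "- p"] by (simp add: ev_def)

lemma ev_diff: "ev (p - r) = ev p - ev r"
  using ev_add[of p "- r"] by (simp add: ev_uminus)

lemma ev_single: "ev (Poly_Mapping.single k c) = c"
  by (simp add: ev_def)

lemma ev_0 [simp]: "ev 0 = 0" and ev_1 [simp]: "ev 1 = 1"
  using ev_single[of 0 1] by (simp_all add: ev_def)

lemma ev_mult: "ev (p * r) = ev p * ev r"
proof -
  have 1: "ev (frag_of k * r) = ev r" for k :: int and r :: laurent
    using subset_UNIV[of "Poly_Mapping.keys r"]
  proof (induction r rule: frag_induction)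
    case (one x) then show ?case by (simp add: mult_single ev_single)
  next
    case (diff a b) then show ?case by (simp add: right_diff_distrib ev_diff)
  qed simp_all
  show ?thesis
    using subset_UNIV[of "Poly_Mapping.keys p"]
  proof (induction p rule: frag_induction)
    case (one x) then show ?case by (simp add: 1 ev_single)
  next
    case (diff a b) then show ?case by (simp add: left_diff_distrib ev_diff)
  qed simp_all
qed

lemma ev_q [simp]: "ev q = 1" "ev qi = 1" "ev zeta = 0"
  by (simp_all add: t_half_def t_half_inv_def zeta_def ev_diff ev_single)

lemma ev_sum: "ev (sum f A) = (\<Sum>a\<in>A. ev (f a))"
  by (induction A rule: infinite_finite_induct) (simp_all add: ev_add)

lemma ev_power: "ev (p ^ n) = ev p ^ n"
  by (induction n) (simp_all add: ev_mult)

section \<open>Periodic vectors and their straightening relations\<close>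

context root_datum
begin

lemma Neg_empty_sign:
  assumes "Neg z = {}" "generic z" "a \<in> AR"
  shows "val a z > 0 \<longleftrightarrow> val a p0 > 0" "val a z < 0 \<longleftrightarrow> val a p0 < 0"
proof -
  have nz: "val a z \<noteq> 0" "val a p0 \<noteq> 0" using assms generic_val val_p0 by auto
  have "\<not> (val a p0 > 0 \<and> val a z < 0)" "\<not> (val (aneg a) p0 > 0 \<and> val (aneg a) z < 0)"
    using assms(1,3) aneg_AR[OF assms(3)] unfolding Neg_def by blast+
  then show "val a z > 0 \<longleftrightarrow> val a p0 > 0" "val a z < 0 \<longleftrightarrow> val a p0 < 0"
    using nz unfolding val_aneg[OF assms(3)] by linarith+
qed

lemma generic_Wext_p0: "A \<in> Wext \<Longrightarrow> generic (A p0)"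
  by (rule generic_Wext[OF _ generic_p0])

lemma Neg_winv:
  assumes "A \<in> Wext" "Neg (winv A p0) = {}"
  shows "Neg (A p0) = {}"
proof (rule ccontr)
  assume "Neg (A p0) \<noteq> {}"
  then obtain a where a: "a \<in> AR" "val a p0 > 0" "val a (A p0) < 0" unfolding Neg_def by blast
  have c: "pull A a \<in> AR" "val (pull A a) (winv A p0) = val a p0" "val (pull A a) p0 = val a (A p0)"
    using pull[OF assms(1) a(1)] assms(1) by (simp_all add: Wext_inv_simps)
  then show False
    using Neg_empty_sign(1)[OF assms(2) generic_Wext_p0[OF inv_Wext[OF assms(1)]] c(1)] a by simp
qed

lemma winv_winv: "A \<in> Wext \<Longrightarrow> winv (winv A) = A"
  using Wext_inverse inv_inv_eq by blast

text \<open>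
  In \<open>transport x \<Lambda>\<close> the operator \<open>\<Lambda>\<close> changes the base alcove from the one of \<open>x\<close> to the fundamental
  one, crossing one wall at a time by the inverse of a left operator. It depends on the chosen
  gallery, so that a relation is used instead of a function.
\<close>

inductive transport :: "('v \<Rightarrow> 'v) \<Rightarrow> ((('v \<Rightarrow> 'v) \<Rightarrow> laurent) \<Rightarrow> ('v \<Rightarrow> 'v) \<Rightarrow> laurent) \<Rightarrow> bool" where
  transport_base: "x \<in> Wext \<Longrightarrow> Neg (winv x p0) = {} \<Longrightarrow>
    transport x (\<lambda>v B. if B \<in> Wext then v (winv x \<circ> B) else 0)"
| transport_step: "transport (x \<circ> arefl a) \<Lambda> \<Longrightarrow> x \<in> Wext \<Longrightarrow> a \<in> S \<Longrightarrow> val a (winv x p0) < 0 \<Longrightarrow>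
    transport x (\<lambda>v. \<Lambda> (Linv a v))"

lemma exists_transport: "x \<in> Wext \<Longrightarrow> \<exists>\<Lambda>. transport x \<Lambda>"
proof (induction "card (Neg (winv x p0))" arbitrary: x rule: less_induct)
  case less
  have g: "generic (winv x p0)" using less.prems by (intro generic_Wext_p0 inv_Wext)
  show ?case
  proof (cases "Neg (winv x p0) = {}")
    case True then show ?thesis using transport_base less.prems by blast
  next
    case False
    then obtain a where a: "a \<in> S" "val a (winv x p0) < 0" using Neg_nonempty[OF g] by blast
    have aR: "arefl a \<in> Wext" using a S_AR arefl_Wext by blast
    have "winv (x \<circ> arefl a) p0 = arefl a (winv x p0)"
      using less.prems aR a by (simp add: winv_comp winv_arefl S_AR)
    then have "card (Neg (winv (x \<circ> arefl a) p0)) < card (Neg (winv x p0))"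
      using card_Neg_step[OF a g] by simp
    then obtain \<Lambda> where "transport (x \<circ> arefl a) \<Lambda>"
      using less.hyps comp_Wext[OF less.prems aR] by blast
    then show ?thesis using transport_step less.prems a by blast
  qed
qed

lemma Linv_lin: "Linv a (\<lambda>B. c * v B + d * w B) = (\<lambda>B. c * Linv a v B + d * Linv a w B)"
  by (auto simp: Linv_def fun_eq_iff algebra_simps)

lemma Linv_Rop_commute:
  assumes "a \<in> S" "b \<in> S" "supp v"
  shows "Linv a (Rop b v) = Rop b (Linv a v)"
  using assms by (simp only: Linv_Lop[OF S_AR] supp_ops Rop_lin Lop_Rop_commute)

text \<open>
  Each property holds for one inverse left operator, and for the left translation at the end of the
  chain. That translation preserves all signs, because there \<open>x\<close> maps the fundamental alcove to itself.
\<close>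

lemma transport_props:
  assumes "transport x \<Lambda>"
  shows "x \<in> Wext"
    and "supp v \<Longrightarrow> supp (\<Lambda> v)"
    and "\<Lambda> (\<lambda>B. c * v B + d * w B) = (\<lambda>B. c * \<Lambda> v B + d * \<Lambda> w B)"
    and "b \<in> S \<Longrightarrow> supp v \<Longrightarrow> \<Lambda> (Rop b v) = Rop b (\<Lambda> v)"
    and "A \<in> Wext \<Longrightarrow> Neg (A p0) = {} \<Longrightarrow> \<Lambda> (delta (winv x \<circ> A)) = delta A"
    and "B \<in> Wext \<Longrightarrow> ev (\<Lambda> v B) = ev (v (winv x \<circ> B))"
  using assms
proof (induction arbitrary: v w)
  case (transport_base x)
  {
    case 1 then show ?case using transport_base by blast
  next
    case 2 then show ?case by (simp add: supp_def)
  next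
    case 3 then show ?case by (auto simp: fun_eq_iff)
  next
    case 4
    have "Rop b v (winv x \<circ> B) = Rop b (\<lambda>B. if B \<in> Wext then v (winv x \<circ> B) else 0) B" if B: "B \<in> Wext" for B
    proof -
      have bR: "b \<in> AR" using 4 S_AR by blast
      have W1: "winv x \<circ> B \<in> Wext" "B \<circ> arefl b \<in> Wext"
        using B transport_base bR by (simp_all add: comp_Wext inv_Wext arefl_Wext)
      have "winv (winv x \<circ> B) p0 = winv B (x p0)"
        using B transport_base by (simp add: winv_comp inv_Wext winv_winv)
      moreover have "val b (winv B (x p0)) < 0 \<longleftrightarrow> val b (winv B p0) < 0"
        using Neg_empty_sign(2)[OF Neg_winv[OF transport_base] generic_Wext_p0[OF transport_base(1)]]
          pull[OF inv_Wext[OF B] bR] by metis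
      ultimately show ?thesis using B W1 by (simp add: Rop_def comp_assoc)
    qed
    then show ?case by (auto simp: fun_eq_iff) (simp add: Rop_def)
  next
    case 5
    have *: "winv x \<circ> B = winv x \<circ> A \<longleftrightarrow> B = A" for B
      using transport_base(1) by (metis Wext_inv_simps(1) comp_apply ext)
    show ?case
    proof
      fix B
      show "(if B \<in> Wext then delta (winv x \<circ> A) (winv x \<circ> B) else 0) = delta A B"
        by (cases "B = A") (use 5 in \<open>simp_all add: delta_def *\<close>)
    qed
  next
    case 6 then show ?case by (simp add: comp_def)
  }
next
  case (transport_step x a \<Lambda>)
  have aR: "a \<in> AR" using transport_step S_AR by blast
  have wi: "winv (x \<circ> arefl a) = arefl a \<circ> winv x"
    using transport_step aR by (simp add: winv_comp arefl_Wext winv_arefl)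
  {
    case 1 then show ?case using transport_step by blast
  next
    case 2 then show ?case using transport_step by (simp add: supp_ops)
  next
    case 3 then show ?case using transport_step by (simp add: Linv_lin)
  next
    case 4 then show ?case using transport_step by (simp add: Linv_Rop_commute supp_ops)
  next
    case 5
    have W1: "winv x \<circ> A \<in> Wext" using 5 transport_step by (simp add: comp_Wext inv_Wext)
    have "val a (winv x (A p0)) < 0"
      using Neg_empty_sign(2)[OF 5(2) generic_Wext_p0[OF 5(1)]] transport_step
        pull[OF inv_Wext[of x] aR] by metis
    then have "Linv a (delta (winv x \<circ> A)) = delta (winv (x \<circ> arefl a) \<circ> A)"
      using Linv_delta[OF W1 aR] wi by (simp add: comp_assoc)
    then show ?case using transport_step 5 by (simp add: comp_def)
  next
    case 6
    have "winv (x \<circ> arefl a) \<circ> B \<in> Wext"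
      using 6 transport_step aR unfolding wi by (simp add: comp_Wext inv_Wext arefl_Wext)
    then have "ev (Linv a v (winv (x \<circ> arefl a) \<circ> B)) = ev (v (arefl a \<circ> (winv (x \<circ> arefl a) \<circ> B)))"
      by (simp add: Linv_def ev_diff ev_mult)
    also have "arefl a \<circ> (winv (x \<circ> arefl a) \<circ> B) = winv x \<circ> B"
      unfolding wi using arefl_invol[OF aR] by (simp add: fun_eq_iff)
    finally show ?case using transport_step 6 by (simp add: comp_def)
  }
qed

text \<open>
  The sum \<open>2\<rho>\<close> of the positive roots pairs integrally with all coroots, as every root does.
\<close>

definition far_translation :: "nat \<Rightarrow> 'v \<Rightarrow> 'v" where
  "far_translation m = (\<lambda>z. z + (2 * real m) *\<^sub>R rho D)"

lemma far_translation_Wext: "far_translation m \<in> Wext"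
proof (rule WextI[OF id_W])
  show "\<langle>(2 * real m) *\<^sub>R rho D, \<alpha>\<rangle> \<in> \<int>" if "\<alpha> \<in> R" for \<alpha>
    using that root_pairing_int[OF that] pos_root
    by (auto simp: rho_def pairing_simps intro!: Ints_mult Ints_sum)
qed (simp add: far_translation_def)

definition Lam :: "nat \<Rightarrow> (('v \<Rightarrow> 'v) \<Rightarrow> laurent) \<Rightarrow> ('v \<Rightarrow> 'v) \<Rightarrow> laurent" where
  "Lam m = (SOME \<Lambda>. transport (far_translation m) \<Lambda>)"

lemma Lam: "transport (far_translation m) (Lam m)"
  unfolding Lam_def by (rule someI_ex[OF exists_transport[OF far_translation_Wext]])

text \<open>
  The vector of the alcove \<open>A\<close> with respect to a base alcove far out in the dominant chamber. As \<open>m\<close>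
  grows, the relations between the vectors of finitely many alcoves become independent of \<open>m\<close>.
\<close>

definition periodic :: "nat \<Rightarrow> ('v \<Rightarrow> 'v) \<Rightarrow> ('v \<Rightarrow> 'v) \<Rightarrow> laurent" where
  "periodic m A = Lam m (delta (winv (far_translation m) \<circ> A))"

lemma periodic_supp: "A \<in> Wext \<Longrightarrow> supp (periodic m A)"
  unfolding periodic_def by (intro transport_props(2)[OF Lam] supp_delta comp_Wext inv_Wext far_translation_Wext)

lemma periodic_base: "A \<in> Wext \<Longrightarrow> Neg (A p0) = {} \<Longrightarrow> periodic m A = delta A"
  unfolding periodic_def by (rule transport_props(5)[OF Lam])

text \<open>
  At \<open>t = 1\<close> the operators become translations of functions, and the vector forgets its base alcove.
\<close>

lemma periodic_ev:
  assumes "A \<in> Wext" "B \<in> Wext"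
  shows "ev (periodic m A B) = (if B = A then 1 else 0)"
proof -
  have "winv (far_translation m) \<circ> B = winv (far_translation m) \<circ> A \<longleftrightarrow> B = A"
    using far_translation_Wext[of m] by (metis Wext_inv_simps(1) comp_apply ext)
  then show ?thesis unfolding periodic_def transport_props(6)[OF Lam assms(2)] by (simp add: delta_def)
qed

definition crossing_op :: "'v \<Rightarrow> 'v \<times> int \<Rightarrow> (('v \<Rightarrow> 'v) \<Rightarrow> laurent) \<Rightarrow> ('v \<Rightarrow> 'v) \<Rightarrow> laurent" where
  "crossing_op \<beta> b = (if \<beta> \<in> P then Rop b else Rinv b)"

lemma eventually_far:
  assumes "c \<in> AR" "fst c \<in> P"
  shows "\<forall>\<^sub>F m in sequentially. val c (far_translation m z) > 0"
proof -
  have c: "2 * \<langle>rho D, fst c\<rangle> > 0" using rho_pos assms by simp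
  have "filterlim (\<lambda>m. val c z + 2 * \<langle>rho D, fst c\<rangle> * real m) at_top sequentially"
    by (intro filterlim_tendsto_add_at_top[OF tendsto_const]
        filterlim_tendsto_pos_mult_at_top[OF tendsto_const c] filterlim_real_sequentially)
  then have "\<forall>\<^sub>F m in sequentially. val c z + 2 * \<langle>rho D, fst c\<rangle> * real m > 0"
    by (simp add: filterlim_at_top_dense)
  then show ?thesis using assms(1)
    by (elim eventually_mono) (simp add: val_def far_translation_def pairing_simps AR_iff algebra_simps)
qed

text \<open>
  To cross a wall of the alcove is to apply a right operator or its inverse to the vector, according to
  the side of the wall on which the far base alcove lies. The operator that has transported the
  vector commutes with right operators, and on delta functions the claim follows from the definitions.
\<close>

lemma cross:
  assumes A: "A \<in> Wext" and b: "b \<in> S"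
  shows "\<forall>\<^sub>F m in sequentially. periodic m (A \<circ> arefl b) = crossing_op (fst (pull (winv A) b)) b (periodic m A)"
proof -
  have bR: "b \<in> AR" using b S_AR by blast
  define c where "c = pull (winv A) b"
  have c: "c \<in> AR" "\<And>x. val c x = val b (winv A x)" using pull[OF inv_Wext[OF A] bR] by (auto simp: c_def)
  have Rd: "Rop b (periodic m A) = (\<lambda>B. 1 * periodic m (A \<circ> arefl b) B + (if val c (far_translation m p0) < 0 then zeta else 0) * periodic m A B)" for m
  proof -
    have D: "winv (far_translation m) \<circ> A \<in> Wext" using A far_translation_Wext by (simp add: comp_Wext inv_Wext)
    have w: "winv (winv (far_translation m) \<circ> A) p0 = winv A (far_translation m p0)"
      using A far_translation_Wext by (simp add: winv_comp inv_Wext winv_winv)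
    have "Rop b (periodic m A) = Lam m (Rop b (delta (winv (far_translation m) \<circ> A)))"
      unfolding periodic_def by (rule transport_props(4)[OF Lam b supp_delta[OF D], symmetric])
    also have "Rop b (delta (winv (far_translation m) \<circ> A)) = (\<lambda>B. 1 * delta (winv (far_translation m) \<circ> (A \<circ> arefl b)) B +
        (if val c (far_translation m p0) < 0 then zeta else 0) * delta (winv (far_translation m) \<circ> A) B)"
      unfolding Rop_delta[OF D bR] w c(2) by (auto simp: fun_eq_iff comp_assoc)
    finally show ?thesis unfolding transport_props(3)[OF Lam] periodic_def .
  qed
  consider "fst c \<in> P" | "- fst c \<in> P" using c(1) pos_or_neg AR_iff by blast
  then show ?thesis
  proof cases
    case 1
    have "\<forall>\<^sub>F m in sequentially. val c (far_translation m p0) > 0" by (rule eventually_far[OF c(1) 1])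
    then show ?thesis
    proof eventually_elim
      case (elim m)
      then show ?case using Rd[of m] 1 by (simp add: crossing_op_def c_def)
    qed
  next
    case 2
    have "\<forall>\<^sub>F m in sequentially. val (aneg c) (far_translation m p0) > 0"
      using 2 c(1) by (intro eventually_far aneg_AR) (auto simp: aneg_def)
    then show ?thesis
    proof eventually_elim
      case (elim m)
      then have "val c (far_translation m p0) < 0" using val_aneg[OF c(1)] by simp
      moreover have "fst c \<notin> P" using 2 pos_not_neg by force
      ultimately show ?case using Rd[of m] Rinv_Rop[OF bR periodic_supp[OF A, of m]]
        by (simp add: crossing_op_def fun_eq_iff flip: c_def)
    qed
  qed
qed

lemma fst_pull_comp:
  assumes "A \<in> Wext" "b \<in> AR" "w \<in> W" "\<And>\<alpha>. \<alpha> \<in> R \<Longrightarrow> \<langle>c, \<alpha>\<rangle> \<in> \<int>" "\<And>x. g x = w x + c"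
  shows "fst (pull (winv (g \<circ> A)) b) = w (fst (pull (winv A) b))"
proof -
  have g: "g \<in> Wext" using assms WextI by metis
  have ig: "winv g x = winv w x + - winv w c" for x
  proof -
    have "g (winv w x + - winv w c) = x"
      using assms(3,5) by (simp add: W_simps(1,2,4)[OF assms(3)] W_inv_simps)
    then show ?thesis using Wext_inv_simps(2)[OF g] by metis
  qed
  let ?d = "pull (winv A) b"
  have d: "?d \<in> AR" using assms by (simp add: pull inv_Wext)
  have "pull (winv (g \<circ> A)) b = pull (winv g) ?d"
    using assms g d by (intro pull_unique) (simp_all add: pull inv_Wext comp_Wext winv_comp)
  also have "fst \<dots> = winv (winv w) (fst ?d)"
    by (rule fst_pull[OF inv_Wext[OF g] d inv_W[OF assms(3)] ig])
  also have "winv (winv w) = w" using W_bij[OF assms(3)] by (rule inv_inv_eq)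
  finally show ?thesis .
qed

lemma arefl_simple:
  assumes i: "i \<in> I"
  shows "(sr i, k) \<in> AR" "arefl (sr i, k) \<in> Wext"
    "\<And>\<alpha>. \<alpha> \<in> R \<Longrightarrow> \<langle>- of_int k *\<^sub>R sr i, \<alpha>\<rangle> \<in> \<int>"
    "arefl (sr i, k) x = s i x + - of_int k *\<^sub>R sr i"
proof -
  show A: "(sr i, k) \<in> AR" using i by (simp add: AR_iff simple_root)
  then show "arefl (sr i, k) \<in> Wext" by (rule arefl_Wext)
  show "\<langle>- of_int k *\<^sub>R sr i, \<alpha>\<rangle> \<in> \<int>" if "\<alpha> \<in> R" for \<alpha>
    using that root_pairing_int[OF that simple_root[OF i]] by (simp add: pairing_simps)
  show "arefl (sr i, k) x = s i x + - of_int k *\<^sub>R sr i"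
    by (simp add: arefl_def s_def refl_def val_def algebra_simps)
qed

lemma pairing_arefl:
  assumes i: "i \<in> I"
  shows "\<langle>arefl (sr i, k) x, sr i\<rangle> = - \<langle>x, sr i\<rangle> - 2 * of_int k"
  using val_arefl_self[OF arefl_simple(1)[OF i], of k x] by (simp add: val_def)

lemma fst_pull_arefl:
  assumes "i \<in> I" "A \<in> Wext" "b \<in> AR"
  shows "fst (pull (winv (arefl (sr i, k) \<circ> A)) b) = s i (fst (pull (winv A) b))"
  by (rule fst_pull_comp[OF assms(2,3) s_W[OF assms(1)] arefl_simple(3)[OF assms(1), of _ k] arefl_simple(4)[OF assms(1)]])

text \<open>
  The alcove lies between the hyperplanes number \<open>k\<close> and \<open>k + 1\<close> of the direction \<open>\<alpha>\<^sub>i\<close>.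
\<close>

definition strip :: "nat \<Rightarrow> nat \<Rightarrow> ('v \<Rightarrow> 'v) \<Rightarrow> bool" where
  "strip i k A \<longleftrightarrow> A \<in> Wext \<and> real k < \<langle>A p0, sr i\<rangle> \<and> \<langle>A p0, sr i\<rangle> < real k + 1"

lemma cross_sign:
  assumes A: "A \<in> Wext" and b: "b \<in> S" and d: "d \<in> AR"
    and ne: "d \<noteq> pull (winv A) b" "d \<noteq> aneg (pull (winv A) b)"
  shows "val d (A (arefl b p0)) < 0 \<longleftrightarrow> val d (A p0) < 0"
proof -
  have bR: "b \<in> AR" using b S_AR by blast
  have "pull A d \<noteq> b" using ne(1) pull_winv(1)[OF A d] by auto
  moreover have "pull A d \<noteq> aneg b"
    using ne(2) pull_winv(1)[OF A d] pull_aneg[OF inv_Wext[OF A] bR] by auto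
  ultimately show ?thesis using S_sign[OF b pull(1)[OF A d]] pull(2)[OF A d] by simp
qed

text \<open>The wall of \<open>A\<close> behind which the fundamental alcove lies.\<close>

lemma separating_wall:
  assumes A: "A \<in> Wext" and ne: "Neg (A p0) \<noteq> {}"
  obtains b where "b \<in> S" "val b (winv A p0) < 0"
    "card (Neg (winv (A \<circ> arefl b) p0)) < card (Neg (winv A p0))"
proof -
  have g: "generic (winv A p0)" using A by (intro generic_Wext_p0 inv_Wext)
  have "Neg (winv A p0) \<noteq> {}" using ne Neg_winv[OF A] by blast
  then obtain b where b: "b \<in> S" "val b (winv A p0) < 0" using Neg_nonempty[OF g] by blast
  have "winv (A \<circ> arefl b) p0 = arefl b (winv A p0)"
    using A b by (simp add: winv_comp winv_arefl S_AR arefl_Wext)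
  then show thesis using that b card_Neg_step[OF b g] by simp
qed

lemma strip_step:
  assumes i: "i \<in> I" and A: "strip i k A" and b: "b \<in> S"
    and ne: "fst (pull (winv A) b) \<noteq> sr i" "fst (pull (winv A) b) \<noteq> - sr i"
  shows "strip i k (A \<circ> arefl b)"
proof -
  have AW: "A \<in> Wext" using A by (simp add: strip_def)
  have W1: "A \<circ> arefl b \<in> Wext" using AW b S_AR by (simp add: comp_Wext arefl_Wext)
  have *: "val (sr i, j) (A (arefl b p0)) < 0 \<longleftrightarrow> val (sr i, j) (A p0) < 0" for j
  proof (rule cross_sign[OF AW b arefl_simple(1)[OF i]])
    show "(sr i, j) \<noteq> pull (winv A) b" using ne(1) by (metis fst_conv)
    show "(sr i, j) \<noteq> aneg (pull (winv A) b)"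
      using ne(2) by (metis aneg_aneg aneg_def fst_conv)
  qed
  have nz: "val (sr i, j) (A (arefl b p0)) \<noteq> 0" for j
    using val_p0_Wext[OF W1 arefl_simple(1)[OF i]] by simp
  show ?thesis
    using A W1 *[of "- int k"] *[of "- int k - 1"] nz[of "- int k"]
    by (auto simp: strip_def val_def)
qed

text \<open>
  The reflection \<open>s\<^sub>i\<close> preserves the sign of every root except \<open>\<plusminus> \<alpha>\<^sub>i\<close>. Therefore an alcove and its images
  under reflections of the direction \<open>\<alpha>\<^sub>i\<close> cross a wall of another direction with the same operator.
\<close>

lemma periodic_cross_parallel:
  assumes i: "i \<in> I" and A: "A \<in> Wext" and b: "b \<in> S"
    and ne: "fst (pull (winv A) b) \<noteq> sr i" "fst (pull (winv A) b) \<noteq> - sr i"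
  shows "\<exists>X\<in>{Rop b, Rinv b}.
    (\<forall>\<^sub>F m in sequentially. periodic m A = X (periodic m (A \<circ> arefl b))) \<and>
    (\<forall>k. \<forall>\<^sub>F m in sequentially. periodic m (arefl (sr i, k) \<circ> A) = X (periodic m (arefl (sr i, k) \<circ> (A \<circ> arefl b)))) \<and>
    (\<forall>k l. \<forall>\<^sub>F m in sequentially. periodic m (arefl (sr i, k) \<circ> (arefl (sr i, l) \<circ> A)) =
      X (periodic m (arefl (sr i, k) \<circ> (arefl (sr i, l) \<circ> (A \<circ> arefl b)))))"
proof -
  have bR: "b \<in> AR" using b S_AR by blast
  define A' where "A' = A \<circ> arefl b"
  have AA: "A' \<in> Wext" "A' \<circ> arefl b = A"
    using A bR by (auto simp: A'_def comp_Wext arefl_Wext arefl_invol)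
  define c where "c = pull (winv A) b"
  have c: "c \<in> AR" using A bR by (simp add: c_def pull inv_Wext)
  have A'c: "A' = arefl c \<circ> A"
    using arefl_pull[OF A c] pull_winv(2)[OF A bR] pull_winv[OF A] A bR
    by (simp add: A'_def c_def)
  have "pull (winv A') b = aneg c"
  proof (rule pull_unique[OF inv_Wext[OF AA(1)] bR aneg_AR[OF c]])
    fix x
    have "winv A' x = arefl b (winv A x)"
      using A bR by (simp add: A'_def winv_comp winv_arefl arefl_Wext)
    then show "val (aneg c) x = val b (winv A' x)"
      using val_arefl_self[OF bR] val_aneg[OF c] pull(2)[OF inv_Wext[OF A] bR] by (simp add: c_def)
  qed
  then have f: "fst (pull (winv A') b) = - fst c" by (simp add: aneg_def)
  have nc: "- fst c \<in> R" "- fst c \<noteq> sr i" "- fst c \<noteq> - sr i"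
    using ne c uminus_root unfolding c_def AR_iff by (metis minus_minus)+
  have sP: "s i (- fst c) \<in> P \<longleftrightarrow> - fst c \<in> P" by (rule s_pos_iff[OF i nc])
  have s2: "s i (s i (- fst c)) = - fst c" by (rule s_invol[OF i])
  let ?X = "crossing_op (- fst c) b"
  have X: "crossing_op (s i (- fst c)) b = ?X" using sP by (simp add: crossing_op_def)
  have W1: "arefl (sr i, k) \<circ> A' \<in> Wext" for k using AA arefl_simple(2)[OF i] by (simp add: comp_Wext)
  have W2: "arefl (sr i, k) \<circ> (arefl (sr i, l) \<circ> A') \<in> Wext" for k l
    using W1 arefl_simple(2)[OF i] by (simp add: comp_Wext)
  have 1: "\<forall>\<^sub>F m in sequentially. periodic m A = ?X (periodic m A')"
    using cross[OF AA(1) b] unfolding AA(2) f .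
  have 2: "\<forall>\<^sub>F m in sequentially. periodic m (arefl (sr i, k) \<circ> A) = ?X (periodic m (arefl (sr i, k) \<circ> A'))" for k
    using cross[OF W1 b, of k] unfolding comp_assoc AA(2) fst_pull_arefl[OF i AA(1) bR] f X .
  have 3: "\<forall>\<^sub>F m in sequentially. periodic m (arefl (sr i, k) \<circ> (arefl (sr i, l) \<circ> A)) =
      ?X (periodic m (arefl (sr i, k) \<circ> (arefl (sr i, l) \<circ> A')))" for k l
    using cross[OF W2 b, of k l]
    unfolding fst_pull_arefl[OF i W1 bR] fst_pull_arefl[OF i AA(1) bR] f s2
    unfolding comp_assoc AA(2) .
  have "?X \<in> {Rop b, Rinv b}" by (simp add: crossing_op_def)
  then show ?thesis using 1 2 3 unfolding A'_def by blast
qed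

lemma K_X: "X \<in> {Rop b, Rinv b} \<Longrightarrow> b \<in> S \<Longrightarrow> v \<in> K \<Longrightarrow> X v \<in> K"
  using K_Rop[of b v] K_Rinv[of b v] by blast

lemma X_lin: "X \<in> {Rop b, Rinv b} \<Longrightarrow> X (\<lambda>B. c * v B + d * w B) = (\<lambda>B. c * X v B + d * X w B)"
  using Rop_lin[of b] Rinv_lin[of b] by blast

text \<open>
  The factor that the four-term relation below has at a wall of direction \<open>\<alpha>\<^sub>i\<close>. By the quadratic relation
  it has the two forms \<open>R\<^sup>-\<^sup>1 + q\<^sup>-\<^sup>1\<close> and \<open>R + q\<close>, one for the alcove and one for its image under \<open>s\<^sub>i\<close>.
\<close>

definition Gop :: "'v \<times> int \<Rightarrow> (('v \<Rightarrow> 'v) \<Rightarrow> laurent) \<Rightarrow> ('v \<Rightarrow> 'v) \<Rightarrow> laurent" where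
  "Gop b v = (\<lambda>B. 1 * Rinv b v B + qi * v B)"

lemma Gop_lin: "Gop b (\<lambda>B. c * v B + d * w B) = (\<lambda>B. c * Gop b v B + d * Gop b w B)"
  by (simp add: Gop_def Rinv_lin fun_eq_iff algebra_simps)

lemma Gop_Rop: "b \<in> AR \<Longrightarrow> supp v \<Longrightarrow> Gop b v = (\<lambda>B. 1 * Rop b v B + q * v B)"
  by (simp add: Gop_def Rinv_Rop zeta_def algebra_simps)

lemma K_Gop: "b \<in> S \<Longrightarrow> v \<in> K \<Longrightarrow> Gop b v \<in> K"
  unfolding Gop_def by (intro K_lin K_Rinv)

text \<open>
  The two-term straightening relation, modulo \<open>K\<close>, for the vectors of alcoves in the first strip. The
  factors \<open>1\<close> give the combination the form in which linear operators are applied to it.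
\<close>

definition rel0 :: "nat \<Rightarrow> ('v \<Rightarrow> 'v) \<Rightarrow> nat \<Rightarrow> bool" where
  "rel0 i A m \<longleftrightarrow> (\<lambda>B. 1 * periodic m (s i \<circ> A) B + q * periodic m A B) \<in> K"

text \<open>
  The four-term straightening relation, modulo \<open>K\<close>, for the vectors of alcoves in the higher strips.
\<close>

definition rel :: "nat \<Rightarrow> nat \<Rightarrow> ('v \<Rightarrow> 'v) \<Rightarrow> nat \<Rightarrow> bool" where
  "rel i k A m \<longleftrightarrow> (let r = arefl (sr i, - int k) in
    (\<lambda>B. 1 * (1 * periodic m (s i \<circ> A) B + q * periodic m A B) +
         1 * (1 * periodic m (r \<circ> A) B + q * periodic m (s i \<circ> (r \<circ> A)) B)) \<in> K)"

lemma s_arefl: "s i = arefl (sr i, 0)"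
  by (rule arefl_sa[symmetric])

lemma rel0_parallel:
  assumes "i \<in> I" "A \<in> Wext" "b \<in> S"
    "fst (pull (winv A) b) \<noteq> sr i" "fst (pull (winv A) b) \<noteq> - sr i"
    "\<forall>\<^sub>F m in sequentially. rel0 i (A \<circ> arefl b) m"
  shows "\<forall>\<^sub>F m in sequentially. rel0 i A m"
proof -
  obtain X where X: "X \<in> {Rop b, Rinv b}" "\<forall>\<^sub>F m in sequentially. periodic m A = X (periodic m (A \<circ> arefl b))"
    "\<And>k. \<forall>\<^sub>F m in sequentially. periodic m (arefl (sr i, k) \<circ> A) = X (periodic m (arefl (sr i, k) \<circ> (A \<circ> arefl b)))"
    using periodic_cross_parallel[OF assms(1-5)] by blast
  show ?thesis
    using X(2) X(3)[of 0] assms(6)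
  proof eventually_elim
    case (elim m)
    have "X (\<lambda>B. 1 * periodic m (s i \<circ> (A \<circ> arefl b)) B + q * periodic m (A \<circ> arefl b) B) \<in> K"
      by (rule K_X[OF X(1) assms(3)]) (use elim in \<open>simp add: rel0_def\<close>)
    then show ?case unfolding X_lin[OF X(1)] rel0_def using elim by (simp add: s_arefl)
  qed
qed

lemma rel_parallel:
  assumes "i \<in> I" "A \<in> Wext" "b \<in> S"
    "fst (pull (winv A) b) \<noteq> sr i" "fst (pull (winv A) b) \<noteq> - sr i"
    "\<forall>\<^sub>F m in sequentially. rel i k (A \<circ> arefl b) m"
  shows "\<forall>\<^sub>F m in sequentially. rel i k A m"
proof -
  obtain X where X: "X \<in> {Rop b, Rinv b}" "\<forall>\<^sub>F m in sequentially. periodic m A = X (periodic m (A \<circ> arefl b))"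
    "\<And>k. \<forall>\<^sub>F m in sequentially. periodic m (arefl (sr i, k) \<circ> A) = X (periodic m (arefl (sr i, k) \<circ> (A \<circ> arefl b)))"
    "\<And>k l. \<forall>\<^sub>F m in sequentially. periodic m (arefl (sr i, k) \<circ> (arefl (sr i, l) \<circ> A)) =
      X (periodic m (arefl (sr i, k) \<circ> (arefl (sr i, l) \<circ> (A \<circ> arefl b))))"
    using periodic_cross_parallel[OF assms(1-5)] by blast
  show ?thesis
    using X(2) X(3)[of 0] X(3)[of "- int k"] X(4)[of 0 "- int k"] assms(6)
  proof eventually_elim
    case (elim m)
    let ?A = "A \<circ> arefl b"
    let ?r = "arefl (sr i, - int k)"
    have "X (\<lambda>B. 1 * (1 * periodic m (s i \<circ> ?A) B + q * periodic m ?A B) +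
         1 * (1 * periodic m (?r \<circ> ?A) B + q * periodic m (s i \<circ> (?r \<circ> ?A)) B)) \<in> K"
      by (rule K_X[OF X(1) assms(3)]) (use elim in \<open>simp add: rel_def Let_def\<close>)
    then show ?case unfolding X_lin[OF X(1)] rel_def Let_def using elim by (simp add: s_arefl)
  qed
qed

text \<open>
  A wall is crossed alone. A reflection in another hyperplane of the same direction towards the
  fundamental alcove would cross the hyperplane number \<open>k\<close> as well.
\<close>

lemma parallel_wall:
  assumes i: "i \<in> I" and A: "strip i k A" and b: "b \<in> S" "val b (winv A p0) < 0"
    and p: "fst (pull (winv A) b) = sr i \<or> fst (pull (winv A) b) = - sr i"
  shows "k \<ge> 1 \<and> pull (winv A) b = (sr i, - int k)"
proof -
  have AW: "A \<in> Wext" using A by (simp add: strip_def)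
  have bR: "b \<in> AR" using b S_AR by blast
  define c where "c = pull (winv A) b"
  have c: "c \<in> AR" "\<And>x. val c x = val b (winv A x)" using pull[OF inv_Wext[OF AW] bR] by (auto simp: c_def)
  define X where "X = \<langle>A p0, sr i\<rangle>"
  have X: "real k < X" "X < real k + 1" using A by (auto simp: strip_def X_def)
  have pp: "0 < \<langle>p0, sr i\<rangle>" "\<langle>p0, sr i\<rangle> < 1"
    using p0(1)[OF simple_pos[OF i]] p0(2)[OF simple_root[OF i]] by auto
  have cs: "val c (A p0) > 0" "val c p0 < 0"
    using b S_pos AW unfolding c(2) by (auto simp: Wext_inv_simps)
  obtain \<gamma> n where cn: "c = (\<gamma>, n)" by fastforce
  have g: "\<gamma> = sr i"
  proof (rule ccontr)
    assume "\<gamma> \<noteq> sr i"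
    then have "\<gamma> = - sr i" using p cn by (simp add: c_def)
    then have "of_int n > X" "of_int n < \<langle>p0, sr i\<rangle>"
      using cs i cn by (simp_all add: val_def coroot_uminus simple_root X_def)
    then have "(of_int n :: real) > 0" "(of_int n :: real) < 1" using X pp by linarith+
    then show False by simp
  qed
  have n: "X + of_int n > 0" "\<langle>p0, sr i\<rangle> + of_int n < 0"
    using cs cn g by (simp_all add: val_def X_def)
  have "(of_int n :: real) < 0" "- (real k + 1) < (of_int n :: real)" using n X pp by linarith+
  then have n1: "n < 0" "- int k - 1 < n"
    using of_int_less_iff[where 'a=real, of "- int k - 1" n] by simp_all
  have "n = - int k"
  proof (rule ccontr)
    assume ne: "n \<noteq> - int k"
    then have "n \<ge> - int k + 1" using n1 by linarith
    then have nk: "(of_int n :: real) \<ge> - real k + 1"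
      using of_int_le_iff[where 'a=real, of "- int k + 1" n] by simp
    let ?d = "(sr i, - int k)"
    have "?d \<noteq> c" "?d \<noteq> aneg c"
      using ne cn g root_nonzero[OF simple_root[OF i]] pos_not_neg[OF simple_pos[OF i]] simple_pos[OF i]
      by (auto simp: aneg_def)
    then have sg: "val ?d (A (arefl b p0)) < 0 \<longleftrightarrow> val ?d (A p0) < 0"
      by (intro cross_sign[OF AW b(1) arefl_simple(1)[OF i]]) (simp_all add: c_def)
    have "arefl c \<circ> A = A \<circ> arefl b"
      using arefl_pull[OF AW c(1)] pull_winv(1)[OF inv_Wext[OF AW] bR] winv_winv[OF AW] by (simp add: c_def)
    then have "A (arefl b p0) = arefl c (A p0)" by (metis comp_apply)
    then have "val ?d (A (arefl b p0)) = - X - 2 * of_int n - real k"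
      using pairing_arefl[OF i, of n "A p0"] unfolding cn g by (simp add: val_def X_def)
    moreover have "val ?d (A p0) > 0" using X by (simp add: val_def X_def)
    ultimately show False using sg X nk by simp
  qed
  then show ?thesis using n1 cn g by (simp add: c_def)
qed

text \<open>
  Across the strip next to the finite wall, the relation is moved to the fundamental alcove by
  crossing walls of other directions; there it is the sign relation of the antispherical quotient.
\<close>

lemma rel0_strip:
  assumes i: "i \<in> I" and A: "strip i 0 A"
  shows "\<forall>\<^sub>F m in sequentially. rel0 i A m"
  using A
proof (induction "card (Neg (winv A p0))" arbitrary: A rule: less_induct)
  case less
  have AW: "A \<in> Wext" using less.prems by (simp add: strip_def)
  show ?case
  proof (cases "Neg (A p0) = {}")
    case True
    let ?a = "sa i"
    let ?b = "pull A ?a"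
    have aR: "?a \<in> AR" by (rule arefl_simple(1)[OF i])
    have b: "?b \<in> AR" "\<And>x. val ?b x = val ?a (A x)" using pull[OF AW aR] by auto
    have sg: "val d (A p0) > 0 \<longleftrightarrow> val d p0 > 0" "val d (A p0) < 0 \<longleftrightarrow> val d p0 < 0" if "d \<in> AR" for d
      using Neg_empty_sign[OF True generic_Wext_p0[OF AW] that] by auto
    have bS: "?b \<in> S"
      unfolding S_def mem_Collect_eq
    proof (intro conjI ballI impI)
      show "?b \<in> AR" by (rule b)
      show "val ?b p0 > 0" using b sg(1)[OF aR] S_pos[OF simple_S[OF i]] by simp
      fix d assume d: "d \<in> AR" "val d p0 > 0" "val d (arefl ?b p0) < 0"
      let ?d = "pull (winv A) d"
      have dd: "?d \<in> AR" "\<And>x. val ?d x = val d (winv A x)" using pull[OF inv_Wext[OF AW] d(1)] by auto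
      let ?d' = "pull (arefl ?a) ?d"
      have d': "?d' \<in> AR" "\<And>x. val ?d' x = val ?d (arefl ?a x)"
        using pull[OF arefl_Wext[OF aR] dd(1)] by auto
      have ra: "winv A (arefl ?a (A p0)) = arefl ?b p0"
        using fun_cong[OF arefl_pull[OF AW aR], of p0] AW by (simp add: Wext_inv_simps)
      have "val ?d (A p0) > 0" using d(2) AW by (simp add: dd(2) Wext_inv_simps)
      then have 1: "val ?d p0 > 0" using sg(1)[OF dd(1)] by blast
      have "val ?d' (A p0) < 0" unfolding d'(2) dd(2) ra by (rule d(3))
      then have "val ?d' p0 < 0" using sg(2)[OF d'(1)] by blast
      then have "val ?d (arefl ?a p0) < 0" unfolding d'(2) .
      then have "?d = ?a" using simple_S[OF i] dd(1) 1 unfolding S_def by blast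
      then show "d = ?b" using pull_winv(2)[OF AW d(1)] by simp
    qed
    have sA: "s i \<circ> A = A \<circ> arefl ?b" using arefl_pull[OF AW aR] by (simp add: arefl_sa)
    have pw: "pull (winv A) ?b = ?a" by (rule pull_winv(1)[OF AW aR])
    have nn: "\<not> val ?a (A p0) < 0" "\<not> val ?b (winv A p0) < 0"
      using sg(2)[OF aR] S_pos[OF simple_S[OF i]] b(2) AW by (auto simp: Wext_inv_simps)
    have "\<forall>\<^sub>F m in sequentially. periodic m (A \<circ> arefl ?b) = crossing_op (fst (pull (winv A) ?b)) ?b (periodic m A)"
      by (rule cross[OF AW bS])
    then show ?thesis
    proof eventually_elim
      case (elim m)
      have "periodic m (s i \<circ> A) = Rop ?b (delta A)"
        using elim i unfolding sA pw by (simp add: crossing_op_def simple_pos periodic_base[OF AW True])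
      also have "\<dots> = delta (s i \<circ> A)" using nn by (simp add: Rop_delta[OF AW b(1)] sA)
      also have "\<dots> = Lop ?a (delta A)" using nn by (simp add: Lop_delta[OF AW aR] arefl_sa)
      finally show ?case
        unfolding rel0_def periodic_base[OF AW True] by (simp only: K_Lop[OF i supp_delta[OF AW]])
    qed
  next
    case False
    obtain b where b: "b \<in> S" "val b (winv A p0) < 0"
      "card (Neg (winv (A \<circ> arefl b) p0)) < card (Neg (winv A p0))"
      using separating_wall[OF AW False] by blast
    have ne: "fst (pull (winv A) b) \<noteq> sr i" "fst (pull (winv A) b) \<noteq> - sr i"
      using parallel_wall[OF i less.prems b(1,2)] by auto
    show ?thesis
      by (rule rel0_parallel[OF i AW b(1) ne less.hyps[OF b(3) strip_step[OF i less.prems b(1) ne]]])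
  qed
qed

text \<open>
  In the strip number \<open>k \<ge> 1\<close> walls of other directions are crossed until the wall behind which the
  fundamental alcove lies is the one of direction \<open>\<alpha>\<^sub>i\<close>. There the relation has the form
  \<open>G (y + q x) \<in> K\<close>, with \<open>x\<close> and \<open>y\<close> the vectors of the alcove one strip below and of its image under
  \<open>s\<^sub>i\<close>, and with the linear operator \<open>G\<close> of that wall. For \<open>k = 1\<close> already \<open>y + q x\<close> lies in \<open>K\<close>. For larger
  \<open>k\<close> the relation one strip below replaces \<open>y + q x\<close> by \<open>- (u + q w)\<close>, where \<open>u\<close> and \<open>w\<close> are the vectors
  of an alcove two strips below and of its image under \<open>s\<^sub>i\<close>. For \<open>k \<ge> 3\<close> the statement
  \<open>G (u + q w) \<in> K\<close> is the relation two strips below. For \<open>k = 2\<close> that alcove lies in the first strip, the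
  wall is its finite wall, and \<open>w + q u \<in> K\<close> is the same as \<open>G u \<in> K\<close>; from these two facts
  \<open>G (u + q w) \<in> K\<close> follows.
\<close>

lemma rel_strip:
  assumes i: "i \<in> I" and k: "k \<ge> 1" and A: "strip i k A"
  shows "\<forall>\<^sub>F m in sequentially. rel i k A m"
  using k A
proof (induction k arbitrary: A rule: less_induct)
  case (less k)
  note outer = less.IH
  show ?case
    using less.prems
  proof (induction "card (Neg (winv A p0))" arbitrary: A rule: less_induct)
    case less
    have AW: "A \<in> Wext" using less.prems by (simp add: strip_def)
    have "(- sr i, int k) \<in> Neg (A p0)"
      using less.prems i p0(2)[OF simple_root[OF i]]
      by (simp add: Neg_def AR_iff uminus_root simple_root val_def coroot_uminus strip_def)
    then have "Neg (A p0) \<noteq> {}" by blast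
    then obtain b where b: "b \<in> S" "val b (winv A p0) < 0"
      "card (Neg (winv (A \<circ> arefl b) p0)) < card (Neg (winv A p0))"
      using separating_wall[OF AW] by blast
    have bR: "b \<in> AR" using b S_AR by blast
    show ?case
    proof (cases "fst (pull (winv A) b) = sr i \<or> fst (pull (winv A) b) = - sr i")
      case False
      then have ne: "fst (pull (winv A) b) \<noteq> sr i" "fst (pull (winv A) b) \<noteq> - sr i" by auto
      show ?thesis
        by (rule rel_parallel[OF i AW b(1) ne
              less.hyps[OF b(3) less.prems(1) strip_step[OF i less.prems(2) b(1) ne]]])
    next
      case True
      define r r' where "r = arefl (sr i, - int k)" and "r' = arefl (sr i, - int (k - 1))"
      have c: "pull (winv A) b = (sr i, - int k)" using parallel_wall[OF i less.prems(2) b(1,2) True] by blast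
      define C where "C = A \<circ> arefl b"
      have CA: "C \<circ> arefl b = A" using bR by (simp add: C_def fun_eq_iff arefl_invol)
      have CW: "C \<in> Wext" using AW bR by (simp add: C_def comp_Wext arefl_Wext)
      have rA: "r \<circ> A = C"
        using arefl_pull[OF AW arefl_simple(1)[OF i, of "- int k"]] pull_winv(2)[OF AW bR]
          pull_winv(1)[OF inv_Wext[OF AW] bR] winv_winv[OF AW] by (simp add: C_def r_def c)
      have pC: "pull (winv C) b = aneg (sr i, - int k)"
      proof (rule pull_unique[OF inv_Wext[OF CW] bR aneg_AR[OF arefl_simple(1)[OF i]]])
        fix x
        have "winv C x = arefl b (winv A x)"
          using AW bR by (simp add: C_def winv_comp winv_arefl arefl_Wext)
        then show "val (aneg (sr i, - int k)) x = val b (winv C x)"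
          using val_arefl_self[OF bR] val_aneg[OF arefl_simple(1)[OF i]] pull(2)[OF inv_Wext[OF AW] bR, unfolded c]
          by simp
      qed
      then have fC: "fst (pull (winv C) b) = - sr i" by (simp add: aneg_def)
      have nP: "- sr i \<notin> P" by (rule pos_not_neg[OF simple_pos[OF i]])
      have sP: "s i (- sr i) = sr i" using i by (simp add: linear_neg s_linear s_simple)
      have XC: "crossing_op (- sr i) b = Rinv b" "crossing_op (sr i) b = Rop b"
        using nP simple_pos[OF i] by (simp_all add: crossing_op_def)
      have C0: "\<langle>C p0, sr i\<rangle> = 2 * real k - \<langle>A p0, sr i\<rangle>"
      proof -
        have "C p0 = r (A p0)" using rA by (metis comp_apply)
        then show ?thesis using pairing_arefl[OF i, of "- int k" "A p0"] by (simp add: r_def)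
      qed
      have Cs: "strip i (k - 1) C"
        using less.prems CW C0 by (simp add: strip_def of_nat_diff)
      have siC: "s i \<circ> C \<in> Wext" using CW W_Wext[OF s_W[OF i]] by (simp add: comp_Wext)
      have 1: "\<forall>\<^sub>F m in sequentially. periodic m A = Rinv b (periodic m C)"
        using cross[OF CW b(1)] unfolding CA fC XC .
      have 2: "\<forall>\<^sub>F m in sequentially. periodic m (s i \<circ> A) = Rop b (periodic m (s i \<circ> C))"
        using cross[OF siC b(1)] unfolding comp_assoc CA
        using fst_pull_arefl[OF i CW bR, of 0] by (simp add: arefl_sa fC sP XC)
      define Z where "Z m = (\<lambda>B. 1 * periodic m (s i \<circ> C) B + q * periodic m C B)" for m
      have G: "\<forall>\<^sub>F m in sequentially. rel i k A m = (Gop b (Z m) \<in> K)"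
        using 1 2
      proof eventually_elim
        case (elim m)
        have "Gop b (Z m) = (\<lambda>B. 1 * (1 * periodic m (s i \<circ> A) B + q * periodic m A B) +
            1 * (1 * periodic m (r \<circ> A) B + q * periodic m (s i \<circ> (r \<circ> A)) B))"
          unfolding Z_def Gop_lin Gop_Rop[OF bR periodic_supp[OF siC]] unfolding Gop_def elim rA
          by (simp add: algebra_simps)
        then show ?case by (simp add: rel_def r_def Let_def)
      qed
      show ?thesis
      proof (cases "k = 1")
        case True
        then have "strip i 0 C" using Cs by simp
        from rel0_strip[OF i this] G show ?thesis
        proof eventually_elim
          case (elim m)
          then show ?case using K_Gop[OF b(1)] by (simp add: rel0_def Z_def)
        qed
      next
        case False
        then have k2: "k \<ge> 2" using less.prems(1) by simp
        \<comment> \<open>the alcove two strips below; its wall of type \<open>b\<close> again has direction \<open>\<alpha>\<^sub>i\<close>\<close>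
        define E where "E = r' \<circ> C"
        have EW: "E \<in> Wext" using CW arefl_simple(2)[OF i] by (simp add: E_def r'_def comp_Wext)
        have siE: "s i \<circ> E \<in> Wext" using EW W_Wext[OF s_W[OF i]] by (simp add: comp_Wext)
        have E0: "\<langle>E p0, sr i\<rangle> = 2 * real (k - 1) - \<langle>C p0, sr i\<rangle>"
          using pairing_arefl[OF i, of "- int (k - 1)" "C p0"] by (simp add: E_def r'_def)
        have Es: "strip i (k - 2) E"
          using less.prems EW C0 E0 k2 by (simp add: strip_def of_nat_diff)
        have fE: "fst (pull (winv E) b) = sr i"
          unfolding E_def r'_def fst_pull_arefl[OF i CW bR] fC by (rule sP)
        have pE: "pull (winv E) b = (sr i, - int (k - 2))"
        proof (rule pull_unique[OF inv_Wext[OF EW] bR arefl_simple(1)[OF i]])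
          fix x
          have "winv E x = winv C (r' x)"
            using CW arefl_simple(1,2)[OF i] by (simp add: E_def r'_def winv_comp winv_arefl)
          then have "val b (winv E x) = - val (sr i, - int k) (r' x)"
            using pull(2)[OF inv_Wext[OF CW] bR, unfolded pC] val_aneg[OF arefl_simple(1)[OF i]] by simp
          also have "\<dots> = val (sr i, - int (k - 2)) x"
            using i k2 coroot_self[OF simple_root[OF i]]
            by (simp add: r'_def arefl_def val_def pairing_simps simple_root algebra_simps of_nat_diff)
          finally show "val (sr i, - int (k - 2)) x = val b (winv E x)" by simp
        qed
        have rE: "E \<circ> arefl b = arefl (sr i, - int (k - 2)) \<circ> E"
          using arefl_pull[OF EW arefl_simple(1)[OF i, of "- int (k - 2)"]]
            pull_winv(1)[OF inv_Wext[OF EW] bR] winv_winv[OF EW] by (simp add: pE)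
        have 3: "\<forall>\<^sub>F m in sequentially. periodic m (E \<circ> arefl b) = Rop b (periodic m E)"
          using cross[OF EW b(1)] unfolding fE XC .
        have fsE: "fst (pull (winv (s i \<circ> E)) b) = - sr i"
          using fst_pull_arefl[OF i EW bR, of 0] i by (simp add: arefl_sa fE s_simple)
        have 4: "\<forall>\<^sub>F m in sequentially. periodic m (s i \<circ> (E \<circ> arefl b)) = Rinv b (periodic m (s i \<circ> E))"
          using cross[OF siE b(1)] unfolding comp_assoc fsE XC .
        define Y where "Y m = (\<lambda>B. 1 * periodic m E B + q * periodic m (s i \<circ> E) B)" for m
        have GY: "\<forall>\<^sub>F m in sequentially. Gop b (Y m) \<in> K"
        proof (cases "k = 2")
          case True
          then have E0: "strip i 0 E" using Es by simp
          have sE: "E \<circ> arefl b = s i \<circ> E" using rE True by (simp add: arefl_sa)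
          from rel0_strip[OF i E0] 3 show ?thesis
          proof eventually_elim
            case (elim m)
            \<comment> \<open>\<open>u + q w = q (w + q u) + (1 - q\<^sup>2) u\<close>\<close>
            have Gu: "Gop b (periodic m E) \<in> K"
              unfolding Gop_Rop[OF bR periodic_supp[OF EW]] elim(2)[symmetric] sE
              using elim(1) by (simp add: rel0_def)
            have "Gop b (\<lambda>B. 1 * periodic m (s i \<circ> E) B + q * periodic m E B) \<in> K"
              by (rule K_Gop[OF b(1)]) (use elim(1) in \<open>simp add: rel0_def\<close>)
            then have "(\<lambda>B. q * Gop b (\<lambda>B. 1 * periodic m (s i \<circ> E) B + q * periodic m E B) B +
                (1 - q * q) * Gop b (periodic m E) B) \<in> K"
              using Gu by (rule K_lin)
            then show ?case unfolding Y_def Gop_lin by (simp add: algebra_simps)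
          qed
        next
          case False
          then have "k - 2 < k" "1 \<le> k - 2" using k2 by auto
          from outer[OF this Es] 3 4 show ?thesis
          proof eventually_elim
            case (elim m)
            have "Gop b (Y m) = (\<lambda>B. 1 * (1 * periodic m (s i \<circ> E) B + q * periodic m E B) +
              1 * (1 * periodic m (E \<circ> arefl b) B + q * periodic m (s i \<circ> (E \<circ> arefl b)) B))"
              unfolding Y_def Gop_lin Gop_Rop[OF bR periodic_supp[OF EW]] unfolding Gop_def elim(2,3)
              by (simp add: algebra_simps)
            then show ?case using elim(1) by (simp add: rel_def Let_def rE)
          qed
        qed
        have "k - 1 < k" "1 \<le> k - 1" using k2 by auto
        from outer[OF this Cs] GY G show ?thesis
        proof eventually_elim
          case (elim m)
          have "(\<lambda>B. 1 * Z m B + 1 * Y m B) \<in> K"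
            using elim(1) by (simp add: rel_def Let_def Z_def Y_def E_def r'_def)
          then have "Gop b (\<lambda>B. 1 * Z m B + 1 * Y m B) \<in> K" by (rule K_Gop[OF b(1)])
          then have "(\<lambda>B. 1 * Gop b (\<lambda>B. 1 * Z m B + 1 * Y m B) B + (- 1) * Gop b (Y m) B) \<in> K"
            using elim(2) by (rule K_lin)
          then show ?case unfolding Gop_lin elim(3) by simp
        qed
      qed
    qed
  qed
qed

end

section \<open>Functionals on points that satisfy the straightening relations\<close>

context root_datum
begin

definition closed_alcove :: "'v set" where
  "closed_alcove = {\<nu>. \<forall>c\<in>AR. val c p0 > 0 \<longrightarrow> val c \<nu> \<ge> 0}"

text \<open>
  The alcoves whose closure contains \<open>z\<close>, with \<open>z\<close> in the position of the point \<open>\<nu>\<close> of the closed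
  fundamental alcove.
\<close>

definition alcoves_at :: "'v \<Rightarrow> 'v \<Rightarrow> ('v \<Rightarrow> 'v) set" where
  "alcoves_at \<nu> z = {A \<in> Wext. A \<nu> = z}"

lemma finite_alcoves_at: "finite (alcoves_at \<nu> z)"
proof (rule finite_subset)
  show "alcoves_at \<nu> z \<subseteq> (\<lambda>w x. w x + (z - w \<nu>)) ` W"
  proof
    fix A assume "A \<in> alcoves_at \<nu> z"
    then have A: "A \<in> Wext" "A \<nu> = z" by (auto simp: alcoves_at_def)
    then obtain w b where w: "w \<in> W" "\<And>x. A x = w x + b" by (metis WextE)
    then have "A = (\<lambda>x. w x + (z - w \<nu>))" using A(2) by (auto simp: fun_eq_iff)
    then show "A \<in> (\<lambda>w x. w x + (z - w \<nu>)) ` W" using w(1) by blast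
  qed
qed (simp add: finite_W)

lemma alcove_sign:
  assumes "\<nu> \<in> closed_alcove" "A \<in> alcoves_at \<nu> z" "a \<in> AR"
  shows "val a (A p0) > 0 \<Longrightarrow> val a z \<ge> 0" "val a (A p0) < 0 \<Longrightarrow> val a z \<le> 0"
proof -
  have A: "A \<in> Wext" "A \<nu> = z" using assms by (auto simp: alcoves_at_def)
  have 1: "val a z \<ge> 0" if "val a (A p0) > 0" "a \<in> AR" for a
  proof -
    have p: "pull A a \<in> AR" "\<And>x. val (pull A a) x = val a (A x)" using pull[OF A(1) that(2)] by auto
    have "val (pull A a) p0 > 0" using p(2)[of p0] that(1) by simp
    then have "val (pull A a) \<nu> \<ge> 0" using assms(1) p(1) unfolding closed_alcove_def by blast
    then show ?thesis using p(2)[of \<nu>] A(2) by simp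
  qed
  show "val a (A p0) > 0 \<Longrightarrow> val a z \<ge> 0" using 1 assms(3) by blast
  show "val a (A p0) < 0 \<Longrightarrow> val a z \<le> 0"
    using 1[of "aneg a"] val_aneg[OF assms(3)] aneg_AR[OF assms(3)] by simp
qed

lemma alcoves_at_reflect:
  assumes "a \<in> AR"
  shows "bij_betw (\<lambda>A. arefl a \<circ> A) (alcoves_at \<nu> z) (alcoves_at \<nu> (arefl a z))"
  using assms
  by (intro bij_betw_byWitness[where f'="\<lambda>A. arefl a \<circ> A"])
    (auto simp: alcoves_at_def comp_Wext arefl_Wext arefl_invol fun_eq_iff)

text \<open>
  The same number as \<open>level\<close> below with the hyperplane of direction \<open>\<alpha>\<^sub>i\<close> left out, which makes it
  invariant under reflections of that direction.
\<close>

definition above :: "nat \<Rightarrow> ('v \<Rightarrow> 'v) \<Rightarrow> 'v \<Rightarrow> nat" where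
  "above i A z = card {\<alpha> \<in> P - {sr i}. \<langle>z, \<alpha>\<rangle> \<in> \<int> \<and> \<langle>A p0 - z, \<alpha>\<rangle> > 0}"

text \<open>
  The number of hyperplanes through \<open>z\<close> above which the alcove lies. These exponents make the relations of
  \<open>F\<close> valid also on hyperplanes.
\<close>

definition level :: "('v \<Rightarrow> 'v) \<Rightarrow> 'v \<Rightarrow> nat" where
  "level A z = card {\<alpha> \<in> P. \<langle>z, \<alpha>\<rangle> \<in> \<int> \<and> \<langle>A p0 - z, \<alpha>\<rangle> > 0}"

lemma level_above:
  assumes "i \<in> I"
  shows "level A z = above i A z + (if \<langle>z, sr i\<rangle> \<in> \<int> \<and> \<langle>A p0, sr i\<rangle> > \<langle>z, sr i\<rangle> then 1 else 0)"
proof -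
  let ?S = "{\<alpha> \<in> P - {sr i}. \<langle>z, \<alpha>\<rangle> \<in> \<int> \<and> \<langle>A p0 - z, \<alpha>\<rangle> > 0}"
  have "{\<alpha> \<in> P. \<langle>z, \<alpha>\<rangle> \<in> \<int> \<and> \<langle>A p0 - z, \<alpha>\<rangle> > 0} =
    (if \<langle>z, sr i\<rangle> \<in> \<int> \<and> \<langle>A p0, sr i\<rangle> > \<langle>z, sr i\<rangle> then insert (sr i) ?S else ?S)"
    using assms by (auto simp: simple_pos pairing_simps simple_root)
  then show ?thesis using finite_pos by (auto simp: level_def above_def)
qed

lemma above_reflect:
  assumes i: "i \<in> I"
  shows "above i (arefl (sr i, k) \<circ> A) (arefl (sr i, k) z) = above i A z"
proof -
  let ?r = "arefl (sr i, k)"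
  have r: "?r x = s i x + - of_int k *\<^sub>R sr i" for x by (rule arefl_simple(4)[OF i])
  have "s i ` {\<alpha> \<in> P - {sr i}. \<langle>?r z, \<alpha>\<rangle> \<in> \<int> \<and> \<langle>?r (A p0) - ?r z, \<alpha>\<rangle> > 0} =
    {\<alpha> \<in> P - {sr i}. \<langle>z, \<alpha>\<rangle> \<in> \<int> \<and> \<langle>A p0 - z, \<alpha>\<rangle> > 0}" (is "s i ` ?S = ?T")
  proof -
    have iff: "\<alpha> \<in> ?S \<longleftrightarrow> s i \<alpha> \<in> ?T" for \<alpha>
    proof (cases "\<alpha> \<in> P - {sr i}")
      case True
      then have a: "\<alpha> \<in> R" "s i \<alpha> \<in> P - {sr i}" using pos_root s_pos[OF i] s_not_simple[OF i] by auto
      obtain n :: int where n: "\<langle>sr i, \<alpha>\<rangle> = of_int n"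
        using root_pairing_int[OF a(1) simple_root[OF i]] by (elim Ints_cases)
      have sp: "\<langle>s i x, \<alpha>\<rangle> = \<langle>x, s i \<alpha>\<rangle>" for x using i a by (simp add: s_def coroot_refl simple_root)
      have "\<langle>?r z, \<alpha>\<rangle> = \<langle>z, s i \<alpha>\<rangle> - of_int (k * n)" using a n sp by (simp add: r pairing_simps)
      then have "\<langle>?r z, \<alpha>\<rangle> \<in> \<int> \<longleftrightarrow> \<langle>z, s i \<alpha>\<rangle> \<in> \<int>"
        by (metis Ints_diff Ints_of_int Ints_add diff_add_cancel)
      moreover have "\<langle>?r (A p0) - ?r z, \<alpha>\<rangle> = \<langle>A p0 - z, s i \<alpha>\<rangle>"
        using a sp pos_root[of "s i \<alpha>"] by (simp add: r pairing_simps)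
      ultimately show ?thesis using True a by simp
    next
      case False
      have "s i \<alpha> \<notin> P - {sr i}"
      proof
        assume "s i \<alpha> \<in> P - {sr i}"
        then have "s i (s i \<alpha>) \<in> P - {sr i}" using s_pos[OF i] s_not_simple[OF i] by blast
        then show False using False s_invol[OF i] by simp
      qed
      then show ?thesis using False by blast
    qed
    show ?thesis
    proof (rule equalityI)
      show "s i ` ?S \<subseteq> ?T" by (rule image_subsetI) (rule iffD1[OF iff])
      show "?T \<subseteq> s i ` ?S"
      proof
        fix \<beta> assume b: "\<beta> \<in> ?T"
        have "s i \<beta> \<in> ?S" by (rule iffD2[OF iff]) (simp only: s_invol[OF i] b)
        then show "\<beta> \<in> s i ` ?S" by (rule image_eqI[rotated]) (simp only: s_invol[OF i])
      qed
    qed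
  qed
  moreover have "inj_on (s i) X" for X by (rule inj_on_inverseI[where g="s i"]) (rule s_invol[OF i])
  ultimately show ?thesis unfolding above_def comp_apply by (metis (no_types, lifting) card_image)
qed

text \<open>
  The coordinate at \<open>C\<close> of the weighted sum of the vectors of all alcoves around \<open>z\<close> in the antispherical
  module.
\<close>

definition F :: "nat \<Rightarrow> ('v \<Rightarrow> 'v) \<Rightarrow> 'v \<Rightarrow> 'v \<Rightarrow> laurent" where
  "F m C \<nu> z = (\<Sum>A\<in>alcoves_at \<nu> z. q ^ level A z * sign_sum C (periodic m A))"

lemma rel0_sign_sum:
  assumes "rel0 i A m" "dom_alcove C"
  shows "sign_sum C (periodic m (s i \<circ> A)) + q * sign_sum C (periodic m A) = 0"
  using K_sign_sum[OF assms(1)[unfolded rel0_def] assms(2)] unfolding sign_sum_lin by simp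

lemma rel_sign_sum:
  assumes "rel i k A m" "dom_alcove C"
  shows "sign_sum C (periodic m (s i \<circ> A)) + q * sign_sum C (periodic m A) + (sign_sum C (periodic m (arefl (sr i, - int k) \<circ> A)) +
    q * sign_sum C (periodic m (s i \<circ> (arefl (sr i, - int k) \<circ> A)))) = 0"
  using K_sign_sum[OF assms(1)[unfolded rel_def Let_def] assms(2)] unfolding sign_sum_lin by simp

lemma eventually_rel0:
  assumes "i \<in> I" "finite T" "\<And>A. A \<in> T \<Longrightarrow> strip i 0 A"
  shows "\<forall>\<^sub>F m in sequentially. \<forall>A\<in>T. rel0 i A m"
  using rel0_strip[OF assms(1)] assms(2,3) by (intro eventually_ball_finite) auto

lemma eventually_rel:
  assumes "i \<in> I" "k \<ge> 1" "finite T" "\<And>A. A \<in> T \<Longrightarrow> strip i k A"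
  shows "\<forall>\<^sub>F m in sequentially. \<forall>A\<in>T. rel i k A m"
  using rel_strip[OF assms(1,2)] assms(3,4) by (intro eventually_ball_finite) auto

lemma strip_alcove:
  assumes i: "i \<in> I" and nu: "\<nu> \<in> closed_alcove" and A: "A \<in> alcoves_at \<nu> z"
    and z: "real k \<le> \<langle>z, sr i\<rangle>" "\<langle>z, sr i\<rangle> < real k + 1"
    and up: "\<langle>z, sr i\<rangle> = real k \<Longrightarrow> \<langle>A p0, sr i\<rangle> > real k"
  shows "strip i k A"
proof -
  have AW: "A \<in> Wext" using A by (simp add: alcoves_at_def)
  note sg = alcove_sign[OF nu A arefl_simple(1)[OF i]]
  note nz = val_p0_Wext[OF AW arefl_simple(1)[OF i]]
  have 1: "real k < \<langle>A p0, sr i\<rangle>"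
  proof (rule ccontr)
    assume a: "\<not> ?thesis"
    then have "val (sr i, - int k) (A p0) < 0" using nz[of "- int k"] by (simp add: val_def)
    then have "val (sr i, - int k) z \<le> 0" by (rule sg(2))
    then have "\<langle>z, sr i\<rangle> = real k" using z by (simp add: val_def)
    then show False using up a by simp
  qed
  have 2: "\<langle>A p0, sr i\<rangle> < real k + 1"
  proof (rule ccontr)
    assume "\<not> ?thesis"
    then have "val (sr i, - int k - 1) (A p0) > 0" using nz[of "- int k - 1"] by (simp add: val_def)
    then have "val (sr i, - int k - 1) z \<ge> 0" by (rule sg(1))
    then show False using z by (simp add: val_def)
  qed
  show ?thesis using 1 2 AW by (simp add: strip_def)
qed

text \<open>
  Away from the hyperplanes of direction \<open>\<alpha>\<^sub>i\<close>, a reflection of that direction preserves all levels.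
\<close>

lemma F_reflect:
  assumes i: "i \<in> I" and z: "\<langle>z, sr i\<rangle> \<notin> \<int>"
  shows "F m C \<nu> (arefl (sr i, k) z) = (\<Sum>A\<in>alcoves_at \<nu> z. q ^ level A z * sign_sum C (periodic m (arefl (sr i, k) \<circ> A)))"
proof -
  let ?r = "arefl (sr i, k)"
  have rz: "\<langle>?r z, sr i\<rangle> \<notin> \<int>"
  proof
    assume "\<langle>?r z, sr i\<rangle> \<in> \<int>"
    then have "- \<langle>?r z, sr i\<rangle> - 2 * of_int k \<in> \<int>" by simp
    then show False using z pairing_arefl[OF i, of k z] by simp
  qed
  have "F m C \<nu> (?r z) = (\<Sum>A\<in>alcoves_at \<nu> z. q ^ level (?r \<circ> A) (?r z) * sign_sum C (periodic m (?r \<circ> A)))"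
    unfolding F_def by (rule sum.reindex_bij_betw[OF alcoves_at_reflect[OF arefl_simple(1)[OF i]], symmetric])
  also have "\<dots> = (\<Sum>A\<in>alcoves_at \<nu> z. q ^ level A z * sign_sum C (periodic m (?r \<circ> A)))"
    using z rz by (simp add: level_above[OF i] above_reflect[OF i])
  finally show ?thesis .
qed

lemma F_relation_first_strip:
  assumes i: "i \<in> I" and nu: "\<nu> \<in> closed_alcove" and C: "dom_alcove C"
    and z: "0 < \<langle>z, sr i\<rangle>" "\<langle>z, sr i\<rangle> < 1"
  shows "\<forall>\<^sub>F m in sequentially. F m C \<nu> (s i z) + q * F m C \<nu> z = 0"
proof -
  have nz: "\<langle>z, sr i\<rangle> \<notin> \<int>" using z by (auto elim!: Ints_cases)
  have "\<forall>\<^sub>F m in sequentially. \<forall>A\<in>alcoves_at \<nu> z. rel0 i A m"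
    using z by (intro eventually_rel0[OF i finite_alcoves_at] strip_alcove[OF i nu]) auto
  then show ?thesis
  proof eventually_elim
    case (elim m)
    have "F m C \<nu> (s i z) + q * F m C \<nu> z =
      (\<Sum>A\<in>alcoves_at \<nu> z. q ^ level A z * (sign_sum C (periodic m (s i \<circ> A)) + q * sign_sum C (periodic m A)))"
      using F_reflect[OF i nz, of m C \<nu> 0]
      by (simp add: arefl_sa F_def[of m C \<nu> z] sum_distrib_left algebra_simps sum.distrib)
    also have "\<dots> = 0" using rel0_sign_sum[OF _ C] elim by simp
    finally show ?case .
  qed
qed

lemma F_relation_strip:
  assumes i: "i \<in> I" and nu: "\<nu> \<in> closed_alcove" and C: "dom_alcove C" and k: "k \<ge> 1"
    and z: "real k < \<langle>z, sr i\<rangle>" "\<langle>z, sr i\<rangle> < real k + 1"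
  shows "\<forall>\<^sub>F m in sequentially. F m C \<nu> (s i z) + q * F m C \<nu> z +
    (F m C \<nu> (arefl (sr i, - int k) z) + q * F m C \<nu> (s i (arefl (sr i, - int k) z))) = 0"
proof -
  let ?r = "arefl (sr i, - int k)"
  have nz: "\<langle>z, sr i\<rangle> \<notin> \<int>"
  proof
    assume "\<langle>z, sr i\<rangle> \<in> \<int>"
    then obtain n :: int where "\<langle>z, sr i\<rangle> = of_int n" by (elim Ints_cases)
    then have "int k < n" "n < int k + 1"
      using z of_int_less_iff[where 'a=real, of "int k" n] of_int_less_iff[where 'a=real, of n "int k + 1"] by simp_all
    then show False by simp
  qed
  have nz': "\<langle>?r z, sr i\<rangle> \<notin> \<int>"
  proof
    assume "\<langle>?r z, sr i\<rangle> \<in> \<int>"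
    then have "- \<langle>?r z, sr i\<rangle> - 2 * of_int (- int k) \<in> \<int>" by simp
    then show False using nz pairing_arefl[OF i, of "- int k" z] by simp
  qed
  have 2: "F m C \<nu> (s i (?r z)) = (\<Sum>A\<in>alcoves_at \<nu> z. q ^ level A z * sign_sum C (periodic m (s i \<circ> (?r \<circ> A))))" for m
  proof -
    have "F m C \<nu> (s i (?r z)) =
      (\<Sum>A\<in>alcoves_at \<nu> (?r z). q ^ level A (?r z) * sign_sum C (periodic m (s i \<circ> A)))"
      using F_reflect[OF i nz', of m C \<nu> 0] by (simp add: arefl_sa)
    also have "\<dots> = (\<Sum>A\<in>alcoves_at \<nu> z. q ^ level (?r \<circ> A) (?r z) * sign_sum C (periodic m (s i \<circ> (?r \<circ> A))))"
      by (rule sum.reindex_bij_betw[OF alcoves_at_reflect[OF arefl_simple(1)[OF i]], symmetric])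
    finally show ?thesis using nz nz' by (simp add: level_above[OF i] above_reflect[OF i])
  qed
  have "\<forall>\<^sub>F m in sequentially. \<forall>A\<in>alcoves_at \<nu> z. rel i k A m"
    using z by (intro eventually_rel[OF i k finite_alcoves_at] strip_alcove[OF i nu]) auto
  then show ?thesis
  proof eventually_elim
    case (elim m)
    have "F m C \<nu> (s i z) + q * F m C \<nu> z + (F m C \<nu> (?r z) + q * F m C \<nu> (s i (?r z))) =
      (\<Sum>A\<in>alcoves_at \<nu> z. q ^ level A z * (sign_sum C (periodic m (s i \<circ> A)) + q * sign_sum C (periodic m A) +
        (sign_sum C (periodic m (?r \<circ> A)) + q * sign_sum C (periodic m (s i \<circ> (?r \<circ> A))))))"
      using F_reflect[OF i nz, of m C \<nu> 0] F_reflect[OF i nz, of m C \<nu> "- int k"] 2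
      by (simp add: arefl_sa F_def[of m C \<nu> z] sum_distrib_left algebra_simps sum.distrib)
    also have "\<dots> = 0" using rel_sign_sum[OF _ C] elim by simp
    finally show ?case .
  qed
qed

text \<open>At a point on a wall, the alcoves on the two sides of the wall are paired by the reflection.\<close>

lemma sum_alcoves_wall:
  assumes i: "i \<in> I" and z: "\<langle>z, sr i\<rangle> = real k"
  shows "(\<Sum>A\<in>alcoves_at \<nu> z. g A) =
    (\<Sum>A\<in>{A \<in> alcoves_at \<nu> z. \<langle>A p0, sr i\<rangle> > real k}. g A + g (arefl (sr i, - int k) \<circ> A))"
proof -
  let ?r = "arefl (sr i, - int k)"
  let ?T = "alcoves_at \<nu> z"
  let ?U = "{A \<in> ?T. \<langle>A p0, sr i\<rangle> > real k}"
  let ?V = "{A \<in> ?T. \<langle>A p0, sr i\<rangle> < real k}"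
  have rz: "?r z = z" using z by (simp add: arefl_def val_def)
  have rT: "A \<in> ?T \<Longrightarrow> ?r \<circ> A \<in> ?T" for A
    using bij_betwE[OF alcoves_at_reflect[OF arefl_simple(1)[OF i, of "- int k"], of \<nu> z]] rz by simp
  have rr: "?r \<circ> (?r \<circ> A) = A" for A
    using arefl_invol[OF arefl_simple(1)[OF i]] by (simp add: fun_eq_iff)
  have sgn: "\<langle>(?r \<circ> A) p0, sr i\<rangle> = 2 * real k - \<langle>A p0, sr i\<rangle>" for A
    using pairing_arefl[OF i, of "- int k" "A p0"] by simp
  have bij: "bij_betw (\<lambda>A. ?r \<circ> A) ?U ?V"
    by (rule bij_betw_byWitness[where f'="\<lambda>A. ?r \<circ> A"]) (use rT rr sgn in \<open>auto simp del: comp_apply\<close>)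
  have "\<langle>A p0, sr i\<rangle> \<noteq> real k" if "A \<in> ?T" for A
    using val_p0_Wext[OF _ arefl_simple(1)[OF i, of "- int k"], of A] that
    by (auto simp: alcoves_at_def val_def)
  then have T: "?T = ?U \<union> ?V" by (auto simp: neq_iff)
  have "(\<Sum>A\<in>?T. g A) = (\<Sum>A\<in>?U. g A) + (\<Sum>A\<in>?V. g A)"
    by (subst T, rule sum.union_disjoint) (auto simp: finite_alcoves_at)
  also have "(\<Sum>A\<in>?V. g A) = (\<Sum>A\<in>?U. g (?r \<circ> A))"
    by (rule sum.reindex_bij_betw[OF bij, symmetric])
  finally show ?thesis by (simp add: sum.distrib)
qed

text \<open>
  The alcoves at \<open>z\<close> come in pairs whose levels differ by one, and so do those at \<open>s\<^sub>i z\<close>, in the opposite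
  order. The four-term relation of each pair is thereby the contribution of the pair to a two-term
  relation without any factor \<open>q\<close>.
\<close>

lemma F_relation_wall:
  assumes i: "i \<in> I" and nu: "\<nu> \<in> closed_alcove" and C: "dom_alcove C" and k: "k \<ge> 1"
    and z: "\<langle>z, sr i\<rangle> = real k"
  shows "\<forall>\<^sub>F m in sequentially. F m C \<nu> (s i z) + F m C \<nu> z = 0"
proof -
  let ?r = "arefl (sr i, - int k)"
  let ?U = "{A \<in> alcoves_at \<nu> z. \<langle>A p0, sr i\<rangle> > real k}"
  have rz: "?r z = z" using z by (simp add: arefl_def val_def)
  have zZ: "\<langle>z, sr i\<rangle> \<in> \<int>" using z by simp
  have sz: "\<langle>s i z, sr i\<rangle> = - real k" "\<langle>s i x, sr i\<rangle> = - \<langle>x, sr i\<rangle>" for x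
    using pairing_arefl[OF i, of 0] z by (simp_all add: arefl_sa)
  have above: "above i (?r \<circ> A) z = above i A z" "above i (s i \<circ> A) (s i z) = above i A z" for A
    using above_reflect[OF i, of "- int k" A z] above_reflect[OF i, of 0 A z] rz by (simp_all add: arefl_sa)
  have sgn: "\<langle>?r (A p0), sr i\<rangle> = 2 * real k - \<langle>A p0, sr i\<rangle>" for A
    using pairing_arefl[OF i, of "- int k" "A p0"] by simp
  have lev: "level A z = Suc (above i A z)" "level (?r \<circ> A) z = above i A z"
    "level (s i \<circ> A) (s i z) = above i A z" "level (s i \<circ> (?r \<circ> A)) (s i z) = Suc (above i A z)"
    if "A \<in> ?U" for A
    using that z zZ sz sgn above by (simp_all add: level_above[OF i])
  have "\<forall>\<^sub>F m in sequentially. \<forall>A\<in>?U. rel i k A m"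
    using z finite_alcoves_at by (intro eventually_rel[OF i k] strip_alcove[OF i nu]) auto
  then show ?thesis
  proof eventually_elim
    case (elim m)
    have "F m C \<nu> (s i z) = (\<Sum>A\<in>alcoves_at \<nu> z. q ^ level (s i \<circ> A) (s i z) * sign_sum C (periodic m (s i \<circ> A)))"
      unfolding F_def
      using sum.reindex_bij_betw[OF alcoves_at_reflect[OF arefl_simple(1)[OF i, of 0], of \<nu> z],
          of "\<lambda>A. q ^ level A (s i z) * sign_sum C (periodic m A)"] by (simp add: arefl_sa)
    also have "\<dots> = (\<Sum>A\<in>?U. q ^ above i A z * sign_sum C (periodic m (s i \<circ> A)) +
        q ^ Suc (above i A z) * sign_sum C (periodic m (s i \<circ> (?r \<circ> A))))"
      unfolding sum_alcoves_wall[OF i z] by (rule sum.cong[OF HOL.refl]) (simp only: lev)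
    finally have a: "F m C \<nu> (s i z) = \<dots>" .
    have b: "F m C \<nu> z = (\<Sum>A\<in>?U. q ^ Suc (above i A z) * sign_sum C (periodic m A) +
        q ^ above i A z * sign_sum C (periodic m (?r \<circ> A)))"
      unfolding F_def sum_alcoves_wall[OF i z] by (rule sum.cong[OF HOL.refl]) (simp only: lev)
    have "F m C \<nu> (s i z) + F m C \<nu> z = (\<Sum>A\<in>?U. q ^ above i A z *
      (sign_sum C (periodic m (s i \<circ> A)) + q * sign_sum C (periodic m A) + (sign_sum C (periodic m (?r \<circ> A)) + q * sign_sum C (periodic m (s i \<circ> (?r \<circ> A))))))"
      unfolding a b sum.distrib[symmetric]
      by (rule sum.cong[OF HOL.refl]) (simp add: algebra_simps)
    also have "\<dots> = 0" using rel_sign_sum[OF _ C] elim by simp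
    finally show ?case .
  qed
qed

text \<open>
  Here \<open>z\<close> is fixed by \<open>s\<^sub>i\<close>, and the two alcoves of each pair cancel by the two-term relation. This
  matches the vanishing of the kets on the walls of the dominant chamber.
\<close>

lemma F_relation_zero:
  assumes i: "i \<in> I" and nu: "\<nu> \<in> closed_alcove" and C: "dom_alcove C" and z: "\<langle>z, sr i\<rangle> = 0"
  shows "\<forall>\<^sub>F m in sequentially. F m C \<nu> z = 0"
proof -
  let ?U = "{A \<in> alcoves_at \<nu> z. \<langle>A p0, sr i\<rangle> > real 0}"
  have sz: "s i z = z" using z by (simp add: s_def refl_def)
  have sx: "\<langle>s i x, sr i\<rangle> = - \<langle>x, sr i\<rangle>" for x
    using pairing_arefl[OF i, of 0] by (simp add: arefl_sa)
  have above: "above i (s i \<circ> A) z = above i A z" for A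
    using above_reflect[OF i, of 0 A z] sz by (simp add: arefl_sa)
  have lev: "level A z = Suc (above i A z)" "level (s i \<circ> A) z = above i A z" if "A \<in> ?U" for A
    using that z sx above by (simp_all add: level_above[OF i])
  have "\<forall>\<^sub>F m in sequentially. \<forall>A\<in>?U. rel0 i A m"
    using z finite_alcoves_at by (intro eventually_rel0[OF i] strip_alcove[OF i nu]) auto
  then show ?thesis
  proof eventually_elim
    case (elim m)
    have z0: "\<langle>z, sr i\<rangle> = real 0" using z by simp
    have "F m C \<nu> z = (\<Sum>A\<in>?U. q ^ above i A z * (sign_sum C (periodic m (s i \<circ> A)) + q * sign_sum C (periodic m A)))"
      unfolding F_def[of m C \<nu> z] sum_alcoves_wall[OF i z0]
    proof (rule sum.cong[OF HOL.refl])
      fix A assume A: "A \<in> ?U"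
      show "q ^ level A z * sign_sum C (periodic m A) +
          q ^ level (arefl (sr i, - int 0) \<circ> A) z * sign_sum C (periodic m (arefl (sr i, - int 0) \<circ> A)) =
        q ^ above i A z * (sign_sum C (periodic m (s i \<circ> A)) + q * sign_sum C (periodic m A))"
        using lev[OF A] by (simp add: arefl_sa algebra_simps)
    qed
    also have "\<dots> = 0" using rel0_sign_sum[OF _ C] elim by simp
    finally show ?case .
  qed
qed

section \<open>Separating dominant points\<close>

lemma regular_stabiliser:
  assumes "u \<in> W" "\<And>\<beta>. \<beta> \<in> P \<Longrightarrow> \<langle>x, \<beta>\<rangle> > 0" "\<And>\<beta>. \<beta> \<in> P \<Longrightarrow> \<langle>u x, \<beta>\<rangle> > 0"
  shows "u = id"
proof (rule no_inversions_idI[OF assms(1)])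
  fix \<beta> assume b: "\<beta> \<in> P"
  show "u \<beta> \<in> P"
  proof (rule ccontr)
    assume "u \<beta> \<notin> P"
    then have "- u \<beta> \<in> P" using pos_or_neg W_root[OF assms(1) pos_root[OF b]] by blast
    then have "\<langle>u x, - u \<beta>\<rangle> > 0" by (rule assms(3))
    then show False
      using assms(2)[OF b] W_pairing[OF assms(1) pos_root[OF b]] coroot_uminus[OF W_root[OF assms(1) pos_root[OF b]]]
      by simp
  qed
qed

text \<open>
  At \<open>t = 1\<close> only the elements \<open>u C\<close> contribute to the sums, and only \<open>u = 1\<close> maps the regular
  dominant point \<open>C \<nu>\<close> to a dominant one.
\<close>

lemma F_ev:
  assumes C: "dom_alcove C" and nu: "\<And>\<beta>. \<beta> \<in> P \<Longrightarrow> \<langle>C \<nu>, \<beta>\<rangle> > 0" and z: "\<And>\<beta>. \<beta> \<in> P \<Longrightarrow> \<langle>z, \<beta>\<rangle> > 0"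
  shows "ev (F m C \<nu> z) = (if z = C \<nu> then 1 else 0)"
proof -
  have CW: "C \<in> Wext" using C by (simp add: dom_alcove_def)
  have uC: "u \<circ> C \<in> Wext" if "u \<in> W" for u using that CW W_Wext by (simp add: comp_Wext)
  have "ev (F m C \<nu> z) = (\<Sum>A\<in>alcoves_at \<nu> z. \<Sum>u\<in>W. (- 1) ^ card (inversions u) * (if u \<circ> C = A then 1 else 0))"
    unfolding F_def sign_sum_def ev_sum ev_mult ev_power ev_q
    using uC by (intro sum.cong) (auto simp: ev_uminus alcoves_at_def periodic_ev ev_sum ev_mult ev_power)
  also have "\<dots> = (\<Sum>u\<in>W. \<Sum>A\<in>alcoves_at \<nu> z. if A = u \<circ> C then (- 1) ^ card (inversions u) else 0)"
    by (subst sum.swap) (intro sum.cong, auto)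
  also have "\<dots> = (\<Sum>u\<in>W. if u (C \<nu>) = z then (- 1) ^ card (inversions u) else 0)"
    using finite_alcoves_at uC by (intro sum.cong) (auto simp: alcoves_at_def)
  also have "\<dots> = (\<Sum>u\<in>W. if u = id then (if z = C \<nu> then 1 else 0) else 0)"
  proof (intro sum.cong HOL.refl)
    fix u assume u: "u \<in> W"
    show "(if u (C \<nu>) = z then (- 1) ^ card (inversions u) else 0) =
      (if u = id then (if z = C \<nu> then 1 else 0) else (0::int))"
    proof (cases "u (C \<nu>) = z")
      case True
      then have "u = id" using regular_stabiliser[OF u nu] z by simp
      then show ?thesis using True by (auto simp: inversions_def)
    qed auto
  qed
  also have "\<dots> = (if z = C \<nu> then 1 else 0)" using finite_W id_W by simp
  finally show ?thesis .
qed

lemma move_to_alcove: "generic g \<Longrightarrow> \<exists>A\<in>Wext. Neg (A g) = {}"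
proof (induction "card (Neg g)" arbitrary: g rule: less_induct)
  case less
  show ?case
  proof (cases "Neg g = {}")
    case True then show ?thesis using id_Wext by (intro bexI[of _ id]) auto
  next
    case False
    then obtain b where b: "b \<in> S" "val b g < 0" using Neg_nonempty less.prems by blast
    have rW: "arefl b \<in> Wext" using b S_AR arefl_Wext by blast
    obtain A where A: "A \<in> Wext" "Neg (A (arefl b g)) = {}"
      using less.hyps[OF card_Neg_step[OF b less.prems] generic_Wext[OF rW less.prems]] by blast
    then show ?thesis using comp_Wext[OF A(1) rW] by (intro bexI[of _ "A \<circ> arefl b"]) auto
  qed
qed

text \<open>Every point is the image of a point of the closed fundamental alcove: move a generic
  point close to it into the open alcove.\<close>

lemma exists_alcove:
  obtains C \<nu> where "C \<in> Wext" "\<nu> \<in> closed_alcove" "C \<nu> = z"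
proof -
  let ?D = "{(\<gamma>, \<delta>). \<gamma> \<in> R \<and> \<delta> \<in> R \<and> \<gamma> \<noteq> \<delta>}"
  have fin: "finite ?D" by (rule finite_subset[of _ "R \<times> R"]) (auto simp: finite_roots)
  have 1: "\<forall>\<^sub>F \<epsilon> in at_right 0. \<forall>x\<in>?D. \<langle>z + \<epsilon> *\<^sub>R p0, fst x\<rangle> - \<langle>z + \<epsilon> *\<^sub>R p0, snd x\<rangle> \<notin> \<int>"
  proof (rule eventually_ball_finite[OF fin], clarify)
    fix \<gamma> \<delta> assume g: "\<gamma> \<in> R" "\<delta> \<in> R" "\<gamma> \<noteq> \<delta>"
    have "\<forall>\<^sub>F \<epsilon> in at_right 0. (\<langle>z, \<gamma>\<rangle> - \<langle>z, \<delta>\<rangle>) + \<epsilon> * (\<langle>p0, \<gamma>\<rangle> - \<langle>p0, \<delta>\<rangle>) \<notin> \<int>"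
      using p0(3)[OF g] by (intro eventually_not_int) simp
    then show "\<forall>\<^sub>F \<epsilon> in at_right 0. \<langle>z + \<epsilon> *\<^sub>R p0, fst (\<gamma>, \<delta>)\<rangle> - \<langle>z + \<epsilon> *\<^sub>R p0, snd (\<gamma>, \<delta>)\<rangle> \<notin> \<int>"
      using g by (simp add: pairing_simps algebra_simps)
  qed
  have 2: "\<forall>\<^sub>F \<epsilon> in at_right 0. \<forall>\<gamma>\<in>R. \<langle>z, \<gamma>\<rangle> + of_int (\<lceil>- \<langle>z, \<gamma>\<rangle>\<rceil> - 1) + \<epsilon> * \<langle>p0, \<gamma>\<rangle> < 0"
  proof (rule eventually_ball_finite[OF finite_roots], rule ballI)
    fix \<gamma>
    let ?c = "\<langle>z, \<gamma>\<rangle> + of_int (\<lceil>- \<langle>z, \<gamma>\<rangle>\<rceil> - 1)"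
    have "?c < 0" by (simp, linarith)
    moreover have "((\<lambda>\<epsilon>. ?c + \<epsilon> * \<langle>p0, \<gamma>\<rangle>) \<longlongrightarrow> ?c + 0 * \<langle>p0, \<gamma>\<rangle>) (at_right 0)"
      by (intro tendsto_intros)
    ultimately show "\<forall>\<^sub>F \<epsilon> in at_right 0. ?c + \<epsilon> * \<langle>p0, \<gamma>\<rangle> < 0"
      by (intro order_tendstoD(2)) auto
  qed
  obtain \<epsilon> where e: "\<forall>x\<in>?D. \<langle>z + \<epsilon> *\<^sub>R p0, fst x\<rangle> - \<langle>z + \<epsilon> *\<^sub>R p0, snd x\<rangle> \<notin> \<int>"
    "\<forall>\<gamma>\<in>R. \<langle>z, \<gamma>\<rangle> + of_int (\<lceil>- \<langle>z, \<gamma>\<rangle>\<rceil> - 1) + \<epsilon> * \<langle>p0, \<gamma>\<rangle> < 0"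
    using eventually_happens[OF eventually_conj[OF 1 2]] by auto
  define g where "g = z + \<epsilon> *\<^sub>R p0"
  have gen: "generic g" using e(1) unfolding generic_def g_def by force
  have near: "val a g < 0" if a: "a \<in> AR" "val a z < 0" for a
  proof -
    have aR: "fst a \<in> R" using a by (simp add: AR_iff)
    have "snd a \<le> \<lceil>- \<langle>z, fst a\<rangle>\<rceil> - 1" using a(2) by (simp add: val_def) linarith
    then have "(of_int (snd a) :: real) \<le> of_int (\<lceil>- \<langle>z, fst a\<rangle>\<rceil> - 1)" by (simp only: of_int_le_iff)
    then show ?thesis using e(2)[rule_format, OF aR] aR by (simp add: val_def g_def pairing_simps)
  qed
  obtain A where A: "A \<in> Wext" "Neg (A g) = {}" using move_to_alcove[OF gen] by blast
  have "A z \<in> closed_alcove"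
    unfolding closed_alcove_def
  proof (intro CollectI ballI impI)
    fix c assume c: "c \<in> AR" "val c p0 > 0"
    show "val c (A z) \<ge> 0"
    proof (rule ccontr)
      assume "\<not> ?thesis"
      then have "val c (A g) < 0" using near[OF pull(1)[OF A(1) c(1)]] pull(2)[OF A(1) c(1)] by simp
      then show False using A(2) c unfolding Neg_def by blast
    qed
  qed
  then show thesis using that[of "winv A" "A z"] A(1) by (simp add: inv_Wext Wext_inv_simps)
qed

lemma exists_dom_alcove:
  assumes z: "\<And>\<beta>. \<beta> \<in> P \<Longrightarrow> \<langle>z, \<beta>\<rangle> > 0"
  obtains C \<nu> where "dom_alcove C" "\<nu> \<in> closed_alcove" "C \<nu> = z"
proof -
  obtain C \<nu> where C: "C \<in> Wext" "\<nu> \<in> closed_alcove" "C \<nu> = z" using exists_alcove by blast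
  have "\<langle>C p0, \<beta>\<rangle> > 0" if b: "\<beta> \<in> P" for \<beta>
  proof (rule ccontr)
    assume a: "\<not> ?thesis"
    have bA: "(\<beta>, 0) \<in> AR" using b by (simp add: AR_iff pos_root)
    have "val (\<beta>, 0) (C p0) < 0" using a val_p0_Wext[OF C(1) bA] by (simp add: val_def)
    then have "val (\<beta>, 0) z \<le> 0" using C by (intro alcove_sign(2)[OF C(2) _ bA]) (auto simp: alcoves_at_def)
    then show False using z[OF b] by (simp add: val_def)
  qed
  then show thesis using that[of C \<nu>] C unfolding dom_alcove_def by blast
qed

end

section \<open>Free modules over Laurent polynomials and their quotients\<close>

abbreviation sm :: "laurent \<Rightarrow> ('i \<Rightarrow>\<^sub>0 laurent) \<Rightarrow> 'i \<Rightarrow>\<^sub>0 laurent" where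
  "sm a \<equiv> Poly_Mapping.map ((*) a)"

lemma lookup_sm: "Poly_Mapping.lookup (sm a f) k = a * Poly_Mapping.lookup f k"
  by (simp add: Poly_Mapping.map.rep_eq when_def)

lemma keys_sm: "Poly_Mapping.keys (sm a f) \<subseteq> Poly_Mapping.keys f"
  by (auto simp: in_keys_iff lookup_sm)

lemma sm_simps:
  "sm (a + b) f = sm a f + sm b f" "sm a (f + g) = sm a f + sm a g" "sm (a * b) f = sm a (sm b f)"
  "sm 1 f = f" "sm a (f - g) = sm a f - sm a g" "sm a (- f) = - sm a f" "sm 0 f = 0" "sm (- a) f = - sm a f"
  "sm a 0 = 0"
  by (rule poly_mapping_eqI, simp add: lookup_sm lookup_add lookup_minus algebra_simps)+

lemma lookup_symbol: "Poly_Mapping.lookup (symbol \<mu>) k = (if k = \<mu> then 1 else 0)"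
  by (simp add: symbol_def lookup_single when_def)

lemma keys_symbol: "Poly_Mapping.keys (symbol \<mu>) = {\<mu>}"
  by (auto simp: in_keys_iff lookup_symbol split: if_splits)

lemma poly_mapping_expand:
  assumes "finite A" "Poly_Mapping.keys f \<subseteq> A"
  shows "f = (\<Sum>\<mu>\<in>A. sm (Poly_Mapping.lookup f \<mu>) (symbol \<mu>))"
proof (rule poly_mapping_eqI)
  fix k
  have "(\<Sum>\<mu>\<in>A. Poly_Mapping.lookup (sm (Poly_Mapping.lookup f \<mu>) (symbol \<mu>)) k) =
      (\<Sum>\<mu>\<in>A. if k = \<mu> then Poly_Mapping.lookup f \<mu> else 0)"
    by (intro sum.cong) (auto simp: lookup_sm lookup_symbol)
  also have "\<dots> = Poly_Mapping.lookup f k"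
    using assms by (auto simp: sum.delta in_keys_iff subset_iff)
  finally show "Poly_Mapping.lookup f k =
      Poly_Mapping.lookup (\<Sum>\<mu>\<in>A. sm (Poly_Mapping.lookup f \<mu>) (symbol \<mu>)) k"
    by (simp add: lookup_sum)
qed

lemma cring_laurent: "cring laurent_ring"
  by (intro cringI abelian_groupI comm_monoidI)
    (auto simp: laurent_ring_def algebra_simps intro: exI[of _ "- _"] add.left_inverse)

lemma module_free: "Module.module laurent_ring (free_module X)"
proof (rule moduleI[OF cring_laurent])
  show "abelian_group (free_module X)"
  proof (rule abelian_groupI)
    fix f assume "f \<in> carrier (free_module X)"
    then show "\<exists>g\<in>carrier (free_module X). g \<oplus>\<^bsub>free_module X\<^esub> f = \<zero>\<^bsub>free_module X\<^esub>"
      by (intro bexI[of _ "- f"]) (auto simp: free_module_def)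
  qed (use keys_add in \<open>fastforce simp: free_module_def algebra_simps\<close>)+
qed (use keys_sm in \<open>fastforce simp: free_module_def laurent_ring_def sm_simps\<close>)+

locale free_submodule =
  fixes X :: "'i set" and N :: "('i \<Rightarrow>\<^sub>0 laurent) set"
  assumes sub: "submodule N laurent_ring (free_module X)"
begin

abbreviation Q where "Q \<equiv> quotient_module (free_module X) N"

definition cls :: "('i \<Rightarrow>\<^sub>0 laurent) \<Rightarrow> ('i \<Rightarrow>\<^sub>0 laurent) set" where
  "cls f = N +>\<^bsub>free_module X\<^esub> f"

abbreviation FX where "FX \<equiv> {f :: 'i \<Rightarrow>\<^sub>0 laurent. Poly_Mapping.keys f \<subseteq> X}"

lemma FX_add: "f \<in> FX \<Longrightarrow> g \<in> FX \<Longrightarrow> f + g \<in> FX"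
  using keys_add[of f g] by auto

lemma FX_sm: "f \<in> FX \<Longrightarrow> sm a f \<in> FX"
  using keys_sm[of a f] by auto

lemma FX_sum: "(\<And>a. a \<in> A \<Longrightarrow> f a \<in> FX) \<Longrightarrow> sum f A \<in> FX"
  by (induction A rule: infinite_finite_induct) (use FX_add in auto)

lemma N_props:
  shows N_zero: "0 \<in> N" and N_add: "f \<in> N \<Longrightarrow> g \<in> N \<Longrightarrow> f + g \<in> N"
    and N_sm: "f \<in> N \<Longrightarrow> sm a f \<in> N"
proof -
  interpret submodule N laurent_ring "free_module X" by (rule sub)
  show "0 \<in> N" using one_closed by (simp add: free_module_def)
  show "f \<in> N \<Longrightarrow> g \<in> N \<Longrightarrow> f + g \<in> N" using m_closed[of f g] by (simp add: free_module_def)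
  show "f \<in> N \<Longrightarrow> sm a f \<in> N" using smult_closed[of a f] by (simp add: free_module_def laurent_ring_def)
qed

lemma N_uminus: "f \<in> N \<Longrightarrow> - f \<in> N"
  using N_sm[of f "- 1"] by (simp add: sm_simps)

lemma N_diff: "f \<in> N \<Longrightarrow> g \<in> N \<Longrightarrow> f - g \<in> N"
  using N_add[of f "- g"] N_uminus by simp

lemma N_sum: "(\<And>a. a \<in> A \<Longrightarrow> f a \<in> N) \<Longrightarrow> sum f A \<in> N"
  by (induction A rule: infinite_finite_induct) (auto simp: N_zero N_add)

lemma cls_alt: "cls f = (\<lambda>n. n + f) ` N"
  by (auto simp: cls_def a_r_coset_def' free_module_def)

lemma cls_eq_iff: "cls f = cls g \<longleftrightarrow> f - g \<in> N"
proof
  assume "cls f = cls g"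
  then have "f \<in> (\<lambda>n. n + g) ` N" using N_zero by (force simp: cls_alt)
  then show "f - g \<in> N" by auto
next
  assume fg: "f - g \<in> N"
  have "n + f \<in> (\<lambda>n. n + g) ` N" if "n \<in> N" for n
    using N_add[OF that fg] by (intro image_eqI[of _ _ "n + (f - g)"]) auto
  moreover have "n + g \<in> (\<lambda>n. n + f) ` N" if "n \<in> N" for n
    using N_diff[OF that fg] by (intro image_eqI[of _ _ "n - (f - g)"]) auto
  ultimately show "cls f = cls g" by (auto simp: cls_alt)
qed

lemma carrier_Q: "carrier Q = cls ` FX"
  by (auto simp: quotient_module_def A_RCOSETS_def' cls_def free_module_def)

lemma cls_Q: "f \<in> FX \<Longrightarrow> cls f \<in> carrier Q"
  by (simp add: carrier_Q)

lemma cls_add: "f \<in> FX \<Longrightarrow> g \<in> FX \<Longrightarrow> cls f \<oplus>\<^bsub>Q\<^esub> cls g = cls (f + g)"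
proof -
  assume fg: "f \<in> FX" "g \<in> FX"
  interpret M: Module.module laurent_ring "free_module X" by (rule module_free)
  interpret abelian_subgroup N "free_module X"
    using sub by (intro abelian_subgroupI3 M.abelian_group_axioms additive_subgroupI submodule.axioms(1))
  show ?thesis using a_rcos_sum[of f g] fg by (simp add: quotient_module_def cls_def free_module_def)
qed

lemma cls_zero: "\<zero>\<^bsub>Q\<^esub> = cls 0"
  by (simp add: quotient_module_def cls_alt)

lemma cls_smult: "f \<in> FX \<Longrightarrow> a \<odot>\<^bsub>Q\<^esub> cls f = cls (sm a f)"
proof -
  assume f: "f \<in> FX"
  have "a \<odot>\<^bsub>Q\<^esub> cls f = (\<Union>m\<in>cls f. cls (sm a m))"
    by (simp add: quotient_module_def cls_def free_module_def)
  also have "\<dots> = (\<Union>m\<in>cls f. cls (sm a f))"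
  proof (rule SUP_cong[OF HOL.refl])
    fix m assume "m \<in> cls f"
    then have "m - f \<in> N" by (auto simp: cls_alt)
    then show "cls (sm a m) = cls (sm a f)" using N_sm[of "m - f" a] by (simp add: cls_eq_iff sm_simps)
  qed
  also have "\<dots> = cls (sm a f)" using N_zero by (auto simp: cls_alt)
  finally show ?thesis .
qed

lemma module_Q: "Module.module laurent_ring Q"
proof (rule moduleI[OF cring_laurent])
  show "abelian_group Q"
  proof (rule abelian_groupI)
    fix x assume "x \<in> carrier Q"
    then obtain f where "f \<in> FX" "x = cls f" by (auto simp: carrier_Q)
    then show "\<exists>y\<in>carrier Q. y \<oplus>\<^bsub>Q\<^esub> x = \<zero>\<^bsub>Q\<^esub>"
      by (intro bexI[of _ "cls (- f)"]) (simp_all add: cls_add cls_zero cls_Q)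
  next
    fix x y z assume "x \<in> carrier Q" "y \<in> carrier Q" "z \<in> carrier Q"
    then obtain f g h where fgh: "f \<in> FX" "x = cls f" "g \<in> FX" "y = cls g" "h \<in> FX" "z = cls h"
      by (auto simp: carrier_Q)
    then show "x \<oplus>\<^bsub>Q\<^esub> y \<oplus>\<^bsub>Q\<^esub> z = x \<oplus>\<^bsub>Q\<^esub> (y \<oplus>\<^bsub>Q\<^esub> z)"
      using FX_add[of f g] FX_add[of g h] by (simp add: cls_add add.assoc)
  next
    fix x y assume "x \<in> carrier Q" "y \<in> carrier Q"
    then obtain f g where fg: "f \<in> FX" "x = cls f" "g \<in> FX" "y = cls g" by (auto simp: carrier_Q)
    then show "x \<oplus>\<^bsub>Q\<^esub> y \<in> carrier Q" "x \<oplus>\<^bsub>Q\<^esub> y = y \<oplus>\<^bsub>Q\<^esub> x"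
      using cls_Q[OF FX_add[OF fg(1,3)]] by (simp_all add: cls_add add.commute)
  next
    show "\<zero>\<^bsub>Q\<^esub> \<in> carrier Q" by (simp add: cls_zero cls_Q)
    fix x assume "x \<in> carrier Q"
    then obtain f where "f \<in> FX" "x = cls f" by (auto simp: carrier_Q)
    then show "\<zero>\<^bsub>Q\<^esub> \<oplus>\<^bsub>Q\<^esub> x = x" by (simp add: cls_zero cls_add)
  qed
next
  fix a b x assume "x \<in> carrier Q"
  then obtain f where f: "f \<in> FX" "x = cls f" by (auto simp: carrier_Q)
  show "a \<odot>\<^bsub>Q\<^esub> x \<in> carrier Q" using f FX_sm cls_Q by (simp add: cls_smult)
  show "(a \<oplus>\<^bsub>laurent_ring\<^esub> b) \<odot>\<^bsub>Q\<^esub> x = a \<odot>\<^bsub>Q\<^esub> x \<oplus>\<^bsub>Q\<^esub> b \<odot>\<^bsub>Q\<^esub> x"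
    using f FX_sm[of f] by (simp add: cls_smult cls_add laurent_ring_def sm_simps)
  show "(a \<otimes>\<^bsub>laurent_ring\<^esub> b) \<odot>\<^bsub>Q\<^esub> x = a \<odot>\<^bsub>Q\<^esub> (b \<odot>\<^bsub>Q\<^esub> x)"
    using f FX_sm[of f] by (simp add: cls_smult laurent_ring_def sm_simps)
  show "\<one>\<^bsub>laurent_ring\<^esub> \<odot>\<^bsub>Q\<^esub> x = x" using f by (simp add: cls_smult laurent_ring_def sm_simps)
next
  fix a x y assume "x \<in> carrier Q" "y \<in> carrier Q"
  then obtain f g where fg: "f \<in> FX" "x = cls f" "g \<in> FX" "y = cls g" by (auto simp: carrier_Q)
  then show "a \<odot>\<^bsub>Q\<^esub> (x \<oplus>\<^bsub>Q\<^esub> y) = a \<odot>\<^bsub>Q\<^esub> x \<oplus>\<^bsub>Q\<^esub> a \<odot>\<^bsub>Q\<^esub> y"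
    using FX_sm[of f] FX_sm[of g] FX_add[of f g] by (simp add: cls_smult cls_add sm_simps)
qed

lemma finsum_cls:
  assumes "finite A" "\<And>i. i \<in> A \<Longrightarrow> f i \<in> FX"
  shows "(\<Oplus>\<^bsub>Q\<^esub> i\<in>A. cls (f i)) = cls (\<Sum>i\<in>A. f i)"
proof -
  interpret M: Module.module laurent_ring Q by (rule module_Q)
  show ?thesis using assms
  proof (induction A)
    case empty then show ?case using M.finsum_empty by (simp add: cls_zero)
  next
    case (insert a A)
    then have "(\<Oplus>\<^bsub>Q\<^esub> i\<in>insert a A. cls (f i)) = cls (f a) \<oplus>\<^bsub>Q\<^esub> (\<Oplus>\<^bsub>Q\<^esub> i\<in>A. cls (f i))"
      using cls_Q by (intro M.finsum_insert) auto
    then show ?case using insert FX_sum[of A f] by (simp add: cls_add)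
  qed
qed

lemma finsum_symbols:
  assumes "finite A" "A \<subseteq> X"
  shows "(\<Oplus>\<^bsub>Q\<^esub> i\<in>A. c i \<odot>\<^bsub>Q\<^esub> cls (symbol i)) = cls (\<Sum>i\<in>A. sm (c i) (symbol i))"
proof -
  interpret M: Module.module laurent_ring Q by (rule module_Q)
  have s: "symbol i \<in> FX" if "i \<in> A" for i using that assms by (auto simp: keys_symbol)
  have "(\<Oplus>\<^bsub>Q\<^esub> i\<in>A. c i \<odot>\<^bsub>Q\<^esub> cls (symbol i)) = (\<Oplus>\<^bsub>Q\<^esub> i\<in>A. cls (sm (c i) (symbol i)))"
    by (rule M.finsum_cong') (use s FX_sm cls_Q cls_smult in auto)
  also have "\<dots> = cls (\<Sum>i\<in>A. sm (c i) (symbol i))" by (rule finsum_cls) (use assms s FX_sm in auto)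
  finally show ?thesis .
qed

lemma is_basis_cls:
  assumes L: "\<Lambda> \<subseteq> X"
    and span: "\<And>f. f \<in> FX \<Longrightarrow> \<exists>g. Poly_Mapping.keys g \<subseteq> \<Lambda> \<and> f - g \<in> N"
    and indep: "\<And>g. Poly_Mapping.keys g \<subseteq> \<Lambda> \<Longrightarrow> g \<in> N \<Longrightarrow> g = 0"
  shows "is_basis laurent_ring Q \<Lambda> (\<lambda>i. cls (symbol i))"
  unfolding is_basis_def
proof (intro conjI ballI)
  show "(\<lambda>i. cls (symbol i)) \<in> \<Lambda> \<rightarrow> carrier Q" using L by (auto intro!: cls_Q simp: keys_symbol)
  fix m assume "m \<in> carrier Q"
  then obtain f where f: "f \<in> FX" "m = cls f" by (auto simp: carrier_Q)
  obtain g where g: "Poly_Mapping.keys g \<subseteq> \<Lambda>" "f - g \<in> N" using span[OF f(1)] by blast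
  let ?Z = "\<zero>\<^bsub>laurent_ring\<^esub>"
  have Z: "?Z = 0" by (simp add: laurent_ring_def)
  let ?ok = "\<lambda>c. c \<in> \<Lambda> \<rightarrow> carrier laurent_ring \<and> (\<forall>i. i \<notin> \<Lambda> \<longrightarrow> c i = ?Z) \<and> finite {i. c i \<noteq> ?Z} \<and>
    m = (\<Oplus>\<^bsub>Q\<^esub> i\<in>{i. c i \<noteq> ?Z}. c i \<odot>\<^bsub>Q\<^esub> cls (symbol i))"
  show "\<exists>!c. ?ok c"
  proof (rule ex1I[of _ "Poly_Mapping.lookup g"])
    have k: "{i. Poly_Mapping.lookup g i \<noteq> ?Z} = Poly_Mapping.keys g" by (auto simp: Z in_keys_iff)
    have "(\<Oplus>\<^bsub>Q\<^esub> i\<in>Poly_Mapping.keys g. Poly_Mapping.lookup g i \<odot>\<^bsub>Q\<^esub> cls (symbol i)) = cls g"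
      using g(1) L by (subst finsum_symbols) (auto simp flip: poly_mapping_expand)
    then have m: "m = (\<Oplus>\<^bsub>Q\<^esub> i\<in>{i. Poly_Mapping.lookup g i \<noteq> ?Z}. Poly_Mapping.lookup g i \<odot>\<^bsub>Q\<^esub> cls (symbol i))"
      using f g(2) unfolding k by (simp add: cls_eq_iff)
    show "?ok (Poly_Mapping.lookup g)"
      using g(1) m by (auto simp: k laurent_ring_def in_keys_iff)
  next
    fix c assume c: "?ok c"
    define A where "A = {i. c i \<noteq> ?Z}"
    define h where "h = (\<Sum>i\<in>A. sm (c i) (symbol i))"
    have A: "finite A" "A \<subseteq> \<Lambda>" using c by (auto simp: A_def)
    have lh: "Poly_Mapping.lookup h i = c i" for i
    proof -
      have "Poly_Mapping.lookup h i = (\<Sum>j\<in>A. if i = j then c j else 0)"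
        unfolding h_def lookup_sum by (intro sum.cong) (auto simp: lookup_sm lookup_symbol)
      then show ?thesis using A(1) by (auto simp: A_def Z)
    qed
    then have kh: "Poly_Mapping.keys h \<subseteq> \<Lambda>" using A(2) by (auto simp: in_keys_iff A_def Z)
    have "cls f = cls h" using c f finsum_symbols[of A c] A L unfolding h_def A_def by auto
    then have "(f - g) - (f - h) \<in> N" using g(2) N_diff by (simp only: cls_eq_iff)
    then have "h - g \<in> N" by simp
    moreover have "Poly_Mapping.keys (h - g) \<subseteq> \<Lambda>" using keys_add[of h "- g"] kh g(1) by auto
    ultimately have "h = g" using indep by fastforce
    then show "c = Poly_Mapping.lookup g" using lh by auto
  qed
qed

lemma cls_symbol_inj:
  assumes "\<And>g. Poly_Mapping.keys g \<subseteq> \<Lambda> \<Longrightarrow> g \<in> N \<Longrightarrow> g = 0"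
  shows "inj_on (\<lambda>i. cls (symbol i)) \<Lambda>"
proof (rule inj_onI)
  fix i j assume ij: "i \<in> \<Lambda>" "j \<in> \<Lambda>" "cls (symbol i) = cls (symbol j)"
  have "Poly_Mapping.keys (symbol i - symbol j) \<subseteq> \<Lambda>"
    using keys_add[of "symbol i" "- symbol j"] ij by (auto simp: keys_symbol)
  then have "symbol i - symbol j = 0" using ij(3) assms[of "symbol i - symbol j"] unfolding cls_eq_iff by blast
  then have "symbol i = symbol j" by simp
  then show "i = j" by (metis keys_symbol singleton_inject)
qed

end

lemma is_basis_image:
  fixes T :: "'i \<Rightarrow> 'm"
  assumes M: "abelian_group M" and b: "is_basis Rg M \<Lambda> T" and inj: "inj_on T \<Lambda>"
    and sm: "\<And>a x. a \<in> carrier Rg \<Longrightarrow> x \<in> carrier M \<Longrightarrow> a \<odot>\<^bsub>M\<^esub> x \<in> carrier M"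
  shows "is_basis Rg M (T ` \<Lambda>) (\<lambda>x. x)"
  unfolding is_basis_def
proof (intro conjI ballI)
  interpret abelian_group M by (rule M)
  have T: "T \<in> \<Lambda> \<rightarrow> carrier M" using b by (simp add: is_basis_def)
  then show "(\<lambda>x. x) \<in> T ` \<Lambda> \<rightarrow> carrier M" by auto
  fix m assume m: "m \<in> carrier M"
  let ?Z = "\<zero>\<^bsub>Rg\<^esub>"
  let ?ok = "\<lambda>c. c \<in> \<Lambda> \<rightarrow> carrier Rg \<and> (\<forall>i. i \<notin> \<Lambda> \<longrightarrow> c i = ?Z) \<and> finite {i. c i \<noteq> ?Z} \<and>
    m = (\<Oplus>\<^bsub>M\<^esub> i\<in>{i. c i \<noteq> ?Z}. c i \<odot>\<^bsub>M\<^esub> T i)"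
  let ?ok' = "\<lambda>c. c \<in> T ` \<Lambda> \<rightarrow> carrier Rg \<and> (\<forall>i. i \<notin> T ` \<Lambda> \<longrightarrow> c i = ?Z) \<and> finite {i. c i \<noteq> ?Z} \<and>
    m = (\<Oplus>\<^bsub>M\<^esub> i\<in>{i. c i \<noteq> ?Z}. c i \<odot>\<^bsub>M\<^esub> i)"
  define pl where "pl c' i = (if i \<in> \<Lambda> then c' (T i) else ?Z)" for c' :: "'m \<Rightarrow> _" and i
  have pl_ok: "?ok (pl c')" if c': "?ok' c'" for c'
  proof -
    have im: "{x. c' x \<noteq> ?Z} = T ` {i. pl c' i \<noteq> ?Z}" using c' by (auto simp: pl_def)
    have sub: "{i. pl c' i \<noteq> ?Z} \<subseteq> \<Lambda>" by (auto simp: pl_def)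
    have inj': "inj_on T {i. pl c' i \<noteq> ?Z}" using inj sub by (rule inj_on_subset)
    have fin: "finite {i. pl c' i \<noteq> ?Z}" using c' inj' unfolding im by (metis finite_imageD)
    have cr: "pl c' \<in> \<Lambda> \<rightarrow> carrier Rg" using c' by (auto simp: pl_def)
    have tc: "c' (T i) \<odot>\<^bsub>M\<^esub> T i \<in> carrier M" if "i \<in> \<Lambda>" for i
      using that c' T by (intro sm) auto
    have "m = (\<Oplus>\<^bsub>M\<^esub> x\<in>T ` {i. pl c' i \<noteq> ?Z}. c' x \<odot>\<^bsub>M\<^esub> x)" using c' im by simp
    also have "\<dots> = (\<Oplus>\<^bsub>M\<^esub> i\<in>{i. pl c' i \<noteq> ?Z}. c' (T i) \<odot>\<^bsub>M\<^esub> T i)"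
      by (rule add.finprod_reindex[OF _ inj', simplified]) (use tc sub in auto)
    also have "\<dots> = (\<Oplus>\<^bsub>M\<^esub> i\<in>{i. pl c' i \<noteq> ?Z}. pl c' i \<odot>\<^bsub>M\<^esub> T i)"
      by (rule finsum_cong') (use tc sub in \<open>auto simp: pl_def split: if_splits\<close>)
    finally have "m = (\<Oplus>\<^bsub>M\<^esub> i\<in>{i. pl c' i \<noteq> ?Z}. pl c' i \<odot>\<^bsub>M\<^esub> T i)" .
    then show ?thesis using fin cr by (auto simp: pl_def)
  qed
  have ex1: "\<exists>!c. ?ok c" using b m unfolding is_basis_def by blast
  then obtain c where c: "?ok c" by blast
  define c' where "c' x = (if x \<in> T ` \<Lambda> then c (inv_into \<Lambda> T x) else ?Z)" for x
  have c'T: "c' (T i) = c i" if "i \<in> \<Lambda>" for i using that inj by (simp add: c'_def)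
  have sub: "{i. c i \<noteq> ?Z} \<subseteq> \<Lambda>" using c by auto
  have im: "{x. c' x \<noteq> ?Z} = T ` {i. c i \<noteq> ?Z}"
  proof (intro equalityI subsetI)
    fix x assume x: "x \<in> {x. c' x \<noteq> ?Z}"
    then have "x \<in> T ` \<Lambda>" by (auto simp: c'_def split: if_splits)
    then obtain i where "i \<in> \<Lambda>" "x = T i" by auto
    then show "x \<in> T ` {i. c i \<noteq> ?Z}" using x c'T[of i] by auto
  next
    fix x assume "x \<in> T ` {i. c i \<noteq> ?Z}"
    then obtain i where "x = T i" "c i \<noteq> ?Z" by auto
    then show "x \<in> {x. c' x \<noteq> ?Z}" using c'T[of i] sub by auto
  qed
  have inj': "inj_on T {i. c i \<noteq> ?Z}" using inj sub by (rule inj_on_subset)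
  have tc: "c i \<odot>\<^bsub>M\<^esub> T i \<in> carrier M" if "i \<in> \<Lambda>" for i
    using that c T by (intro sm) auto
  have "(\<Oplus>\<^bsub>M\<^esub> x\<in>T ` {i. c i \<noteq> ?Z}. c' x \<odot>\<^bsub>M\<^esub> x) = (\<Oplus>\<^bsub>M\<^esub> i\<in>{i. c i \<noteq> ?Z}. c' (T i) \<odot>\<^bsub>M\<^esub> T i)"
    by (rule add.finprod_reindex[OF _ inj', simplified]) (use tc sub c'T in auto)
  also have "\<dots> = (\<Oplus>\<^bsub>M\<^esub> i\<in>{i. c i \<noteq> ?Z}. c i \<odot>\<^bsub>M\<^esub> T i)"
    by (rule finsum_cong') (use tc sub c'T in auto)
  finally have ok': "?ok' c'" using c c'T unfolding im by (auto simp: c'_def)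
  show "\<exists>!c. ?ok' c"
  proof (rule ex1I[of ?ok', OF ok'])
    fix d assume d: "?ok' d"
    have "pl d = pl c'" using pl_ok[OF d] pl_ok[OF ok'] ex1 by blast
    then have "d (T i) = c' (T i)" if "i \<in> \<Lambda>" for i using that by (metis pl_def)
    then show "d = c'" using d ok' by (metis (no_types, lifting) ext imageE)
  qed
qed

section \<open>Generated submodules and linear functionals\<close>

lemma submodule_generated_submodule:
  assumes M: "Module.module Rg M" and S: "S \<subseteq> carrier M"
  shows "submodule (submodule_generated Rg M S) Rg M"
proof -
  interpret Module.module Rg M by (rule M)
  have ex: "submodule (carrier M) Rg M" by (rule carrier_is_submodule)
  show ?thesis
  proof (rule submoduleI)
    show "submodule_generated Rg M S \<subseteq> carrier M" using ex S by (auto simp: submodule_generated_def)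
    show "\<zero>\<^bsub>M\<^esub> \<in> submodule_generated Rg M S"
      using subgroup.one_closed[OF submodule.axioms(1)] by (fastforce simp: submodule_generated_def)
  qed (use submoduleE in \<open>auto simp: submodule_generated_def\<close>)
qed

lemma submodule_generated_subset: "S \<subseteq> submodule_generated Rg M S"
  by (auto simp: submodule_generated_def)

lemma submodule_generated_least: "submodule N Rg M \<Longrightarrow> S \<subseteq> N \<Longrightarrow> submodule_generated Rg M S \<subseteq> N"
  by (auto simp: submodule_generated_def)

lemma submodule_freeI:
  assumes "H \<subseteq> {f. Poly_Mapping.keys f \<subseteq> X}" "0 \<in> H" "\<And>f g. f \<in> H \<Longrightarrow> g \<in> H \<Longrightarrow> f + g \<in> H"
    "\<And>a f. f \<in> H \<Longrightarrow> sm a f \<in> H"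
  shows "submodule H laurent_ring (free_module X)"
proof -
  interpret Module.module laurent_ring "free_module X" by (rule module_free)
  show ?thesis
  proof (rule submoduleI)
    fix f assume f: "f \<in> H"
    have "- f \<oplus>\<^bsub>free_module X\<^esub> f = \<zero>\<^bsub>free_module X\<^esub>" by (simp add: free_module_def)
    moreover have "f \<in> carrier (free_module X)" "- f \<in> carrier (free_module X)"
      using f assms(1) by (auto simp: free_module_def)
    ultimately have "\<ominus>\<^bsub>free_module X\<^esub> f = - f" using minus_equality by blast
    then show "\<ominus>\<^bsub>free_module X\<^esub> f \<in> H" using assms(4)[OF f, of "- 1"] by (simp add: sm_simps)
  qed (use assms in \<open>auto simp: free_module_def laurent_ring_def\<close>)
qed

definition lin :: "('i \<Rightarrow> laurent) \<Rightarrow> ('i \<Rightarrow>\<^sub>0 laurent) \<Rightarrow> laurent" where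
  "lin \<phi> f = (\<Sum>\<mu>\<in>Poly_Mapping.keys f. Poly_Mapping.lookup f \<mu> * \<phi> \<mu>)"

lemma lin_superset:
  "finite A \<Longrightarrow> Poly_Mapping.keys f \<subseteq> A \<Longrightarrow> lin \<phi> f = (\<Sum>\<mu>\<in>A. Poly_Mapping.lookup f \<mu> * \<phi> \<mu>)"
  unfolding lin_def by (rule sum.mono_neutral_left) (auto simp: in_keys_iff)

lemma lin_add: "lin \<phi> (f + g) = lin \<phi> f + lin \<phi> g"
proof -
  let ?A = "Poly_Mapping.keys f \<union> Poly_Mapping.keys g"
  have "lin \<phi> (f + g) = (\<Sum>\<mu>\<in>?A. Poly_Mapping.lookup (f + g) \<mu> * \<phi> \<mu>)"
    using keys_add[of f g] by (intro lin_superset) auto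
  also have "\<dots> = lin \<phi> f + lin \<phi> g"
    by (simp add: lookup_add algebra_simps sum.distrib lin_superset[of ?A])
  finally show ?thesis .
qed

lemma lin_sm: "lin \<phi> (sm a f) = a * lin \<phi> f"
  using lin_superset[OF finite_keys keys_sm, of \<phi> a f]
  by (simp add: lookup_sm lin_def sum_distrib_left algebra_simps)

lemma lin_0: "lin \<phi> 0 = 0"
  by (simp add: lin_def)

lemma lin_symbol: "lin \<phi> (symbol \<mu>) = \<phi> \<mu>"
  by (simp add: lin_def keys_symbol lookup_symbol)

section \<open>Independence from the specialisation at \<open>t = 1\<close>\<close>

lemma keys_subset_lookup: "Poly_Mapping.keys a \<subseteq> A \<longleftrightarrow> (\<forall>k. k \<notin> A \<longrightarrow> Poly_Mapping.lookup a k = 0)"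
  by (auto simp: in_keys_iff subset_iff)

text \<open>
  Division from the lowest exponent upwards; the window that contains the exponents shrinks by one.
\<close>

lemma divide_q_minus_1:
  "ev a = 0 \<Longrightarrow> Poly_Mapping.keys a \<subseteq> {lo..<lo + int (Suc n)} \<Longrightarrow>
    \<exists>b. a = (q - 1) * b \<and> Poly_Mapping.keys b \<subseteq> {lo..<lo + int n}"
proof (induction n arbitrary: a lo)
  case 0
  then have k: "Poly_Mapping.keys a \<subseteq> {lo}" by auto
  then have "ev a = Poly_Mapping.lookup a lo" using ev_superset[of "{lo}" a] by simp
  then have "a = 0" using 0 k by (intro poly_mapping_eqI) (auto simp: keys_subset_lookup)
  then show ?case by (intro exI[of _ 0]) auto
next
  case (Suc n)
  define c where "c = Poly_Mapping.lookup a lo"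
  define d where "d = Poly_Mapping.single lo c"
  define a' where "a' = a + (q - 1) * d"
  have qd: "(q - 1) * d = Poly_Mapping.single (1 + lo) c - Poly_Mapping.single lo c"
    by (simp add: d_def t_half_def left_diff_distrib mult_single)
  have "Poly_Mapping.keys a' \<subseteq> {lo + 1..<lo + 1 + int (Suc n)}"
    unfolding keys_subset_lookup
  proof (intro allI impI)
    fix k assume k: "k \<notin> {lo + 1..<lo + 1 + int (Suc n)}"
    consider "k = lo" | "k \<noteq> lo" "k \<noteq> 1 + lo" | "k = 1 + lo" by blast
    then show "Poly_Mapping.lookup a' k = 0"
    proof cases
      case 1 then show ?thesis
        by (simp add: a'_def qd lookup_add lookup_minus lookup_single when_def c_def)
    next
      case 2
      then have "Poly_Mapping.lookup a k = 0" using Suc.prems(2) k by (auto simp: keys_subset_lookup)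
      then show ?thesis using 2 by (simp add: a'_def qd lookup_add lookup_minus lookup_single when_def)
    next
      case 3 then show ?thesis using k by auto
    qed
  qed
  moreover have "ev a' = 0" using Suc.prems by (simp add: a'_def ev_add ev_mult ev_diff)
  ultimately obtain b where b: "a' = (q - 1) * b" "Poly_Mapping.keys b \<subseteq> {lo + 1..<lo + 1 + int n}"
    using Suc.IH by blast
  have "a = (q - 1) * (b - d)" using b(1) by (simp add: a'_def algebra_simps)
  moreover have "Poly_Mapping.keys (b - d) \<subseteq> {lo..<lo + int (Suc n)}"
    using b(2) by (auto simp: keys_subset_lookup lookup_minus d_def lookup_single when_def)
  ultimately show ?case by blast
qed

lemma q_neq_1: "q - 1 \<noteq> 0"
proof
  assume "q - 1 = (0 :: laurent)"
  then have "Poly_Mapping.lookup (q - 1) 0 = 0" by simp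
  then show False by (simp add: lookup_minus t_half_def lookup_single lookup_one when_def)
qed

text \<open>
  A square matrix over the Laurent polynomials that becomes the identity at \<open>t = 1\<close> is injective:
  all coefficients of a relation are divisible by \<open>q - 1\<close>, and dividing shortens them.
\<close>

lemma independent_if_identity_at_1:
  fixes a :: "'i \<Rightarrow> laurent"
  assumes "finite A" "\<And>\<mu> \<kappa>. \<mu> \<in> A \<Longrightarrow> \<kappa> \<in> A \<Longrightarrow> ev (G \<mu> \<kappa>) = (if \<kappa> = \<mu> then 1 else 0)"
    "\<And>\<mu>. \<mu> \<in> A \<Longrightarrow> (\<Sum>\<kappa>\<in>A. a \<kappa> * G \<mu> \<kappa>) = 0"
    "\<And>\<kappa>. \<kappa> \<in> A \<Longrightarrow> Poly_Mapping.keys (a \<kappa>) \<subseteq> {lo..<lo + int n}" "\<mu> \<in> A"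
  shows "a \<mu> = 0"
  using assms(3-5)
proof (induction n arbitrary: a \<mu>)
  case 0
  then have "Poly_Mapping.keys (a \<mu>) = {}" by force
  then show ?case by simp
next
  case (Suc n)
  have ev0: "ev (a \<mu>) = 0" if "\<mu> \<in> A" for \<mu>
  proof -
    have "0 = ev (\<Sum>\<kappa>\<in>A. a \<kappa> * G \<mu> \<kappa>)" using Suc.prems(1)[OF that] by simp
    also have "\<dots> = (\<Sum>\<kappa>\<in>A. if \<kappa> = \<mu> then ev (a \<kappa>) else 0)"
      unfolding ev_sum ev_mult using assms(2)[OF that] by (intro sum.cong) auto
    also have "\<dots> = ev (a \<mu>)" using assms(1) that by simp
    finally show ?thesis by simp
  qed
  have "\<forall>\<kappa>\<in>A. \<exists>b. a \<kappa> = (q - 1) * b \<and> Poly_Mapping.keys b \<subseteq> {lo..<lo + int n}"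
    using divide_q_minus_1[OF ev0 Suc.prems(2)] by blast
  then obtain b where b: "\<And>\<kappa>. \<kappa> \<in> A \<Longrightarrow> a \<kappa> = (q - 1) * b \<kappa>"
    "\<And>\<kappa>. \<kappa> \<in> A \<Longrightarrow> Poly_Mapping.keys (b \<kappa>) \<subseteq> {lo..<lo + int n}" by metis
  have "(\<Sum>\<kappa>\<in>A. b \<kappa> * G \<mu> \<kappa>) = 0" if "\<mu> \<in> A" for \<mu>
  proof -
    have "(q - 1) * (\<Sum>\<kappa>\<in>A. b \<kappa> * G \<mu> \<kappa>) = (\<Sum>\<kappa>\<in>A. a \<kappa> * G \<mu> \<kappa>)"
      unfolding sum_distrib_left using b(1) by (intro sum.cong) (auto simp: mult.assoc)
    then show ?thesis using Suc.prems(1)[OF that] q_neq_1 by simp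
  qed
  then have "b \<mu> = 0" using Suc.IH b(2) Suc.prems(3) by blast
  then show ?case using b(1)[OF Suc.prems(3)] by simp
qed

section \<open>The Fock space\<close>

locale fock_space = root_datum D for D :: "'v::real_vector root_data" +
  fixes l :: nat
  assumes l_pos: "l > 0"
begin

abbreviation X where "X \<equiv> weights D"

abbreviation sdot :: "nat \<Rightarrow> 'v \<Rightarrow> 'v" where "sdot i \<equiv> dot D (s i)"

abbreviation sp :: "'v \<Rightarrow> nat \<Rightarrow> real" where "sp \<mu> i \<equiv> shifted_pairing D \<mu> (sr i)"

lemma weights_alt:
  obtains B where "finite B" "X = {\<Sum>b\<in>B. real_of_int (c b) *\<^sub>R b | c. True}"
  using lattice by blast

lemma weights_add: "x \<in> X \<Longrightarrow> y \<in> X \<Longrightarrow> x + y \<in> X"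
proof -
  obtain B where B: "X = {\<Sum>b\<in>B. real_of_int (c b) *\<^sub>R b | c. True}" using weights_alt by blast
  assume "x \<in> X" "y \<in> X"
  then obtain c d where "x = (\<Sum>b\<in>B. real_of_int (c b) *\<^sub>R b)" "y = (\<Sum>b\<in>B. real_of_int (d b) *\<^sub>R b)"
    unfolding B by blast
  then have "x + y = (\<Sum>b\<in>B. real_of_int (c b + d b) *\<^sub>R b)" by (simp add: scaleR_add_left sum.distrib)
  then show ?thesis unfolding B by (intro CollectI exI[of _ "\<lambda>b. c b + d b"]) simp
qed

lemma weights_scale: "x \<in> X \<Longrightarrow> of_int n *\<^sub>R x \<in> X"
proof -
  obtain B where B: "X = {\<Sum>b\<in>B. real_of_int (c b) *\<^sub>R b | c. True}" using weights_alt by blast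
  assume "x \<in> X"
  then obtain c where "x = (\<Sum>b\<in>B. real_of_int (c b) *\<^sub>R b)" unfolding B by blast
  then have "of_int n *\<^sub>R x = (\<Sum>b\<in>B. real_of_int (n * c b) *\<^sub>R b)" by (simp add: scaleR_sum_right)
  then show ?thesis unfolding B by (intro CollectI exI[of _ "\<lambda>b. n * c b"]) simp
qed

lemma weights_sub_root: "x \<in> X \<Longrightarrow> i \<in> I \<Longrightarrow> c \<in> \<int> \<Longrightarrow> x - c *\<^sub>R sr i \<in> X"
proof -
  assume x: "x \<in> X" "i \<in> I" "c \<in> \<int>"
  then obtain n :: int where n: "c = of_int n" by (elim Ints_cases)
  have "sr i \<in> X" using x roots_weights simple_root by blast
  then have "of_int (- n) *\<^sub>R sr i \<in> X" by (rule weights_scale)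
  from weights_add[OF x(1) this] show ?thesis by (simp add: n)
qed

lemma sp_alt: "i \<in> I \<Longrightarrow> sp \<mu> i = \<langle>\<mu>, sr i\<rangle> + 1"
  by (simp add: shifted_pairing_def pairing_simps simple_root rho_simple)

lemma sp_int: "\<mu> \<in> X \<Longrightarrow> i \<in> I \<Longrightarrow> sp \<mu> i \<in> \<int>"
  using coroot_integral[OF simple_root] by (simp add: sp_alt)

lemma sdot_alt: "sdot i \<mu> = \<mu> - sp \<mu> i *\<^sub>R sr i"
  by (simp add: dot_def s_def refl_def shifted_pairing_def)

lemma sdot_weights: "\<mu> \<in> X \<Longrightarrow> i \<in> I \<Longrightarrow> sdot i \<mu> \<in> X"
  using weights_sub_root sp_int by (simp add: sdot_alt)

definition rels :: "('v \<Rightarrow>\<^sub>0 laurent) set" where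
  "rels = straightening_relations D l \<union> wall_relations D"

lemma rels_cases:
  assumes "r \<in> rels"
  obtains (mult) \<mu> i k where "\<mu> \<in> X" "i \<in> I" "sp \<mu> i = real l * real k" "r = symbol (sdot i \<mu>) + symbol \<mu>"
  | (first) \<mu> i where "\<mu> \<in> X" "i \<in> I" "0 < sp \<mu> i" "sp \<mu> i < real l" "r = symbol (sdot i \<mu>) + sm q (symbol \<mu>)"
  | (higher) \<mu> i k j where "\<mu> \<in> X" "i \<in> I" "k > 0" "j \<in> {1..l - 1}" "sp \<mu> i = real k * real l + real j"
      "r = symbol (sdot i \<mu>) + sm q (symbol \<mu>) +
        (symbol (\<mu> - real j *\<^sub>R sr i) + sm q (symbol (sdot i (\<mu> - real j *\<^sub>R sr i))))"
  | (wall) \<mu> i where "\<mu> \<in> X" "i \<in> I" "sp \<mu> i = 0" "r = symbol \<mu>"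
proof -
  from assms consider
    "r \<in> {symbol (sdot i \<mu>) - (- symbol \<mu>) | \<mu> i. \<mu> \<in> X \<and> i \<in> I \<and> (\<exists>k :: nat. sp \<mu> i = real l * real k)}"
  | "r \<in> {symbol (sdot i \<mu>) - (- sm q (symbol \<mu>)) | \<mu> i. \<mu> \<in> X \<and> i \<in> I \<and> 0 < sp \<mu> i \<and> sp \<mu> i < real l}"
  | "r \<in> {symbol (sdot i \<mu>) - (- sm q (symbol (sdot i \<mu>1)) - symbol \<mu>1 - sm q (symbol \<mu>)) | \<mu> \<mu>1 i.
      \<mu> \<in> X \<and> i \<in> I \<and> sp \<mu> i > real l \<and> (\<nexists>k :: int. sp \<mu> i = real l * real_of_int k) \<and>
      (\<exists>k j :: nat. k > 0 \<and> j \<in> {1..l - 1} \<and> sp \<mu> i = real k * real l + real j \<and> \<mu>1 = \<mu> - real j *\<^sub>R sr i)}"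
  | "r \<in> {symbol \<mu> | \<mu> i. \<mu> \<in> X \<and> i \<in> I \<and> sp \<mu> i = 0}"
    unfolding rels_def straightening_relations_def wall_relations_def Let_def free_module_def I_def[symmetric]
    by (simp only: Un_iff module.simps) blast
  then show thesis
  proof cases
    case 1
    then obtain \<mu> i k where "\<mu> \<in> X" "i \<in> I" "sp \<mu> i = real l * real k" "r = symbol (sdot i \<mu>) - (- symbol \<mu>)"
      by blast
    then show thesis by (intro mult[of \<mu> i k]) simp_all
  next
    case 2
    then obtain \<mu> i where "\<mu> \<in> X" "i \<in> I" "0 < sp \<mu> i" "sp \<mu> i < real l"
      "r = symbol (sdot i \<mu>) - (- sm q (symbol \<mu>))" by blast
    then show thesis by (intro first[of \<mu> i]) simp_all
  next
    case 3
    then obtain \<mu> i k j where "\<mu> \<in> X" "i \<in> I" "k > 0" "j \<in> {1..l - 1}" "sp \<mu> i = real k * real l + real j"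
      "r = symbol (sdot i \<mu>) - (- sm q (symbol (sdot i (\<mu> - real j *\<^sub>R sr i))) -
        symbol (\<mu> - real j *\<^sub>R sr i) - sm q (symbol \<mu>))" by blast
    then show thesis by (intro higher[of \<mu> i k j]) (simp_all add: algebra_simps)
  next
    case 4
    then show thesis using wall by blast
  qed
qed

lemma rels_mult:
  "\<mu> \<in> X \<Longrightarrow> i \<in> I \<Longrightarrow> sp \<mu> i = real l * real k \<Longrightarrow> symbol (sdot i \<mu>) + symbol \<mu> \<in> rels"
  unfolding rels_def straightening_relations_def Let_def I_def[symmetric]
  by (intro UnI1 CollectI exI[of _ \<mu>] exI[of _ i]) auto

lemma rels_first:
  "\<mu> \<in> X \<Longrightarrow> i \<in> I \<Longrightarrow> 0 < sp \<mu> i \<Longrightarrow> sp \<mu> i < real l \<Longrightarrow> symbol (sdot i \<mu>) + sm q (symbol \<mu>) \<in> rels"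
  unfolding rels_def straightening_relations_def Let_def I_def[symmetric]
  by (rule UnI1, rule UnI1, rule UnI2, intro CollectI exI[of _ \<mu>] exI[of _ i]) (auto simp: free_module_def)

lemma rels_higher:
  assumes "\<mu> \<in> X" "i \<in> I" "k > 0" "j \<in> {1..l - 1}" "sp \<mu> i = real k * real l + real j"
  shows "symbol (sdot i \<mu>) + sm q (symbol \<mu>) +
    (symbol (\<mu> - real j *\<^sub>R sr i) + sm q (symbol (sdot i (\<mu> - real j *\<^sub>R sr i)))) \<in> rels"
proof -
  have j: "0 < real j" "real j < real l" using assms(4) by auto
  have "1 * real l \<le> real k * real l" using assms(3) by (intro mult_right_mono) auto
  then have 1: "sp \<mu> i > real l" using assms(5) j by linarith
  have 2: "\<nexists>n :: int. sp \<mu> i = real l * real_of_int n"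
  proof
    assume "\<exists>n :: int. sp \<mu> i = real l * real_of_int n"
    then obtain n :: int where "sp \<mu> i = real l * real_of_int n" by blast
    then have n: "real l * real_of_int n = real k * real l + real j" using assms(5) by linarith
    then have "real_of_int (int l * (n - int k)) = real_of_int (int j)" by (simp add: algebra_simps)
    then have e: "int l * (n - int k) = int j" by linarith
    then have "int l dvd int j" by (metis dvd_triv_left)
    then show False using j by (auto dest: zdvd_imp_le)
  qed
  show ?thesis
    unfolding rels_def straightening_relations_def Let_def I_def[symmetric]
    by (rule UnI1, rule UnI2, rule CollectI,
        rule exI[of _ \<mu>], rule exI[of _ "\<mu> - real j *\<^sub>R sr i"], rule exI[of _ i])
      (use assms 1 2 in \<open>auto simp: free_module_def\<close>)
qed

lemma rels_wall: "\<mu> \<in> X \<Longrightarrow> i \<in> I \<Longrightarrow> sp \<mu> i = 0 \<Longrightarrow> symbol \<mu> \<in> rels"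
  unfolding rels_def wall_relations_def I_def[symmetric] by blast

lemma symbol_X: "\<mu> \<in> X \<Longrightarrow> Poly_Mapping.keys (symbol \<mu>) \<subseteq> X"
  by (simp add: keys_symbol)

lemma keys_add_X: "Poly_Mapping.keys f \<subseteq> A \<Longrightarrow> Poly_Mapping.keys g \<subseteq> A \<Longrightarrow> Poly_Mapping.keys (f + g) \<subseteq> A"
  using keys_add[of f g] by blast

lemma keys_sm_X: "Poly_Mapping.keys f \<subseteq> A \<Longrightarrow> Poly_Mapping.keys (sm a f) \<subseteq> A"
  using keys_sm[of a f] by blast

lemma rels_X: "r \<in> rels \<Longrightarrow> Poly_Mapping.keys r \<subseteq> X"
  by (elim rels_cases, simp_all only:)
    (intro keys_add_X keys_sm_X symbol_X sdot_weights weights_sub_root Ints_of_nat; assumption)+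

lemma fock_submodule_alt: "fock_submodule D l = submodule_generated laurent_ring (free_module X) rels"
  by (simp add: fock_submodule_def rels_def)

sublocale free_submodule X "fock_submodule D l"
proof (rule free_submodule.intro)
  show "submodule (fock_submodule D l) laurent_ring (free_module X)"
    unfolding fock_submodule_alt
    by (rule submodule_generated_submodule[OF module_free]) (use rels_X in \<open>auto simp: free_module_def\<close>)
qed

abbreviation N where "N \<equiv> fock_submodule D l"

lemma rels_N: "r \<in> rels \<Longrightarrow> r \<in> N"
  unfolding fock_submodule_alt by (rule subsetD[OF submodule_generated_subset])

lemma N_least: "submodule H laurent_ring (free_module X) \<Longrightarrow> rels \<subseteq> H \<Longrightarrow> N \<subseteq> H"
  unfolding fock_submodule_alt by (rule submodule_generated_least)

lemma fock_alt: "fock D l = Q" and ket_alt: "ket D l \<mu> = cls (symbol \<mu>)"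
  by (simp_all add: fock_def ket_def cls_def)

section \<open>Linear independence of the dominant kets\<close>

text \<open>
  The point at which the functionals are evaluated. Pairings that are divisible by \<open>l\<close> become affine
  hyperplanes.
\<close>

definition pt :: "'v \<Rightarrow> 'v" where
  "pt \<mu> = (1 / real l) *\<^sub>R (\<mu> + rho D)"

lemma pt_pairing: "\<alpha> \<in> R \<Longrightarrow> \<langle>pt \<mu>, \<alpha>\<rangle> = shifted_pairing D \<mu> \<alpha> / real l"
  by (simp add: pt_def pairing_simps shifted_pairing_def)

lemma pt_sdot: "i \<in> I \<Longrightarrow> pt (sdot i \<mu>) = s i (pt \<mu>)"
  using s_linear[of i] by (simp add: pt_def dot_def linear_scale)

lemma pt_inj: "pt \<mu> = pt \<kappa> \<Longrightarrow> \<mu> = \<kappa>"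
  using l_pos by (simp add: pt_def)

lemma pt_affine:
  assumes "i \<in> I" "sp \<mu> i = real k * real l + real j"
  shows "pt (\<mu> - real j *\<^sub>R sr i) = arefl (sr i, - int k) (pt \<mu>)"
proof -
  have "\<langle>pt \<mu>, sr i\<rangle> - real k = real j / real l"
    using assms l_pos by (simp add: pt_pairing simple_root field_simps)
  then have "arefl (sr i, - int k) (pt \<mu>) = pt \<mu> - (real j / real l) *\<^sub>R sr i"
    by (simp add: arefl_def val_def)
  then show ?thesis by (simp add: pt_def scaleR_diff_right algebra_simps)
qed

text \<open>
  Each relation is satisfied by the functionals whose base alcove is far enough, so that every
  element of the submodule of relations is eventually killed.
\<close>

lemma N_eventually_zero:
  assumes C: "dom_alcove C" and nu: "\<nu> \<in> closed_alcove" and f: "f \<in> N"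
  shows "\<forall>\<^sub>F m in sequentially. lin (\<lambda>\<mu>. F m C \<nu> (pt \<mu>)) f = 0"
proof -
  let ?H = "{f. Poly_Mapping.keys f \<subseteq> X \<and> (\<forall>\<^sub>F m in sequentially. lin (\<lambda>\<mu>. F m C \<nu> (pt \<mu>)) f = 0)}"
  have "submodule ?H laurent_ring (free_module X)"
  proof (rule submodule_freeI)
    show "f + g \<in> ?H" if "f \<in> ?H" "g \<in> ?H" for f g
    proof -
      have "\<forall>\<^sub>F m in sequentially. lin (\<lambda>\<mu>. F m C \<nu> (pt \<mu>)) f = 0 \<and> lin (\<lambda>\<mu>. F m C \<nu> (pt \<mu>)) g = 0"
        using that by (simp add: eventually_conj)
      then have "\<forall>\<^sub>F m in sequentially. lin (\<lambda>\<mu>. F m C \<nu> (pt \<mu>)) (f + g) = 0"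
        by (rule eventually_mono) (simp add: lin_add)
      then show ?thesis using that keys_add_X by blast
    qed
    show "sm a f \<in> ?H" if "f \<in> ?H" for a f
      using that keys_sm_X[of f X a] by (auto simp: lin_sm elim: eventually_mono)
  qed (auto simp: lin_0)
  moreover have "rels \<subseteq> ?H"
  proof
    fix r assume r: "r \<in> rels"
    have "\<forall>\<^sub>F m in sequentially. lin (\<lambda>\<mu>. F m C \<nu> (pt \<mu>)) r = 0"
      using r
    proof (cases rule: rels_cases)
      case (mult \<mu> i k)
      have z: "\<langle>pt \<mu>, sr i\<rangle> = real k" using mult l_pos by (simp add: pt_pairing simple_root)
      show ?thesis
      proof (cases "k = 0")
        case True
        then have "s i (pt \<mu>) = pt \<mu>" using z by (simp add: s_def refl_def)
        then show ?thesis using F_relation_zero[OF mult(2) nu C, of "pt \<mu>"] z True mult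
          by (auto simp: lin_add lin_symbol pt_sdot elim: eventually_mono)
      next
        case False
        then show ?thesis using F_relation_wall[OF mult(2) nu C _ z] mult
          by (simp add: lin_add lin_symbol pt_sdot)
      qed
    next
      case (first \<mu> i)
      have "0 < \<langle>pt \<mu>, sr i\<rangle>" "\<langle>pt \<mu>, sr i\<rangle> < 1" using first l_pos by (simp_all add: pt_pairing simple_root)
      from F_relation_first_strip[OF first(2) nu C this] show ?thesis
        using first by (simp add: lin_add lin_symbol lin_sm pt_sdot)
    next
      case (higher \<mu> i k j)
      have j: "0 < real j" "real j < real l" using higher(4) by auto
      have p: "\<langle>pt \<mu>, sr i\<rangle> = real k + real j / real l"
        using higher l_pos by (simp add: pt_pairing simple_root field_simps)
      have "real k < \<langle>pt \<mu>, sr i\<rangle>" "\<langle>pt \<mu>, sr i\<rangle> < real k + 1" using j by (simp_all add: p)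
      moreover have "k \<ge> 1" using higher(3) by simp
      ultimately show ?thesis using F_relation_strip[OF higher(2) nu C, of k "pt \<mu>"] higher
        by (simp add: lin_add lin_symbol lin_sm pt_sdot pt_affine[OF higher(2,5)])
    next
      case (wall \<mu> i)
      then show ?thesis using F_relation_zero[OF wall(2) nu C, of "pt \<mu>"]
        by (simp add: lin_symbol pt_pairing simple_root)
    qed
    then show "r \<in> ?H" using rels_X[OF r] by blast
  qed
  ultimately have "N \<subseteq> ?H" by (rule N_least)
  then show ?thesis using f by blast
qed

lemma dominant_alt: "dominant D = {\<mu> \<in> X. \<forall>i\<in>I. sp \<mu> i > 0}"
  by (simp add: dominant_def I_def)

lemma dominant_pt: "\<mu> \<in> dominant D \<Longrightarrow> \<beta> \<in> P \<Longrightarrow> \<langle>pt \<mu>, \<beta>\<rangle> > 0"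
proof -
  assume m: "\<mu> \<in> dominant D" and b: "\<beta> \<in> P"
  have "\<langle>pt \<mu>, sr i\<rangle> > 0" if "i \<in> I" for i
  proof -
    have "sp \<mu> i > 0" using m that unfolding dominant_alt by blast
    then show ?thesis using l_pos by (simp add: pt_pairing[OF simple_root[OF that]])
  qed
  then show ?thesis using b by (rule dominant_pairing_pos)
qed

text \<open>
  A relation between dominant kets is evaluated by one functional for each ket, with the same \<open>m\<close>
  for all of them.
\<close>

lemma dominant_independent:
  assumes g: "Poly_Mapping.keys g \<subseteq> dominant D" "g \<in> N"
  shows "g = 0"
proof -
  define A where "A = Poly_Mapping.keys g"
  have A: "finite A" "A \<subseteq> dominant D" using g by (auto simp: A_def)
  have "\<forall>\<mu>\<in>A. \<exists>C \<nu>. dom_alcove C \<and> \<nu> \<in> closed_alcove \<and> C \<nu> = pt \<mu>"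
    using exists_dom_alcove dominant_pt A(2) by (metis subsetD)
  then obtain C \<nu> where C: "\<And>\<mu>. \<mu> \<in> A \<Longrightarrow> dom_alcove (C \<mu>) \<and> \<nu> \<mu> \<in> closed_alcove \<and> C \<mu> (\<nu> \<mu>) = pt \<mu>"
    by metis
  have "\<forall>\<^sub>F m in sequentially. \<forall>\<mu>\<in>A. lin (\<lambda>\<kappa>. F m (C \<mu>) (\<nu> \<mu>) (pt \<kappa>)) g = 0"
    using C N_eventually_zero g(2) by (intro eventually_ball_finite A(1)) blast
  then have "\<exists>m. \<forall>\<mu>\<in>A. lin (\<lambda>\<kappa>. F m (C \<mu>) (\<nu> \<mu>) (pt \<kappa>)) g = 0"
    by (rule eventually_happens'[OF sequentially_bot])
  then obtain m where m: "\<And>\<mu>. \<mu> \<in> A \<Longrightarrow> lin (\<lambda>\<kappa>. F m (C \<mu>) (\<nu> \<mu>) (pt \<kappa>)) g = 0"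
    by blast
  have "finite (\<Union>\<mu>\<in>A. Poly_Mapping.keys (Poly_Mapping.lookup g \<mu>))" using A(1) by simp
  then obtain K :: int where K: "\<And>\<mu> k. \<mu> \<in> A \<Longrightarrow> k \<in> Poly_Mapping.keys (Poly_Mapping.lookup g \<mu>) \<Longrightarrow> \<bar>k\<bar> \<le> K"
    using finite_imageI[of _ abs] bdd_above_finite[of "abs ` (\<Union>\<mu>\<in>A. Poly_Mapping.keys (Poly_Mapping.lookup g \<mu>))"]
    unfolding bdd_above_def by (metis UN_I imageI)
  have "Poly_Mapping.lookup g \<mu> = 0" if mu: "\<mu> \<in> A" for \<mu>
  proof (rule independent_if_identity_at_1[where A=A and a="Poly_Mapping.lookup g" and lo="- K"
        and n="nat (2 * \<bar>K\<bar> + 1)" and G="\<lambda>\<mu> \<kappa>. F m (C \<mu>) (\<nu> \<mu>) (pt \<kappa>)"])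
    show "ev (F m (C \<mu>) (\<nu> \<mu>) (pt \<kappa>)) = (if \<kappa> = \<mu> then 1 else 0)" if "\<mu> \<in> A" "\<kappa> \<in> A" for \<mu> \<kappa>
    proof -
      have "ev (F m (C \<mu>) (\<nu> \<mu>) (pt \<kappa>)) = (if pt \<kappa> = C \<mu> (\<nu> \<mu>) then 1 else 0)"
        using C[OF that(1)] dominant_pt A(2) that by (intro F_ev) (auto simp: subset_iff)
      then show ?thesis using C[OF that(1)] pt_inj by auto
    qed
    show "(\<Sum>\<kappa>\<in>A. Poly_Mapping.lookup g \<kappa> * F m (C \<mu>) (\<nu> \<mu>) (pt \<kappa>)) = 0" if "\<mu> \<in> A" for \<mu>
      using m[OF that] by (simp add: lin_def A_def)
    show "Poly_Mapping.keys (Poly_Mapping.lookup g \<kappa>) \<subseteq> {- K..<- K + int (nat (2 * \<bar>K\<bar> + 1))}" if "\<kappa> \<in> A" for \<kappa>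
      using K[OF that] by fastforce
  qed (use A mu in auto)
  then show ?thesis unfolding A_def by (metis keys_eq_empty in_keys_iff equals0I)
qed

end

section \<open>Straightening\<close>

context fock_space
begin

text \<open>
  Along a reduced word every letter adds an inversion.
\<close>

lemma W_reduced_induct [consumes 1, case_names id step]:
  assumes "w \<in> W" "Y id"
    "\<And>i w. i \<in> I \<Longrightarrow> w \<in> W \<Longrightarrow> winv w (sr i) \<in> P \<Longrightarrow> Y w \<Longrightarrow> Y (s i \<circ> w)"
  shows "Y w"
proof -
  have "set is \<subseteq> I \<Longrightarrow> length is = card (inversions (word_prod D is)) \<Longrightarrow> Y (word_prod D is)" for "is"
  proof (induction "is")
    case Nil then show ?case using assms(2) by (simp add: id_def)
  next
    case (Cons i js)
    let ?w = "word_prod D js"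
    have i: "i \<in> I" and w: "?w \<in> W" using Cons.prems(1) W_word by auto
    have l: "Suc (length js) = card (inversions (s i \<circ> ?w))" using Cons.prems(2) by (simp add: comp_def)
    have le: "card (inversions ?w) \<le> length js" using Cons.prems(1) by (intro card_inversions_word) simp
    have p: "winv ?w (sr i) \<in> P" using card_inversions_step(2)[OF i w] l le by linarith
    then have "length js = card (inversions ?w)" using card_inversions_step(1)[OF i w] l by simp
    then have "Y ?w" using Cons.IH Cons.prems(1) by simp
    then show ?case using assms(3)[OF i w p] by (simp add: comp_def)
  qed
  then show ?thesis using reduced_word[OF assms(1)] by metis
qed

definition shifted_norm :: "'v \<Rightarrow> real" where
  "shifted_norm \<mu> = form (\<mu> + rho D) (\<mu> + rho D)"

text \<open>
  The factor 4 accounts for the denominator of \<open>\<rho>\<close> in both arguments of the form.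
\<close>

definition shifted_norm_nat :: "'v \<Rightarrow> nat" where
  "shifted_norm_nat \<mu> = nat \<lfloor>4 * shifted_norm \<mu>\<rfloor>"

definition negative_count :: "'v \<Rightarrow> nat" where
  "negative_count \<mu> = card {\<beta> \<in> P. \<langle>\<mu> + rho D, \<beta>\<rangle> < 0}"

lemma shifted_norm_int: "\<mu> \<in> X \<Longrightarrow> 4 * shifted_norm \<mu> \<in> \<int>" and shifted_norm_nonneg: "shifted_norm \<mu> \<ge> 0"
proof -
  assume m: "\<mu> \<in> X"
  have i: "2 * \<langle>\<mu> + rho D, \<gamma>\<rangle> \<in> \<int>" if "\<gamma> \<in> R" for \<gamma>
    using that m root_pairing_int[OF that] pos_root pairing_int
    by (auto simp: rho_def pairing_simps distrib_left intro!: Ints_add Ints_mult Ints_sum)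
  have "4 * shifted_norm \<mu> = (\<Sum>\<gamma>\<in>R. (2 * \<langle>\<mu> + rho D, \<gamma>\<rangle>) * (2 * \<langle>\<mu> + rho D, \<gamma>\<rangle>))"
    by (simp add: shifted_norm_def form_def sum_distrib_left algebra_simps)
  moreover have "(\<Sum>\<gamma>\<in>R. (2 * \<langle>\<mu> + rho D, \<gamma>\<rangle>) * (2 * \<langle>\<mu> + rho D, \<gamma>\<rangle>)) \<in> \<int>"
    by (rule Ints_sum) (rule Ints_mult[OF i i])
  ultimately show "4 * shifted_norm \<mu> \<in> \<int>" by simp
qed (simp add: shifted_norm_def form_def sum_nonneg)

lemma shifted_norm_nat_mono:
  assumes "\<mu> \<in> X" "\<kappa> \<in> X"
  shows "shifted_norm \<mu> < shifted_norm \<kappa> \<Longrightarrow> shifted_norm_nat \<mu> < shifted_norm_nat \<kappa>" "shifted_norm \<mu> = shifted_norm \<kappa> \<Longrightarrow> shifted_norm_nat \<mu> = shifted_norm_nat \<kappa>"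
proof -
  obtain a b :: int where "4 * shifted_norm \<mu> = of_int a" "4 * shifted_norm \<kappa> = of_int b"
    using shifted_norm_int assms by (metis Ints_cases)
  then show "shifted_norm \<mu> < shifted_norm \<kappa> \<Longrightarrow> shifted_norm_nat \<mu> < shifted_norm_nat \<kappa>" "shifted_norm \<mu> = shifted_norm \<kappa> \<Longrightarrow> shifted_norm_nat \<mu> = shifted_norm_nat \<kappa>"
    using shifted_norm_nonneg[of \<mu>] shifted_norm_nonneg[of \<kappa>] by (auto simp: shifted_norm_nat_def)
qed

lemma shifted_norm_sdot: "i \<in> I \<Longrightarrow> shifted_norm (sdot i \<mu>) = shifted_norm \<mu>"
  by (simp add: shifted_norm_def dot_def s_def form_refl simple_root)

lemma shifted_norm_dot: "w \<in> W \<Longrightarrow> shifted_norm (dot D w \<mu>) = shifted_norm \<mu>"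
  by (simp add: shifted_norm_def dot_def W_form)

lemma shifted_norm_string:
  assumes i: "i \<in> I" and c: "0 < c" "c < sp \<mu> i"
  shows "shifted_norm (\<mu> - c *\<^sub>R sr i) < shifted_norm \<mu>"
proof -
  let ?x = "\<mu> + rho D" and ?a = "sr i"
  have "shifted_norm (\<mu> - c *\<^sub>R ?a) = form (?x - c *\<^sub>R ?a) (?x - c *\<^sub>R ?a)"
    by (simp add: shifted_norm_def algebra_simps)
  also have "\<dots> = shifted_norm \<mu> - c * (2 * form ?x ?a) + c * c * form ?a ?a"
    using form_commute[of ?a \<mu>] form_commute[of ?a "rho D"] unfolding shifted_norm_def
    by (simp add: form_simps algebra_simps)
  also have "\<dots> = shifted_norm \<mu> - c * (sp \<mu> i - c) * form ?a ?a"
    unfolding form_root[OF simple_root[OF i]] shifted_pairing_def by (simp add: algebra_simps)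
  also have "\<dots> < shifted_norm \<mu>" using c form_root_pos[OF simple_root[OF i]] by simp
  finally show ?thesis .
qed

lemma negative_count_sdot:
  assumes i: "i \<in> I" and p: "sp \<mu> i < 0"
  shows "negative_count (sdot i \<mu>) < negative_count \<mu>"
proof -
  let ?x = "\<mu> + rho D"
  let ?S = "{\<beta> \<in> P. \<langle>?x, \<beta>\<rangle> < 0}"
  let ?T = "{\<beta> \<in> P. \<langle>s i ?x, \<beta>\<rangle> < 0}"
  have e: "\<langle>s i ?x, \<beta>\<rangle> = \<langle>?x, s i \<beta>\<rangle>" if "\<beta> \<in> P" for \<beta>
    using i that by (simp add: s_def coroot_refl simple_root pos_root)
  have "s i ` ?T \<subseteq> ?S - {sr i}"
  proof (rule image_subsetI)
    fix \<beta> assume b: "\<beta> \<in> ?T"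
    have "\<beta> \<noteq> sr i"
    proof
      assume "\<beta> = sr i"
      then have "\<langle>?x, - sr i\<rangle> < 0" using b e[of "sr i"] i by (simp add: s_simple)
      then show False using p coroot_uminus[OF simple_root[OF i]] by (simp add: shifted_pairing_def)
    qed
    then show "s i \<beta> \<in> ?S - {sr i}" using b e s_pos[OF i] s_not_simple[OF i] by auto
  qed
  moreover have "inj_on (s i) ?T" by (rule inj_on_inverseI[where g="s i"]) (rule s_invol[OF i])
  ultimately have "card ?T \<le> card (?S - {sr i})" using finite_pos by (intro card_inj_on_le) auto
  also have "\<dots> < card ?S"
    using p simple_pos[OF i] finite_pos by (intro psubset_card_mono) (auto simp: shifted_pairing_def)
  finally show ?thesis by (simp add: negative_count_def dot_def)
qed

lemma sp_sdot: "i \<in> I \<Longrightarrow> sp (sdot i \<mu>) i = - sp \<mu> i"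
  using coroot_self[OF simple_root] by (simp add: sdot_alt shifted_pairing_def pairing_simps simple_root)

lemma sdot_invol: "i \<in> I \<Longrightarrow> sdot i (sdot i \<mu>) = \<mu>"
  by (simp add: dot_def s_invol)

text \<open>
  The part of a root string strictly between a weight and its image under the dot action of \<open>s\<^sub>i\<close>.
\<close>

definition string :: "'v \<Rightarrow> nat \<Rightarrow> 'v set" where
  "string \<mu> i = {\<mu> - real j *\<^sub>R sr i | j. 0 < j \<and> real j < sp \<mu> i}"

text \<open>
  The coefficient of \<open>|\<mu>\<rangle>\<close> in the relation for \<open>|s\<^sub>i \<circ> \<mu>\<rangle>\<close>, where \<open>p\<close> is the pairing of \<open>\<mu> + \<rho>\<close> with the
  simple coroot.
\<close>

definition leading_factor :: "real \<Rightarrow> laurent" where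
  "leading_factor p = (if \<exists>k :: int. p = real l * real_of_int k then - 1 else - q)"

text \<open>
  For a positive pairing the relations have a common shape: up to terms strictly inside the root
  string, \<open>|s\<^sub>i \<circ> \<mu>\<rangle>\<close> is a multiple of \<open>|\<mu>\<rangle>\<close>.
\<close>

lemma straighten_step:
  assumes m: "\<mu> \<in> X" and i: "i \<in> I" and p: "sp \<mu> i > 0"
  shows "\<exists>h. Poly_Mapping.keys h \<subseteq> string \<mu> i \<and> symbol (sdot i \<mu>) - (sm (leading_factor (sp \<mu> i)) (symbol \<mu>) + h) \<in> N"
proof -
  obtain n :: int where n: "sp \<mu> i = of_int n" using sp_int[OF m i] by (elim Ints_cases)
  define p' where "p' = nat n"
  have pn: "sp \<mu> i = real p'" "p' > 0" using n p by (auto simp: p'_def)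
  define k j where "k = p' div l" and "j = p' mod l"
  have kj: "p' = k * l + j" "j < l" using l_pos by (auto simp: k_def j_def)
  have dv: "(\<exists>k :: int. sp \<mu> i = real l * real_of_int k) \<longleftrightarrow> j = 0"
  proof
    assume "\<exists>k :: int. sp \<mu> i = real l * real_of_int k"
    then obtain k' :: int where "real p' = real l * real_of_int k'" using pn by auto
    then have "real_of_int (int p') = real_of_int (int l * k')" by simp
    then have "int p' = int l * k'" by (simp only: of_int_eq_iff)
    then have "int l dvd int p'" by simp
    then show "j = 0" by (simp add: j_def)
  next
    assume "j = 0"
    then show "\<exists>k :: int. sp \<mu> i = real l * real_of_int k"
      using pn kj by (intro exI[of _ "int k"]) simp
  qed
  consider "j = 0" | "j > 0" "k = 0" | "j > 0" "k > 0" by blast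
  then show ?thesis
  proof cases
    case 1
    then have "symbol (sdot i \<mu>) + symbol \<mu> \<in> N"
      using pn kj by (intro rels_N rels_mult[OF m i, of k]) simp
    then show ?thesis using 1 dv by (intro exI[of _ 0]) (simp add: leading_factor_def sm_simps)
  next
    case 2
    then have "symbol (sdot i \<mu>) + sm q (symbol \<mu>) \<in> N"
      using pn kj by (intro rels_N rels_first[OF m i]) simp_all
    then show ?thesis using 2 dv by (intro exI[of _ 0]) (simp add: leading_factor_def sm_simps)
  next
    case 3
    let ?\<kappa> = "\<mu> - real j *\<^sub>R sr i"
    let ?h = "- (symbol ?\<kappa> + sm q (symbol (sdot i ?\<kappa>)))"
    have "symbol (sdot i \<mu>) + sm q (symbol \<mu>) + (symbol ?\<kappa> + sm q (symbol (sdot i ?\<kappa>))) \<in> N"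
      using 3 pn kj by (intro rels_N rels_higher[OF m i, of k j]) auto
    moreover have "Poly_Mapping.keys ?h \<subseteq> string \<mu> i"
    proof -
      have "k * l \<ge> l" using 3 by simp
      then have jp: "j < p'" "0 < p' - j" using kj l_pos by auto
      have "sp ?\<kappa> i = real p' - 2 * real j"
        using i pn coroot_self[OF simple_root[OF i]]
        by (simp add: shifted_pairing_def pairing_simps simple_root algebra_simps)
      then have e: "sdot i ?\<kappa> = \<mu> - real (p' - j) *\<^sub>R sr i"
        using jp by (simp add: sdot_alt of_nat_diff algebra_simps flip: scaleR_add_left)
      have "?\<kappa> \<in> string \<mu> i" using 3 jp pn by (auto simp: string_def)
      moreover have "sdot i ?\<kappa> \<in> string \<mu> i"
        unfolding e string_def using jp pn 3 by (intro CollectI exI[of _ "p' - j"]) auto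
      ultimately have "Poly_Mapping.keys (symbol ?\<kappa> + sm q (symbol (sdot i ?\<kappa>))) \<subseteq> string \<mu> i"
        by (intro keys_add_X keys_sm_X) (simp_all add: keys_symbol)
      then show ?thesis by (simp del: minus_add_distrib)
    qed
    ultimately show ?thesis using 3 dv by (intro exI[of _ ?h]) (simp add: leading_factor_def sm_simps algebra_simps)
  qed
qed

lemma string_X: "\<mu> \<in> X \<Longrightarrow> i \<in> I \<Longrightarrow> string \<mu> i \<subseteq> X"
  by (auto simp: string_def intro!: weights_sub_root)

lemma string_shifted_norm: "i \<in> I \<Longrightarrow> \<kappa> \<in> string \<mu> i \<Longrightarrow> shifted_norm \<kappa> < shifted_norm \<mu>"
  by (auto simp: string_def intro!: shifted_norm_string)

lemma reduce_combination:
  assumes "\<And>\<kappa>. \<kappa> \<in> Poly_Mapping.keys h \<Longrightarrow> \<exists>g. Poly_Mapping.keys g \<subseteq> T \<and> symbol \<kappa> - g \<in> N"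
  shows "\<exists>g. Poly_Mapping.keys g \<subseteq> T \<and> h - g \<in> N"
proof -
  obtain G where G: "\<And>\<kappa>. \<kappa> \<in> Poly_Mapping.keys h \<Longrightarrow> Poly_Mapping.keys (G \<kappa>) \<subseteq> T \<and> symbol \<kappa> - G \<kappa> \<in> N"
    using assms by metis
  let ?K = "Poly_Mapping.keys h"
  let ?g = "\<Sum>\<kappa>\<in>?K. sm (Poly_Mapping.lookup h \<kappa>) (G \<kappa>)"
  have "h - ?g = (\<Sum>\<kappa>\<in>?K. sm (Poly_Mapping.lookup h \<kappa>) (symbol \<kappa> - G \<kappa>))"
    using poly_mapping_expand[of ?K h] by (simp add: sm_simps sum_subtractf)
  also have "\<dots> \<in> N" by (rule N_sum) (use G N_sm in auto)
  finally have "h - ?g \<in> N" .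
  moreover have "Poly_Mapping.keys (\<Sum>\<kappa>\<in>A. sm (Poly_Mapping.lookup h \<kappa>) (G \<kappa>)) \<subseteq> T" if "A \<subseteq> ?K" for A
    using finite_subset[OF that finite_keys] that
  proof (induction A)
    case (insert a A)
    then have "Poly_Mapping.keys (G a) \<subseteq> T" using G by blast
    then have "Poly_Mapping.keys (sm (Poly_Mapping.lookup h a) (G a) +
        (\<Sum>\<kappa>\<in>A. sm (Poly_Mapping.lookup h \<kappa>) (G \<kappa>))) \<subseteq> T"
      using insert by (intro keys_add_X keys_sm_X) auto
    then show ?case unfolding sum.insert[OF insert(1,2)] .
  qed simp
  from this[OF subset_refl] have "Poly_Mapping.keys ?g \<subseteq> T" .
  ultimately show ?thesis by (intro exI[of _ ?g] conjI)
qed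

text \<open>
  Closed under everything that straightening can produce.
\<close>

definition saturated :: "'v set \<Rightarrow> bool" where
  "saturated C \<longleftrightarrow> C \<subseteq> X \<and> (\<forall>\<mu>\<in>C. \<forall>i\<in>I. sdot i \<mu> \<in> C \<and> string \<mu> i \<subseteq> C)"

text \<open>
  Straightening terminates: a step either shortens \<open>\<mu> + \<rho>\<close> or keeps its length and removes one
  positive root on which it is negative.
\<close>

lemma straighten:
  assumes C: "saturated C" and m: "\<mu> \<in> C"
  shows "\<exists>g. Poly_Mapping.keys g \<subseteq> {\<nu> \<in> dominant D \<inter> C. shifted_norm \<nu> \<le> shifted_norm \<mu>} \<and> symbol \<mu> - g \<in> N"
  using m
proof (induction "(shifted_norm_nat \<mu>, negative_count \<mu>)" arbitrary: \<mu> rule: wf_induct_rule[OF wf_lex_prod[OF wf_less wf_less]])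
  case (1 \<mu>)
  have mX: "\<mu> \<in> X" using 1(2) C by (auto simp: saturated_def)
  consider "\<mu> \<in> dominant D" | i where "i \<in> I" "sp \<mu> i = 0" | i where "i \<in> I" "sp \<mu> i < 0"
    using mX by (force simp: dominant_alt)
  then show ?case
  proof cases
    case 1
    then show ?thesis using \<open>\<mu> \<in> C\<close> by (intro exI[of _ "symbol \<mu>"]) (simp add: keys_symbol N_zero)
  next
    case (2 i)
    then show ?thesis using rels_N[OF rels_wall[OF mX]] by (intro exI[of _ 0]) auto
  next
    case (3 i)
    let ?\<kappa> = "sdot i \<mu>"
    have k: "?\<kappa> \<in> C" "sp ?\<kappa> i > 0" "sdot i ?\<kappa> = \<mu>" "shifted_norm ?\<kappa> = shifted_norm \<mu>"
      using 1(2) C 3 by (auto simp: saturated_def sp_sdot sdot_invol shifted_norm_sdot)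
    then have kX: "?\<kappa> \<in> X" using C by (auto simp: saturated_def)
    let ?T = "{\<nu> \<in> dominant D \<inter> C. shifted_norm \<nu> \<le> shifted_norm \<mu>}"
    obtain h where h: "Poly_Mapping.keys h \<subseteq> string ?\<kappa> i"
      "symbol \<mu> - (sm (leading_factor (sp ?\<kappa> i)) (symbol ?\<kappa>) + h) \<in> N"
      using straighten_step[OF kX 3(1) k(2)] k(3) by auto
    have "\<exists>g. Poly_Mapping.keys g \<subseteq> {\<nu> \<in> dominant D \<inter> C. shifted_norm \<nu> \<le> shifted_norm ?\<kappa>} \<and> symbol ?\<kappa> - g \<in> N"
    proof (rule 1(1))
      show "((shifted_norm_nat ?\<kappa>, negative_count ?\<kappa>), shifted_norm_nat \<mu>, negative_count \<mu>) \<in> {(x, y). x < y} <*lex*> {(x, y). x < y}"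
        using negative_count_sdot[OF 3] shifted_norm_nat_mono(2)[OF kX mX k(4)] by simp
    qed (rule k(1))
    then obtain g0 where g0: "Poly_Mapping.keys g0 \<subseteq> ?T" "symbol ?\<kappa> - g0 \<in> N" using k(4) by auto
    have "\<exists>g. Poly_Mapping.keys g \<subseteq> ?T \<and> h - g \<in> N"
    proof (rule reduce_combination)
      fix \<eta> assume "\<eta> \<in> Poly_Mapping.keys h"
      then have e: "\<eta> \<in> string ?\<kappa> i" using h(1) by blast
      have "string ?\<kappa> i \<subseteq> C" using C k(1) 3(1) unfolding saturated_def by blast
      then have eC: "\<eta> \<in> C" "\<eta> \<in> X" using e string_X[OF kX 3(1)] by blast+
      have lt: "shifted_norm \<eta> < shifted_norm \<mu>" using string_shifted_norm[OF 3(1) e] k(4) by simp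
      have "\<exists>g. Poly_Mapping.keys g \<subseteq> {\<nu> \<in> dominant D \<inter> C. shifted_norm \<nu> \<le> shifted_norm \<eta>} \<and> symbol \<eta> - g \<in> N"
      proof (rule 1(1))
        show "((shifted_norm_nat \<eta>, negative_count \<eta>), shifted_norm_nat \<mu>, negative_count \<mu>) \<in> {(x, y). x < y} <*lex*> {(x, y). x < y}"
          using shifted_norm_nat_mono(1)[OF eC(2) mX lt] by simp
      qed (rule eC(1))
      then show "\<exists>g. Poly_Mapping.keys g \<subseteq> ?T \<and> symbol \<eta> - g \<in> N" using lt by fastforce
    qed
    then obtain g1 where g1: "Poly_Mapping.keys g1 \<subseteq> ?T" "h - g1 \<in> N" by blast
    let ?c = "leading_factor (sp ?\<kappa> i)"
    have "(symbol \<mu> - (sm ?c (symbol ?\<kappa>) + h)) + (sm ?c (symbol ?\<kappa> - g0) + (h - g1)) \<in> N"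
      by (intro N_add h(2) N_sm g0(2) g1(2))
    then have "symbol \<mu> - (sm ?c g0 + g1) \<in> N" by (simp add: sm_simps algebra_simps)
    moreover have "Poly_Mapping.keys (sm ?c g0 + g1) \<subseteq> ?T" by (intro keys_add_X keys_sm_X g0(1) g1(1))
    ultimately show ?thesis by blast
  qed
qed

lemma saturated_X: "saturated X"
  using sdot_weights string_X by (auto simp: saturated_def)

lemma dominant_span:
  assumes "Poly_Mapping.keys f \<subseteq> X"
  shows "\<exists>g. Poly_Mapping.keys g \<subseteq> dominant D \<and> f - g \<in> N"
proof (rule reduce_combination)
  fix \<kappa> assume "\<kappa> \<in> Poly_Mapping.keys f"
  then obtain g where "Poly_Mapping.keys g \<subseteq> {\<nu> \<in> dominant D \<inter> X. shifted_norm \<nu> \<le> shifted_norm \<kappa>}" "symbol \<kappa> - g \<in> N"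
    using straighten[OF saturated_X subsetD[OF assms]] by metis
  then show "\<exists>g. Poly_Mapping.keys g \<subseteq> dominant D \<and> symbol \<kappa> - g \<in> N" by (intro exI[of _ g]) auto
qed

section \<open>Unitriangularity\<close>

definition Qplus :: "'v set" where
  "Qplus = {\<Sum>\<alpha>\<in>P. real (c \<alpha>) *\<^sub>R \<alpha> | c :: 'v \<Rightarrow> nat. True}"

lemma Qplus_0: "0 \<in> Qplus"
  unfolding Qplus_def by (intro CollectI exI[of _ "\<lambda>_. 0"]) simp

lemma Qplus_add_root:
  assumes "x \<in> Qplus" "\<beta> \<in> P"
  shows "x + real n *\<^sub>R \<beta> \<in> Qplus"
proof -
  obtain c :: "'v \<Rightarrow> nat" where c: "x = (\<Sum>\<alpha>\<in>P. real (c \<alpha>) *\<^sub>R \<alpha>)" using assms unfolding Qplus_def by blast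
  have "(\<Sum>\<alpha>\<in>P. real (c \<alpha> + (if \<alpha> = \<beta> then n else 0)) *\<^sub>R \<alpha>) =
      x + (\<Sum>\<alpha>\<in>P. if \<alpha> = \<beta> then real n *\<^sub>R \<alpha> else 0)"
    unfolding c sum.distrib[symmetric] by (rule sum.cong) (simp_all add: scaleR_add_left)
  also have "\<dots> = x + real n *\<^sub>R \<beta>" using assms(2) finite_pos by simp
  finally show ?thesis
    unfolding Qplus_def by (intro CollectI exI[of _ "\<lambda>\<alpha>. c \<alpha> + (if \<alpha> = \<beta> then n else 0)"]) simp
qed

text \<open>
  The condition is imposed on the whole orbit, because the condition on \<open>\<mu>\<close> alone is not stable under the
  dot action, which raises a weight that is negative on a simple coroot.
\<close>

definition dominated :: "'v \<Rightarrow> 'v set" where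
  "dominated \<xi> = {\<mu> \<in> X. \<forall>w\<in>W. \<xi> - dot D w \<mu> \<in> Qplus}"

lemma dot_comp: "dot D v (dot D w \<mu>) = dot D (v \<circ> w) \<mu>"
  by (simp add: dot_def)

lemma dot_weights: "w \<in> W \<Longrightarrow> \<mu> \<in> X \<Longrightarrow> dot D w \<mu> \<in> X"
proof (induction rule: W_induct)
  case (step i w)
  then show ?case using sdot_weights[of "dot D w \<mu>" i] by (simp add: dot_comp comp_def)
qed (simp add: dot_def)

text \<open>
  After applying \<open>w\<close>, an interior point of a root string lies between the two ends; it is obtained from
  the upper one by subtracting a positive root several times.
\<close>

lemma saturated_dominated: "saturated (dominated \<xi>)"
  unfolding saturated_def
proof (intro conjI ballI)
  show "dominated \<xi> \<subseteq> X" by (auto simp: dominated_def)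
  fix \<mu> i assume m: "\<mu> \<in> dominated \<xi>" and i: "i \<in> I"
  have mX: "\<mu> \<in> X" using m by (simp add: dominated_def)
  show "sdot i \<mu> \<in> dominated \<xi>"
    using m i sdot_weights[OF mX i] comp_W[OF _ s_W[OF i]] by (simp add: dominated_def dot_comp)
  show "string \<mu> i \<subseteq> dominated \<xi>"
  proof
    fix \<kappa> assume k: "\<kappa> \<in> string \<mu> i"
    then obtain j :: nat where j: "\<kappa> = \<mu> - real j *\<^sub>R sr i" "0 < j" "real j < sp \<mu> i"
      by (auto simp: string_def)
    obtain n :: int where n: "sp \<mu> i = of_int n" using sp_int[OF mX i] by (elim Ints_cases)
    define p where "p = nat n"
    have p: "sp \<mu> i = real p" "j < p" using n j(3) by (auto simp: p_def)
    have "\<xi> - dot D w \<kappa> \<in> Qplus" if w: "w \<in> W" for w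
    proof -
      have dk: "dot D w \<kappa> = dot D w \<mu> - real j *\<^sub>R w (sr i)"
      proof -
        have "\<kappa> + rho D = (\<mu> + rho D) - real j *\<^sub>R sr i" by (simp add: j(1) algebra_simps)
        then have "w (\<kappa> + rho D) = w (\<mu> + rho D) - real j *\<^sub>R w (sr i)"
          by (simp only: W_simps(2,3)[OF w])
        then show ?thesis by (simp add: dot_def)
      qed
      have dm: "\<xi> - dot D w \<mu> \<in> Qplus" "\<xi> - dot D (w \<circ> s i) \<mu> \<in> Qplus"
        using m w comp_W[OF w s_W[OF i]] by (auto simp: dominated_def)
      have wr: "w (sr i) \<in> R" using w i by (simp add: W_root simple_root)
      show ?thesis
      proof (cases "w (sr i) \<in> P")
        case True
        then show ?thesis using Qplus_add_root[OF dm(1) True, of j] by (simp add: dk algebra_simps)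
      next
        case False
        then have n: "- w (sr i) \<in> P" using wr pos_or_neg by blast
        have "dot D (w \<circ> s i) \<mu> = dot D w \<mu> - real p *\<^sub>R w (sr i)"
        proof -
          have "dot D (w \<circ> s i) \<mu> = dot D w (sdot i \<mu>)" by (simp add: dot_comp)
          also have "\<dots> = w ((\<mu> + rho D) - real p *\<^sub>R sr i) - rho D"
            by (simp add: dot_def[of D w] sdot_alt p(1) algebra_simps)
          also have "w ((\<mu> + rho D) - real p *\<^sub>R sr i) = w (\<mu> + rho D) - real p *\<^sub>R w (sr i)"
            by (simp only: W_simps(2,3)[OF w])
          finally show ?thesis by (simp add: dot_def)
        qed
        then have "\<xi> - dot D w \<kappa> = (\<xi> - dot D (w \<circ> s i) \<mu>) + real (p - j) *\<^sub>R (- w (sr i))"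
          using p(2) by (simp add: dk of_nat_diff algebra_simps)
        then show ?thesis using Qplus_add_root[OF dm(2) n, of "p - j"] by (simp only:)
      qed
    qed
    then show "\<kappa> \<in> dominated \<xi>" using k string_X[OF mX i] by (auto simp: dominated_def)
  qed
qed

lemma dominant_shifted_pos: "\<xi> \<in> dominant D \<Longrightarrow> \<beta> \<in> P \<Longrightarrow> shifted_pairing D \<xi> \<beta> > 0"
  using dominant_pt[of \<xi> \<beta>] l_pos by (simp add: pt_pairing pos_root zero_less_divide_iff)

lemma sp_dot: "w \<in> W \<Longrightarrow> i \<in> I \<Longrightarrow> sp (dot D w \<xi>) i = shifted_pairing D \<xi> (winv w (sr i))"
  by (simp add: shifted_pairing_def dot_def W_pairing_inv simple_root)

text \<open>
  Along a reduced word positive multiples of simple roots are subtracted.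
\<close>

lemma dominant_dominated:
  assumes l: "\<xi> \<in> dominant D"
  shows "\<xi> \<in> dominated \<xi>"
proof -
  have lX: "\<xi> \<in> X" using l by (simp add: dominant_alt)
  have "\<xi> - dot D w \<xi> \<in> Qplus" if "w \<in> W" for w
    using that
  proof (induction rule: W_reduced_induct)
    case id then show ?case by (simp add: dot_def Qplus_0)
  next
    case (step i w)
    obtain n :: int where n: "sp (dot D w \<xi>) i = of_int n"
      using sp_int[OF dot_weights[OF step(2) lX] step(1)] by (elim Ints_cases)
    have "sp (dot D w \<xi>) i > 0"
      using dominant_shifted_pos[OF l step(3)] sp_dot[OF step(2,1)] by simp
    then have "sp (dot D w \<xi>) i = real (nat n)" using n by simp
    then have "dot D (s i \<circ> w) \<xi> = dot D w \<xi> - real (nat n) *\<^sub>R sr i"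
      using sdot_alt[of i "dot D w \<xi>"] by (simp add: dot_comp)
    then have "\<xi> - dot D (s i \<circ> w) \<xi> = (\<xi> - dot D w \<xi>) + real (nat n) *\<^sub>R sr i" by simp
    then show ?case using Qplus_add_root[OF step(4) simple_pos[OF step(1)]] by metis
  qed
  then show ?thesis using lX by (simp add: dominated_def)
qed

definition lower :: "'v \<Rightarrow> 'v set" where
  "lower \<xi> = {\<nu> \<in> dominant D. (\<nu>, \<xi>) \<in> dominance_order D \<and> \<nu> \<noteq> \<xi>}"

lemma dominance_order_alt:
  "(\<nu>, \<xi>) \<in> dominance_order D \<longleftrightarrow> \<nu> \<in> dominant D \<and> \<xi> \<in> dominant D \<and> \<xi> - \<nu> \<in> Qplus"
proof -
  have "(\<exists>c :: 'v \<Rightarrow> nat. \<nu> = \<xi> - (\<Sum>\<alpha>\<in>P. real (c \<alpha>) *\<^sub>R \<alpha>)) \<longleftrightarrow> \<xi> - \<nu> \<in> Qplus"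
    unfolding Qplus_def by (auto simp: algebra_simps)
  then show ?thesis by (simp add: dominance_order_def)
qed

text \<open>
  Along a reduced word every step has a positive pairing, so that the leading coefficient of the
  result is the product of the factors of the inversions.
\<close>

lemma triangular:
  assumes l: "\<xi> \<in> dominant D" and w: "w \<in> W"
  shows "\<exists>h. Poly_Mapping.keys h \<subseteq> lower \<xi> \<and>
    symbol (dot D w \<xi>) - (sm (\<Prod>\<beta>\<in>inversions w. leading_factor (shifted_pairing D \<xi> \<beta>)) (symbol \<xi>) + h) \<in> N"
  using w
proof (induction rule: W_reduced_induct)
  case id
  have "inversions id = {}" using pos_not_neg by (auto simp: inversions_def)
  then have "symbol (dot D id \<xi>) - (sm (\<Prod>\<beta>\<in>inversions id. leading_factor (shifted_pairing D \<xi> \<beta>)) (symbol \<xi>) + 0) = 0"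
    by (simp only: prod.empty sm_simps(4) dot_def id_apply) simp
  then show ?case using N_zero by (intro exI[of _ 0] conjI) (simp_all only: keys_zero empty_subsetI)
next
  case (step i w)
  have lX: "\<xi> \<in> X" using l by (simp add: dominant_alt)
  let ?\<kappa> = "dot D w \<xi>"
  have kX: "?\<kappa> \<in> X" by (rule dot_weights[OF step(2) lX])
  have p: "sp ?\<kappa> i = shifted_pairing D \<xi> (winv w (sr i))" by (rule sp_dot[OF step(2,1)])
  have pp: "sp ?\<kappa> i > 0" unfolding p by (rule dominant_shifted_pos[OF l step(3)])
  have kb: "?\<kappa> \<in> dominated \<xi>"
    using dominant_dominated[OF l] kX comp_W[OF _ step(2)] by (simp add: dominated_def dot_comp)
  obtain h where h: "Poly_Mapping.keys h \<subseteq> string ?\<kappa> i"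
    "symbol (sdot i ?\<kappa>) - (sm (leading_factor (sp ?\<kappa> i)) (symbol ?\<kappa>) + h) \<in> N"
    using straighten_step[OF kX step(1) pp] by blast
  have "\<exists>g. Poly_Mapping.keys g \<subseteq> lower \<xi> \<and> h - g \<in> N"
  proof (rule reduce_combination)
    fix \<eta> assume "\<eta> \<in> Poly_Mapping.keys h"
    then have e: "\<eta> \<in> string ?\<kappa> i" using h(1) by blast
    have eb: "\<eta> \<in> dominated \<xi>" using saturated_dominated[of \<xi>] kb step(1) e unfolding saturated_def by blast
    have lt: "shifted_norm \<eta> < shifted_norm \<xi>" using string_shifted_norm[OF step(1) e] shifted_norm_dot[OF step(2)] by simp
    have sub: "{\<nu> \<in> dominant D \<inter> dominated \<xi>. shifted_norm \<nu> \<le> shifted_norm \<eta>} \<subseteq> lower \<xi>"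
    proof
      fix \<nu> assume n: "\<nu> \<in> {\<nu> \<in> dominant D \<inter> dominated \<xi>. shifted_norm \<nu> \<le> shifted_norm \<eta>}"
      then have "\<xi> - dot D id \<nu> \<in> Qplus" using id_W unfolding dominated_def by blast
      then have "\<xi> - \<nu> \<in> Qplus" by (simp add: dot_def)
      then show "\<nu> \<in> lower \<xi>" using n l lt by (auto simp: lower_def dominance_order_alt)
    qed
    show "\<exists>g. Poly_Mapping.keys g \<subseteq> lower \<xi> \<and> symbol \<eta> - g \<in> N"
      using straighten[OF saturated_dominated eb] sub by (elim exE conjE) (intro exI conjI, erule subset_trans)
  qed
  then obtain g where g: "Poly_Mapping.keys g \<subseteq> lower \<xi>" "h - g \<in> N" by blast
  let ?c = "\<Prod>\<beta>\<in>inversions w. leading_factor (shifted_pairing D \<xi> \<beta>)"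
  obtain h' where h': "Poly_Mapping.keys h' \<subseteq> lower \<xi>" "symbol ?\<kappa> - (sm ?c (symbol \<xi>) + h') \<in> N"
    using step(4) by blast
  let ?d = "leading_factor (sp ?\<kappa> i)"
  have "(symbol (sdot i ?\<kappa>) - (sm ?d (symbol ?\<kappa>) + h)) +
      (sm ?d (symbol ?\<kappa> - (sm ?c (symbol \<xi>) + h')) + (h - g)) \<in> N"
    by (intro N_add h(2) N_sm h'(2) g(2))
  then have "symbol (sdot i ?\<kappa>) - (sm ?d (sm ?c (symbol \<xi>)) + (sm ?d h' + g)) \<in> N"
    by (simp add: sm_simps(2,5) algebra_simps)
  then have "symbol (sdot i ?\<kappa>) - (sm (?d * ?c) (symbol \<xi>) + (sm ?d h' + g)) \<in> N"
    by (simp only: sm_simps(3))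
  moreover have "(\<Prod>\<beta>\<in>inversions (s i \<circ> w). leading_factor (shifted_pairing D \<xi> \<beta>)) = ?d * ?c"
    using inversions_step[OF step(1-3)] finite_inversions by (simp add: p)
  moreover have "Poly_Mapping.keys (sm ?d h' + g) \<subseteq> lower \<xi>" by (intro keys_add_X keys_sm_X h'(1) g(1))
  ultimately show ?case by (metis dot_comp)
qed

end

section \<open>The bar involution\<close>

lemma lookup_bar: "Poly_Mapping.lookup (laurent_bar a) k = Poly_Mapping.lookup a (- k)"
  by (simp add: laurent_bar_def map_key.rep_eq)

lemma bar_add: "laurent_bar (a + b) = laurent_bar a + laurent_bar b"
  by (rule poly_mapping_eqI) (simp add: lookup_bar lookup_add)

lemma bar_single: "laurent_bar (Poly_Mapping.single k c) = Poly_Mapping.single (- k) c"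
  by (rule poly_mapping_eqI) (auto simp: lookup_bar lookup_single when_def)

lemma bar_simps [simp]: "laurent_bar 0 = 0" "laurent_bar 1 = 1" "laurent_bar q = qi" "laurent_bar qi = q"
  "laurent_bar (- a) = - laurent_bar a" "laurent_bar (laurent_bar a) = a"
  using bar_single[of 0 1]
  by (simp_all add: t_half_def t_half_inv_def bar_single single_one)
    (rule poly_mapping_eqI, simp add: lookup_bar lookup_minus)+

lemma bar_sum: "laurent_bar (sum f A) = (\<Sum>a\<in>A. laurent_bar (f a))"
  by (induction A rule: infinite_finite_induct) (auto simp: bar_add)

lemma laurent_expand: "(a :: laurent) = (\<Sum>k\<in>Poly_Mapping.keys a. Poly_Mapping.single k (Poly_Mapping.lookup a k))"
proof (rule poly_mapping_eqI)
  fix k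
  have "(\<Sum>j\<in>Poly_Mapping.keys a. Poly_Mapping.lookup (Poly_Mapping.single j (Poly_Mapping.lookup a j)) k) =
      (\<Sum>j\<in>Poly_Mapping.keys a. if k = j then Poly_Mapping.lookup a j else 0)"
    by (intro sum.cong) (auto simp: lookup_single when_def)
  then show "Poly_Mapping.lookup a k = Poly_Mapping.lookup
      (\<Sum>j\<in>Poly_Mapping.keys a. Poly_Mapping.single j (Poly_Mapping.lookup a j)) k"
    by (simp add: lookup_sum in_keys_iff)
qed

lemma bar_mult: "laurent_bar (a * b) = laurent_bar a * laurent_bar b"
proof -
  have 1: "laurent_bar (Poly_Mapping.single i c * b) = laurent_bar (Poly_Mapping.single i c) * laurent_bar b"
    for i c
  proof -
    let ?S = "\<lambda>k. Poly_Mapping.single k (Poly_Mapping.lookup b k)"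
    have "Poly_Mapping.single i c * b = (\<Sum>k\<in>Poly_Mapping.keys b. Poly_Mapping.single i c * ?S k)"
      by (subst laurent_expand[of b]) (simp add: sum_distrib_left)
    then have "laurent_bar (Poly_Mapping.single i c * b) =
        (\<Sum>k\<in>Poly_Mapping.keys b. laurent_bar (Poly_Mapping.single i c) * laurent_bar (?S k))"
      by (simp add: bar_sum mult_single bar_single)
    also have "\<dots> = laurent_bar (Poly_Mapping.single i c) * laurent_bar (\<Sum>k\<in>Poly_Mapping.keys b. ?S k)"
      by (simp add: bar_sum sum_distrib_left)
    finally show ?thesis by (simp flip: laurent_expand)
  qed
  let ?S = "\<lambda>k. Poly_Mapping.single k (Poly_Mapping.lookup a k)"
  have "a * b = (\<Sum>k\<in>Poly_Mapping.keys a. ?S k * b)"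
    by (subst laurent_expand[of a]) (simp add: sum_distrib_right)
  then have "laurent_bar (a * b) = laurent_bar (\<Sum>k\<in>Poly_Mapping.keys a. ?S k) * laurent_bar b"
    by (simp add: bar_sum sum_distrib_right 1)
  then show ?thesis by (simp flip: laurent_expand)
qed

lemma bar_power: "laurent_bar (a ^ n) = laurent_bar a ^ n"
  by (induction n) (simp_all add: bar_mult)

lemma sm_sum: "sm a (sum f A) = (\<Sum>x\<in>A. sm a (f x))"
  by (induction A rule: infinite_finite_induct) (auto simp: sm_simps)

definition semilin :: "('i \<Rightarrow> 'j \<Rightarrow>\<^sub>0 laurent) \<Rightarrow> ('i \<Rightarrow>\<^sub>0 laurent) \<Rightarrow> 'j \<Rightarrow>\<^sub>0 laurent" where
  "semilin \<phi> f = (\<Sum>\<mu>\<in>Poly_Mapping.keys f. sm (laurent_bar (Poly_Mapping.lookup f \<mu>)) (\<phi> \<mu>))"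

lemma semilin_superset:
  "finite A \<Longrightarrow> Poly_Mapping.keys f \<subseteq> A \<Longrightarrow>
    semilin \<phi> f = (\<Sum>\<mu>\<in>A. sm (laurent_bar (Poly_Mapping.lookup f \<mu>)) (\<phi> \<mu>))"
  unfolding semilin_def by (rule sum.mono_neutral_left) (auto simp: in_keys_iff sm_simps)

lemma semilin_add: "semilin \<phi> (f + g) = semilin \<phi> f + semilin \<phi> g"
proof -
  let ?A = "Poly_Mapping.keys f \<union> Poly_Mapping.keys g"
  have "semilin \<phi> (f + g) = (\<Sum>\<mu>\<in>?A. sm (laurent_bar (Poly_Mapping.lookup (f + g) \<mu>)) (\<phi> \<mu>))"
    using keys_add[of f g] by (intro semilin_superset) auto
  also have "\<dots> = semilin \<phi> f + semilin \<phi> g"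
    by (simp add: lookup_add bar_add sm_simps sum.distrib semilin_superset[of ?A])
  finally show ?thesis .
qed

lemma semilin_sm: "semilin \<phi> (sm a f) = sm (laurent_bar a) (semilin \<phi> f)"
  using semilin_superset[OF finite_keys keys_sm, of \<phi> a f]
  by (simp add: lookup_sm semilin_def bar_mult sm_simps(3) sm_sum)

lemma semilin_0: "semilin \<phi> 0 = 0"
  by (simp add: semilin_def)

lemma semilin_sum: "semilin \<phi> (sum f A) = (\<Sum>a\<in>A. semilin \<phi> (f a))"
  by (induction A rule: infinite_finite_induct) (auto simp: semilin_add semilin_0)

lemma semilin_uminus: "semilin \<phi> (- f) = - semilin \<phi> f"
  using semilin_sm[of \<phi> "- 1" f] by (simp add: sm_simps)

lemma semilin_symbol: "semilin \<phi> (symbol \<mu>) = \<phi> \<mu>"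
  by (simp add: semilin_def keys_symbol lookup_symbol sm_simps)

context fock_space
begin

definition divp :: "real \<Rightarrow> bool" where
  "divp p \<longleftrightarrow> (\<exists>k :: int. p = real l * real_of_int k)"

lemma divp_uminus: "divp (- p) = divp p"
proof -
  have "divp (- p)" if p: "divp p" for p
  proof -
    obtain k :: int where "p = real l * real_of_int k" using p unfolding divp_def by blast
    then show ?thesis unfolding divp_def by (intro exI[of _ "- k"]) simp
  qed
  from this[of p] this[of "- p"] show ?thesis by auto
qed

lemma divp_shift: "divp (p + real l * real_of_int n) = divp p"
proof -
  have "divp (p + real l * real_of_int n)" if p: "divp p" for p n
  proof -
    obtain k :: int where "p = real l * real_of_int k" using p unfolding divp_def by blast
    then show ?thesis unfolding divp_def by (intro exI[of _ "k + n"]) (simp add: algebra_simps)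
  qed
  from this[of p n] this[of "p + real l * real_of_int n" "- n"] show ?thesis by auto
qed

lemma wall_count_alt: "wall_count D l \<mu> = card {\<beta> \<in> P. divp (shifted_pairing D \<mu> \<beta>)}"
  by (simp add: wall_count_def divp_def)

text \<open>
  The reflection permutes the positive roots other than \<open>\<alpha>\<^sub>i\<close>, and divisibility does not see the sign by
  which it changes \<open>\<alpha>\<^sub>i\<close>.
\<close>

lemma wall_count_cong:
  assumes i: "i \<in> I"
    and d: "\<And>\<beta>. \<beta> \<in> P \<Longrightarrow> divp (shifted_pairing D \<kappa> \<beta>) = divp (shifted_pairing D \<mu> (s i \<beta>))"
  shows "wall_count D l \<kappa> = wall_count D l \<mu>"
proof -
  let ?A = "{\<beta> \<in> P. divp (shifted_pairing D \<kappa> \<beta>)}"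
  let ?B = "{\<beta> \<in> P. divp (shifted_pairing D \<mu> \<beta>)}"
  define \<phi> where "\<phi> \<beta> = (if \<beta> = sr i then \<beta> else s i \<beta>)" for \<beta>
  have inv: "\<phi> (\<phi> \<beta>) = \<beta>" if "\<beta> \<in> P" for \<beta>
    using that s_not_simple[OF i] s_invol[OF i] by (auto simp: \<phi>_def)
  have pos: "\<phi> \<beta> \<in> P" if "\<beta> \<in> P" for \<beta> using that s_pos[OF i] by (auto simp: \<phi>_def)
  have simple: "divp (shifted_pairing D \<mu> (s i (sr i))) = divp (shifted_pairing D \<mu> (sr i))"
    using i by (simp add: s_simple shifted_pairing_def coroot_uminus simple_root divp_uminus)
  have dv: "divp (shifted_pairing D \<kappa> \<beta>) = divp (shifted_pairing D \<mu> (\<phi> \<beta>))" if "\<beta> \<in> P" for \<beta>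
    using d[OF that] simple by (simp add: \<phi>_def)
  have "bij_betw \<phi> ?A ?B"
    by (rule bij_betw_byWitness[where f'=\<phi>]) (use inv pos dv in \<open>auto simp: image_subset_iff\<close>)
  then show ?thesis unfolding wall_count_alt by (rule bij_betw_same_card)
qed

lemma wall_count_sdot: "i \<in> I \<Longrightarrow> wall_count D l (sdot i \<mu>) = wall_count D l \<mu>"
  by (rule wall_count_cong) (auto simp: shifted_pairing_def dot_def s_def coroot_refl[OF simple_root pos_root])

lemma wall_count_dot: "w \<in> W \<Longrightarrow> wall_count D l (dot D w \<mu>) = wall_count D l \<mu>"
proof (induction rule: W_induct)
  case (step i w)
  then show ?case using wall_count_sdot[of i "dot D w \<mu>"] by (simp add: dot_comp comp_def)
qed (simp add: dot_def)

text \<open>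
  The affine reflection changes pairings by multiples of \<open>l\<close> and by the action of \<open>s\<^sub>i\<close>.
\<close>

lemma wall_count_affine:
  assumes i: "i \<in> I" and p: "sp \<mu> i = real k * real l + real j"
  shows "wall_count D l (\<mu> - real j *\<^sub>R sr i) = wall_count D l \<mu>"
proof (rule wall_count_cong[OF i])
  fix \<beta> assume b: "\<beta> \<in> P"
  let ?x = "\<mu> + rho D"
  obtain n :: int where n: "\<langle>sr i, \<beta>\<rangle> = of_int n"
    using root_pairing_int[OF pos_root[OF b] simple_root[OF i]] by (elim Ints_cases)
  have "shifted_pairing D \<mu> (s i \<beta>) = \<langle>s i ?x, \<beta>\<rangle>"
    using i b by (simp add: shifted_pairing_def s_def coroot_refl simple_root pos_root)
  also have "\<dots> = \<langle>?x, \<beta>\<rangle> - sp \<mu> i * \<langle>sr i, \<beta>\<rangle>"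
    using i b by (simp add: s_def pairing_refl simple_root pos_root shifted_pairing_def)
  also have "\<dots> = shifted_pairing D (\<mu> - real j *\<^sub>R sr i) \<beta> + real l * real_of_int (- int k * n)"
    unfolding p unfolding shifted_pairing_def
    using pos_root[OF b] by (simp add: pairing_simps n algebra_simps)
  finally show "divp (shifted_pairing D (\<mu> - real j *\<^sub>R sr i) \<beta>) = divp (shifted_pairing D \<mu> (s i \<beta>))"
    by (simp only: divp_shift)
qed

definition coef :: "'v \<Rightarrow> laurent" where
  "coef \<mu> = (- 1) ^ card P * qi ^ (card P - wall_count D l \<mu>)"

definition barF :: "('v \<Rightarrow>\<^sub>0 laurent) \<Rightarrow> 'v \<Rightarrow>\<^sub>0 laurent" where
  "barF = semilin (\<lambda>\<mu>. sm (coef \<mu>) (symbol (dot D w0 \<mu>)))"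

lemma barF_simps: "barF (f + g) = barF f + barF g" "barF (sm a f) = sm (laurent_bar a) (barF f)"
    "barF 0 = 0" "barF (sum fs A) = (\<Sum>a\<in>A. barF (fs a))" "barF (- f) = - barF f"
    "barF (symbol \<mu>) = sm (coef \<mu>) (symbol (dot D w0 \<mu>))"
  by (simp_all add: barF_def semilin_add semilin_sm semilin_0 semilin_sum semilin_uminus semilin_symbol)

lemma barF_X: "f \<in> FX \<Longrightarrow> barF f \<in> FX"
proof -
  assume f: "f \<in> FX"
  have "sm (laurent_bar (Poly_Mapping.lookup f \<mu>)) (sm (coef \<mu>) (symbol (dot D w0 \<mu>))) \<in> FX"
    if "\<mu> \<in> Poly_Mapping.keys f" for \<mu>
    using that f dot_weights[OF w0(1)] by (intro FX_sm) (auto simp: keys_symbol)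
  then show ?thesis unfolding barF_def semilin_def by (rule FX_sum)
qed

lemma bar_coef: "laurent_bar (coef \<mu>) * coef \<mu> = 1"
proof -
  have "laurent_bar (coef \<mu>) * coef \<mu> =
      ((- 1) ^ card P * (- 1) ^ card P) * (q * qi) ^ (card P - wall_count D l \<mu>)"
    by (simp add: coef_def bar_mult bar_power power_mult_distrib mult_ac del: q_qi)
  then show ?thesis by (simp flip: power_add mult_2)
qed

text \<open>
  The involution law holds already on the free module of symbols, before the relations are imposed.
\<close>

lemma barF_barF: "barF (barF f) = f"
proof -
  have 1: "barF (barF (symbol \<mu>)) = symbol \<mu>" for \<mu>
  proof -
    have "dot D w0 (dot D w0 \<mu>) = \<mu>" by (simp add: dot_def w0_invol)
    moreover have "coef (dot D w0 \<mu>) = coef \<mu>" by (simp add: coef_def wall_count_dot[OF w0(1)])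
    ultimately show ?thesis using bar_coef by (simp add: barF_simps sm_simps(4) flip: sm_simps(3))
  qed
  have "f = (\<Sum>\<mu>\<in>Poly_Mapping.keys f. sm (Poly_Mapping.lookup f \<mu>) (symbol \<mu>))"
    by (rule poly_mapping_expand) auto
  then show ?thesis by (metis (no_types, lifting) 1 barF_simps(2,4) bar_simps(6) sum.cong)
qed



text \<open>
  With \<open>\<kappa> = w\<^sub>0 \<circ> (s\<^sub>i \<circ> \<mu>)\<close> and \<open>w\<^sub>0 \<alpha>\<^sub>i = - \<alpha>\<^sub>j\<close> the pairing of \<open>\<kappa>\<close> with \<open>\<alpha>\<^sub>j\<close> is that of \<open>\<mu>\<close> with
  \<open>\<alpha>\<^sub>i\<close>, and the relation of \<open>\<mu>\<close> and \<open>i\<close> goes to a multiple of the one of \<open>\<kappa>\<close> and \<open>j\<close>.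
\<close>

lemma barF_rels:
  assumes r: "r \<in> rels"
  shows "barF r \<in> N"
proof -
  have opp: "\<exists>j\<in>I. w0 (sr i) = - sr j \<and> dot D w0 \<mu> = sdot j (dot D w0 (sdot i \<mu>)) \<and>
      sp (dot D w0 (sdot i \<mu>)) j = sp \<mu> i" if i: "i \<in> I" for i \<mu>
  proof -
    obtain j where j: "j \<in> I" "w0 (sr i) = - sr j" "\<And>x. w0 (s i x) = s j (w0 x)"
      "\<And>x. \<langle>w0 x, sr j\<rangle> = - \<langle>x, sr i\<rangle>" using w0_simple[OF i] by blast
    have "sp (dot D w0 (sdot i \<mu>)) j = - sp (sdot i \<mu>) i"
      by (simp add: shifted_pairing_def dot_def j(4))
    then have "sp (dot D w0 (sdot i \<mu>)) j = sp \<mu> i" by (simp add: sp_sdot i)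
    moreover have "dot D w0 \<mu> = sdot j (dot D w0 (sdot i \<mu>))"
      by (simp add: dot_def j(3) s_invol j(1))
    ultimately show ?thesis using j(1,2) by blast
  qed
  have kX: "dot D w0 (sdot i \<mu>) \<in> X" if "\<mu> \<in> X" "i \<in> I" for \<mu> i
    by (intro dot_weights[OF w0(1)] sdot_weights that)
  have c: "coef (sdot i \<mu>) = coef \<mu>" if "i \<in> I" for \<mu> i by (simp add: coef_def wall_count_sdot that)
  show ?thesis
    using r
  proof (cases rule: rels_cases)
    case (mult \<mu> i k)
    obtain j where j: "j \<in> I" "dot D w0 \<mu> = sdot j (dot D w0 (sdot i \<mu>))"
      "sp (dot D w0 (sdot i \<mu>)) j = sp \<mu> i" using opp[OF mult(2)] by blast
    let ?\<kappa> = "dot D w0 (sdot i \<mu>)"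
    have "symbol (sdot j ?\<kappa>) + symbol ?\<kappa> \<in> N"
      using mult j by (intro rels_N rels_mult[of _ _ k] kX) simp_all
    then have "sm (coef \<mu>) (symbol (sdot j ?\<kappa>) + symbol ?\<kappa>) \<in> N" by (rule N_sm)
    then show ?thesis unfolding mult(4) barF_simps c[OF mult(2)] j(2)[symmetric] sm_simps(2)
      by (simp only: add.commute)
  next
    case (first \<mu> i)
    obtain j where j: "j \<in> I" "dot D w0 \<mu> = sdot j (dot D w0 (sdot i \<mu>))"
      "sp (dot D w0 (sdot i \<mu>)) j = sp \<mu> i" using opp[OF first(2)] by blast
    let ?\<kappa> = "dot D w0 (sdot i \<mu>)"
    have "symbol (sdot j ?\<kappa>) + sm q (symbol ?\<kappa>) \<in> N"
      using first j by (intro rels_N rels_first kX) simp_all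
    then have "sm (coef \<mu> * qi) (symbol (sdot j ?\<kappa>) + sm q (symbol ?\<kappa>)) \<in> N" by (rule N_sm)
    moreover have "barF r = sm (coef \<mu> * qi) (symbol (sdot j ?\<kappa>) + sm q (symbol ?\<kappa>))"
      unfolding first(5) barF_simps c[OF first(2)] j(2)[symmetric] sm_simps(2) bar_simps
        sm_simps(3)[symmetric] by (simp add: mult_ac)
    ultimately show ?thesis by simp
  next
    case (higher \<mu> i k n)
    obtain j where j: "j \<in> I" "w0 (sr i) = - sr j" "dot D w0 \<mu> = sdot j (dot D w0 (sdot i \<mu>))"
      "sp (dot D w0 (sdot i \<mu>)) j = sp \<mu> i" using opp[OF higher(2)] by blast
    let ?\<kappa> = "dot D w0 (sdot i \<mu>)"
    let ?\<mu>1 = "\<mu> - real n *\<^sub>R sr i" and ?\<kappa>1 = "?\<kappa> - real n *\<^sub>R sr j"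
    have s1: "sdot i ?\<mu>1 = sdot i \<mu> + real n *\<^sub>R sr i"
      using s_linear[OF higher(2)] s_simple[OF higher(2)]
      by (simp add: dot_def linear_add linear_diff linear_scale algebra_simps)
    have k1: "dot D w0 (sdot i ?\<mu>1) = ?\<kappa>1"
    proof -
      have "dot D w0 (sdot i ?\<mu>1) = w0 ((sdot i \<mu> + rho D) + real n *\<^sub>R sr i) - rho D"
        unfolding s1 dot_def[of D w0] by (simp add: algebra_simps)
      also have "\<dots> = ?\<kappa>1" by (simp add: W_simps(1,3)[OF w0(1)] j(2) dot_def[of D w0])
      finally show ?thesis .
    qed
    have k2: "dot D w0 ?\<mu>1 = sdot j ?\<kappa>1"
    proof -
      have "sdot j ?\<kappa>1 = sdot j ?\<kappa> + real n *\<^sub>R sr j"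
        using s_linear[OF j(1)] s_simple[OF j(1)]
        by (simp add: dot_def linear_add linear_diff linear_scale algebra_simps)
      also have "\<dots> = dot D w0 \<mu> - real n *\<^sub>R w0 (sr i)" by (simp add: j(2) flip: j(3))
      also have "\<dots> = w0 ((\<mu> + rho D) - real n *\<^sub>R sr i) - rho D"
        by (simp only: W_simps(2,3)[OF w0(1)] dot_def algebra_simps)
      also have "\<dots> = dot D w0 ?\<mu>1" by (simp add: dot_def algebra_simps)
      finally show ?thesis by simp
    qed
    have c1: "coef ?\<mu>1 = coef \<mu>" using wall_count_affine[OF higher(2,5)] by (simp add: coef_def)
    have "symbol (sdot j ?\<kappa>) + sm q (symbol ?\<kappa>) + (symbol ?\<kappa>1 + sm q (symbol (sdot j ?\<kappa>1))) \<in> N"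
      using higher j by (intro rels_N rels_higher[of _ _ k] kX) simp_all
    then have "sm (coef \<mu> * qi)
        (symbol (sdot j ?\<kappa>) + sm q (symbol ?\<kappa>) + (symbol ?\<kappa>1 + sm q (symbol (sdot j ?\<kappa>1)))) \<in> N"
      by (rule N_sm)
    moreover have "barF r = sm (coef \<mu> * qi)
        (symbol (sdot j ?\<kappa>) + sm q (symbol ?\<kappa>) + (symbol ?\<kappa>1 + sm q (symbol (sdot j ?\<kappa>1))))"
      unfolding higher(6) barF_simps c[OF higher(2)] c1 k1 k2 j(3)[symmetric] sm_simps(2) bar_simps
        sm_simps(3)[symmetric] by (simp add: mult_ac)
    ultimately show ?thesis by simp
  next
    case (wall \<mu> i)
    obtain j where j: "j \<in> I" "dot D w0 \<mu> = sdot j (dot D w0 (sdot i \<mu>))"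
      "sp (dot D w0 (sdot i \<mu>)) j = sp \<mu> i" using opp[OF wall(2)] by blast
    have "sdot i \<mu> = \<mu>" using wall by (simp add: sdot_alt)
    then have "symbol (dot D w0 \<mu>) \<in> N"
      using wall j by (intro rels_N rels_wall[of _ j] dot_weights[OF w0(1)]) simp_all
    then show ?thesis unfolding wall(4) barF_simps by (rule N_sm)
  qed
qed

lemma barF_N: "f \<in> N \<Longrightarrow> barF f \<in> N"
proof -
  have "submodule {f \<in> FX. barF f \<in> N} laurent_ring (free_module X)"
    by (rule submodule_freeI) (use FX_add FX_sm N_zero N_add N_sm in \<open>auto simp: barF_simps\<close>)
  moreover have "rels \<subseteq> {f \<in> FX. barF f \<in> N}" using barF_rels rels_X by auto
  ultimately have "N \<subseteq> {f \<in> FX. barF f \<in> N}" by (rule N_least)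
  then show "f \<in> N \<Longrightarrow> barF f \<in> N" by auto
qed

definition barQ :: "('v \<Rightarrow>\<^sub>0 laurent) set \<Rightarrow> ('v \<Rightarrow>\<^sub>0 laurent) set" where
  "barQ = (\<lambda>C\<in>carrier Q. cls (barF (SOME f. f \<in> FX \<and> cls f = C)))"

lemma barQ_cls:
  assumes "f \<in> FX"
  shows "barQ (cls f) = cls (barF f)"
proof -
  define g where "g = (SOME g. g \<in> FX \<and> cls g = cls f)"
  have g: "g \<in> FX \<and> cls g = cls f" unfolding g_def by (rule someI[of _ f]) (use assms in simp)
  then have "g - f \<in> N" by (simp add: cls_eq_iff)
  then have "barF (g + - f) \<in> N" using barF_N by simp
  then have "barF g - barF f \<in> N" unfolding barF_simps by simp
  then have "cls (barF g) = cls (barF f)" by (simp only: cls_eq_iff)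
  then show ?thesis using cls_Q[OF assms] by (simp add: barQ_def g_def)
qed

lemma coef_alt: "coef \<mu> = (- 1) ^ weyl_length D (longest D) *
    qi ^ (weyl_length D (longest D) - wall_count D l \<mu>)"
  by (simp add: coef_def length_w0)

lemma is_fock_bar_alt:
  "is_fock_bar D l b \<longleftrightarrow> b \<in> extensional (carrier Q) \<and> b \<in> hom (add_monoid Q) (add_monoid Q) \<and>
    (\<forall>a. \<forall>m\<in>carrier Q. b (a \<odot>\<^bsub>Q\<^esub> m) = laurent_bar a \<odot>\<^bsub>Q\<^esub> b m) \<and>
    (\<forall>\<mu>\<in>X. b (cls (symbol \<mu>)) = coef \<mu> \<odot>\<^bsub>Q\<^esub> cls (symbol (dot D w0 \<mu>)))"
  by (simp add: is_fock_bar_def fock_alt ket_alt coef_alt w0_def)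

lemma barQ_is_fock_bar: "is_fock_bar D l barQ"
  unfolding is_fock_bar_alt
proof (intro conjI allI ballI)
  show "barQ \<in> extensional (carrier Q)" by (simp add: barQ_def)
  show "barQ \<in> hom (add_monoid Q) (add_monoid Q)"
    using FX_add barF_X by (auto simp: hom_def carrier_Q barQ_cls cls_add barF_simps)
  show "barQ (a \<odot>\<^bsub>Q\<^esub> m) = laurent_bar a \<odot>\<^bsub>Q\<^esub> barQ m" if "m \<in> carrier Q" for a m
    using that FX_sm barF_X by (auto simp: carrier_Q barQ_cls cls_smult barF_simps)
  show "barQ (cls (symbol \<mu>)) = coef \<mu> \<odot>\<^bsub>Q\<^esub> cls (symbol (dot D w0 \<mu>))" if "\<mu> \<in> X" for \<mu>
    using that dot_weights[OF w0(1) that] by (simp add: barQ_cls cls_smult barF_simps keys_symbol)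
qed

text \<open>
  A semilinear map is determined by its values on the generating kets.
\<close>

lemma fock_bar_cls:
  assumes b: "is_fock_bar D l b" and f: "f \<in> FX"
  shows "b (cls f) = cls (barF f)"
proof -
  note b' = b[unfolded is_fock_bar_alt]
  have hom: "b (cls g \<oplus>\<^bsub>Q\<^esub> cls h) = b (cls g) \<oplus>\<^bsub>Q\<^esub> b (cls h)" if "g \<in> FX" "h \<in> FX" for g h
    using b' cls_Q that by (auto simp: hom_def)
  have smult: "b (a \<odot>\<^bsub>Q\<^esub> cls g) = laurent_bar a \<odot>\<^bsub>Q\<^esub> b (cls g)" if "g \<in> FX" for a g
    using b' cls_Q that by blast
  let ?S = "\<lambda>\<mu>. sm (Poly_Mapping.lookup f \<mu>) (symbol \<mu>)"
  have S: "?S \<mu> \<in> FX" if "\<mu> \<in> Poly_Mapping.keys f" for \<mu>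
    using that f by (intro FX_sm) (auto simp: keys_symbol)
  have "b (cls (\<Sum>\<mu>\<in>A. ?S \<mu>)) = cls (barF (\<Sum>\<mu>\<in>A. ?S \<mu>))" if "A \<subseteq> Poly_Mapping.keys f" for A
    using finite_subset[OF that finite_keys] that
  proof (induction A)
    case empty
    have z: "(0 :: 'v \<Rightarrow>\<^sub>0 laurent) \<in> FX" by simp
    have "b (cls 0) \<in> carrier Q" using b' cls_Q[OF z] by (auto simp: hom_def)
    then obtain g where g: "g \<in> FX" "b (cls 0) = cls g" by (auto simp: carrier_Q)
    have "b (0 \<odot>\<^bsub>Q\<^esub> cls 0) = laurent_bar 0 \<odot>\<^bsub>Q\<^esub> b (cls 0)" by (rule smult[OF z])
    then have "b (cls 0) = cls 0" using g by (simp add: cls_smult sm_simps)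
    then show ?case by (simp add: barF_simps)
  next
    case (insert \<mu> A)
    have m: "\<mu> \<in> X" "\<mu> \<in> Poly_Mapping.keys f" using insert f by auto
    have 1: "b (cls (?S \<mu>)) = cls (barF (?S \<mu>))"
    proof -
      have sx: "symbol \<mu> \<in> FX" "symbol (dot D w0 \<mu>) \<in> FX"
        using m(1) dot_weights[OF w0(1) m(1)] by (simp_all add: keys_symbol)
      have "b (cls (?S \<mu>)) = laurent_bar (Poly_Mapping.lookup f \<mu>) \<odot>\<^bsub>Q\<^esub> b (cls (symbol \<mu>))"
        using smult[OF sx(1)] cls_smult[OF sx(1)] by simp
      also have "b (cls (symbol \<mu>)) = coef \<mu> \<odot>\<^bsub>Q\<^esub> cls (symbol (dot D w0 \<mu>))" using b' m(1) by blast
      also have "\<dots> = cls (barF (symbol \<mu>))" using cls_smult[OF sx(2)] by (simp add: barF_simps)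
      finally show ?thesis using cls_smult[OF barF_X[OF sx(1)]] by (simp add: barF_simps)
    qed
    have sA: "(\<Sum>\<mu>\<in>A. ?S \<mu>) \<in> FX" using S insert by (intro FX_sum) auto
    have e: "(\<Sum>\<mu>\<in>insert \<mu> A. ?S \<mu>) = ?S \<mu> + (\<Sum>\<mu>\<in>A. ?S \<mu>)" by (rule sum.insert[OF insert(1,2)])
    have "b (cls (?S \<mu> + (\<Sum>\<mu>\<in>A. ?S \<mu>))) = b (cls (?S \<mu>)) \<oplus>\<^bsub>Q\<^esub> b (cls (\<Sum>\<mu>\<in>A. ?S \<mu>))"
      using hom[OF S[OF m(2)] sA] cls_add[OF S[OF m(2)] sA] by simp
    also have "\<dots> = cls (barF (?S \<mu>) + barF (\<Sum>\<mu>\<in>A. ?S \<mu>))"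
      using insert 1 cls_add[OF barF_X[OF S[OF m(2)]] barF_X[OF sA]] by simp
    finally show ?case unfolding e barF_simps(1) .
  qed
  from this[OF subset_refl] show ?thesis
    using poly_mapping_expand[OF finite_keys subset_refl, of f] by simp
qed

lemma fock_bar_unique: "\<exists>!b. is_fock_bar D l b"
proof (rule ex1I[of "is_fock_bar D l", OF barQ_is_fock_bar])
  fix b assume b: "is_fock_bar D l b"
  show "b = barQ"
  proof (rule extensionalityI[of _ "carrier Q"])
    show "b \<in> extensional (carrier Q)" using b by (simp add: is_fock_bar_alt)
    show "barQ \<in> extensional (carrier Q)" by (simp add: barQ_def)
    show "b C = barQ C" if "C \<in> carrier Q" for C
      using that fock_bar_cls[OF b] barQ_cls by (auto simp: carrier_Q)
  qed
qed

lemma fock_bar_eq: "fock_bar D l = barQ"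
  using the1_equality[of "is_fock_bar D l", OF fock_bar_unique barQ_is_fock_bar] by (simp add: fock_bar_def)

section \<open>The dominance order and the KL-module\<close>

lemma leading_factor_divp: "leading_factor p = (if divp p then - 1 else - q)"
  by (simp add: leading_factor_def divp_def)

text \<open>
  The normalising factor of the bar involution is the inverse of the leading coefficient that is
  produced by straightening \<open>|w\<^sub>0 \<circ> \<xi>\<rangle>\<close>, in which every positive root contributes one factor.
\<close>

lemma coef_prod: "coef \<xi> * (\<Prod>\<beta>\<in>P. leading_factor (shifted_pairing D \<xi> \<beta>)) = 1"
proof -
  let ?A = "{\<beta> \<in> P. divp (shifted_pairing D \<xi> \<beta>)}"
  let ?m = "card P - wall_count D l \<xi>"
  have "(\<Prod>\<beta>\<in>P. leading_factor (shifted_pairing D \<xi> \<beta>)) =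
      (\<Prod>\<beta>\<in>P. (- 1) * (if divp (shifted_pairing D \<xi> \<beta>) then 1 else q))"
    by (rule prod.cong) (auto simp: leading_factor_divp)
  also have "\<dots> = (- 1) ^ card P * (\<Prod>\<beta>\<in>P. if divp (shifted_pairing D \<xi> \<beta>) then 1 else q)"
    by (simp only: prod.distrib prod_constant)
  also have "(\<Prod>\<beta>\<in>P. if divp (shifted_pairing D \<xi> \<beta>) then 1 else q) = q ^ card (P - ?A)"
  proof -
    have "(\<Prod>\<beta>\<in>P. if divp (shifted_pairing D \<xi> \<beta>) then 1 else q) =
        (\<Prod>\<beta>\<in>P - ?A. if divp (shifted_pairing D \<xi> \<beta>) then 1 else q)"
      by (rule prod.mono_neutral_right) (use finite_pos in auto)
    also have "\<dots> = (\<Prod>\<beta>\<in>P - ?A. q)" by (rule prod.cong) auto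
    finally show ?thesis by simp
  qed
  also have "card (P - ?A) = ?m" using finite_pos by (simp add: wall_count_alt card_Diff_subset)
  finally have "coef \<xi> * (\<Prod>\<beta>\<in>P. leading_factor (shifted_pairing D \<xi> \<beta>)) =
      ((- 1) ^ card P * (- 1) ^ card P) * (qi * q) ^ ?m"
    by (simp add: coef_def power_mult_distrib mult_ac del: q_qi)
  then show ?thesis by (simp flip: power_add mult_2)
qed

lemma form_rho_pos: "\<beta> \<in> P \<Longrightarrow> form (rho D) \<beta> > 0"
  using form_sign(1)[OF pos_root] rho_pos by blast

lemma Qplus_form: "x \<in> Qplus \<Longrightarrow> form (rho D) x \<ge> 0 \<and> (form (rho D) x = 0 \<longrightarrow> x = 0)"
proof -
  assume "x \<in> Qplus"
  then obtain c :: "'v \<Rightarrow> nat" where c: "x = (\<Sum>\<alpha>\<in>P. real (c \<alpha>) *\<^sub>R \<alpha>)" unfolding Qplus_def by blast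
  have f: "form (rho D) x = (\<Sum>\<alpha>\<in>P. real (c \<alpha>) * form (rho D) \<alpha>)"
    unfolding c by (simp add: form_sum form_simps)
  have nn: "real (c \<alpha>) * form (rho D) \<alpha> \<ge> 0" if "\<alpha> \<in> P" for \<alpha> using form_rho_pos[OF that] by simp
  have "x = 0" if "form (rho D) x = 0"
  proof -
    have "real (c \<alpha>) * form (rho D) \<alpha> = 0" if a: "\<alpha> \<in> P" for \<alpha>
      using sum_nonneg_eq_0_iff[OF finite_pos nn] a \<open>form (rho D) x = 0\<close> f by auto
    then have "c \<alpha> = 0" if "\<alpha> \<in> P" for \<alpha> using form_rho_pos[OF that] that by fastforce
    then show ?thesis unfolding c by (intro sum.neutral) simp
  qed
  moreover have "form (rho D) x \<ge> 0" unfolding f by (rule sum_nonneg) (rule nn)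
  ultimately show ?thesis by blast
qed

lemma Qplus_add: "x \<in> Qplus \<Longrightarrow> y \<in> Qplus \<Longrightarrow> x + y \<in> Qplus"
proof -
  assume "x \<in> Qplus" "y \<in> Qplus"
  then obtain c d :: "'v \<Rightarrow> nat" where "x = (\<Sum>\<alpha>\<in>P. real (c \<alpha>) *\<^sub>R \<alpha>)" "y = (\<Sum>\<alpha>\<in>P. real (d \<alpha>) *\<^sub>R \<alpha>)"
    unfolding Qplus_def by blast
  then have "x + y = (\<Sum>\<alpha>\<in>P. real (c \<alpha> + d \<alpha>) *\<^sub>R \<alpha>)" by (simp add: scaleR_add_left sum.distrib)
  then show ?thesis unfolding Qplus_def by (intro CollectI exI[of _ "\<lambda>\<alpha>. c \<alpha> + d \<alpha>"]) simp
qed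

lemma partial_order_dominance: "partial_order_on (dominant D) (dominance_order D)"
  unfolding partial_order_on_def preorder_on_def
proof (intro conjI)
  show "dominance_order D \<subseteq> dominant D \<times> dominant D" by (auto simp: dominance_order_alt)
  show "refl_on (dominant D) (dominance_order D)"
    by (auto simp: refl_on_def dominance_order_alt Qplus_0)
  show "trans (dominance_order D)"
  proof (rule transI)
    fix x y z assume "(x, y) \<in> dominance_order D" "(y, z) \<in> dominance_order D"
    then show "(x, z) \<in> dominance_order D" using Qplus_add[of "z - y" "y - x"] by (auto simp: dominance_order_alt)
  qed
  show "antisym (dominance_order D)"
  proof (rule antisymI)
    fix x y assume "(x, y) \<in> dominance_order D" "(y, x) \<in> dominance_order D"
    then have q: "y - x \<in> Qplus" "x - y \<in> Qplus" by (simp_all add: dominance_order_alt)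
    have "form (rho D) (x - y) = - form (rho D) (y - x)" by (simp add: form_simps)
    then have "form (rho D) (x - y) = 0" using Qplus_form[OF q(1)] Qplus_form[OF q(2)] by linarith
    then show "x = y" using Qplus_form[OF q(2)] by simp
  qed
qed

text \<open>
  The pairing with \<open>\<rho>\<close> bounds every coefficient of \<open>\<xi> - \<nu>\<close> for dominant \<open>\<nu>\<close>.
\<close>

lemma finite_dominance_interval: "finite {\<nu> \<in> dominant D. (\<nu>, \<xi>) \<in> dominance_order D}"
proof -
  define b where "b \<alpha> = nat \<lceil>form (rho D) (\<xi> + rho D) / form (rho D) \<alpha>\<rceil>" for \<alpha>
  have "{\<nu> \<in> dominant D. (\<nu>, \<xi>) \<in> dominance_order D} \<subseteq>
    (\<lambda>c. \<xi> - (\<Sum>\<alpha>\<in>P. real (c \<alpha>) *\<^sub>R \<alpha>)) ` PiE P (\<lambda>\<alpha>. {..b \<alpha>})"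
  proof
    fix \<nu> assume "\<nu> \<in> {\<nu> \<in> dominant D. (\<nu>, \<xi>) \<in> dominance_order D}"
    then have n: "\<nu> \<in> dominant D" "\<xi> - \<nu> \<in> Qplus" by (simp_all add: dominance_order_alt)
    then obtain c :: "'v \<Rightarrow> nat" where c: "\<xi> - \<nu> = (\<Sum>\<alpha>\<in>P. real (c \<alpha>) *\<^sub>R \<alpha>)" unfolding Qplus_def by blast
    have "form (rho D) (\<nu> + rho D) \<ge> 0"
    proof -
      have "form y (rho D) = (1/2) * (\<Sum>\<alpha>\<in>P. form y \<alpha>)" for y
        unfolding rho_def by (simp only: form_simps form_sum)
      then have "form (\<nu> + rho D) (rho D) = (1/2) * (\<Sum>\<alpha>\<in>P. form (\<nu> + rho D) \<alpha>)" .
      moreover have "form (\<nu> + rho D) \<alpha> \<ge> 0" if "\<alpha> \<in> P" for \<alpha>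
        using dominant_shifted_pos[OF n(1) that] form_sign(2)[OF pos_root[OF that]]
        by (simp add: shifted_pairing_def)
      ultimately have "form (\<nu> + rho D) (rho D) \<ge> 0" using sum_nonneg[of P "form (\<nu> + rho D)"] by simp
      then show ?thesis using form_commute by metis
    qed
    moreover have "form (rho D) (\<xi> + rho D) = form (rho D) (\<nu> + rho D) + form (rho D) (\<xi> - \<nu>)"
      by (simp add: form_simps)
    ultimately have le: "form (rho D) (\<xi> - \<nu>) \<le> form (rho D) (\<xi> + rho D)" by linarith
    have f: "form (rho D) (\<xi> - \<nu>) = (\<Sum>\<alpha>\<in>P. real (c \<alpha>) * form (rho D) \<alpha>)"
      unfolding c by (simp add: form_sum form_simps)
    have cb: "c \<alpha> \<le> b \<alpha>" if a: "\<alpha> \<in> P" for \<alpha>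
    proof -
      have "real (c \<alpha>) * form (rho D) \<alpha> \<le> form (rho D) (\<xi> - \<nu>)"
        unfolding f using a finite_pos form_rho_pos by (intro member_le_sum) (auto simp: less_imp_le)
      then have "real (c \<alpha>) \<le> form (rho D) (\<xi> + rho D) / form (rho D) \<alpha>"
        using le form_rho_pos[OF a] by (simp add: pos_le_divide_eq)
      then show ?thesis unfolding b_def by linarith
    qed
    have "\<nu> = \<xi> - (\<Sum>\<alpha>\<in>P. real (restrict c P \<alpha>) *\<^sub>R \<alpha>)" using c by (simp add: algebra_simps)
    then show "\<nu> \<in> (\<lambda>c. \<xi> - (\<Sum>\<alpha>\<in>P. real (c \<alpha>) *\<^sub>R \<alpha>)) ` PiE P (\<lambda>\<alpha>. {..b \<alpha>})"
      using cb by (intro image_eqI[of _ _ "restrict c P"]) auto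
  qed
  then show ?thesis by (rule finite_subset) (intro finite_imageI finite_PiE finite_pos finite_atMost)
qed

lemma bar_triangular:
  assumes xi: "\<xi> \<in> dominant D"
  shows "\<exists>a. barQ (cls (symbol \<xi>)) = cls (symbol \<xi>) \<oplus>\<^bsub>Q\<^esub>
    (\<Oplus>\<^bsub>Q\<^esub> \<nu>\<in>lower \<xi>. a \<nu> \<odot>\<^bsub>Q\<^esub> cls (symbol \<nu>))"
proof -
  have DX: "dominant D \<subseteq> X" by (auto simp: dominant_alt)
  then have lX: "lower \<xi> \<subseteq> X" by (auto simp: lower_def)
  have fin: "finite (lower \<xi>)"
    by (rule finite_subset[OF _ finite_dominance_interval[of \<xi>]]) (auto simp: lower_def)
  let ?c = "\<Prod>\<beta>\<in>P. leading_factor (shifted_pairing D \<xi> \<beta>)"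
  obtain h where h: "Poly_Mapping.keys h \<subseteq> lower \<xi>" "symbol (dot D w0 \<xi>) - (sm ?c (symbol \<xi>) + h) \<in> N"
    using triangular[OF xi w0(1)] unfolding w0(2) by blast
  let ?g = "sm (coef \<xi>) h"
  have "sm (coef \<xi>) (symbol (dot D w0 \<xi>) - (sm ?c (symbol \<xi>) + h)) \<in> N" using h(2) by (rule N_sm)
  then have "sm (coef \<xi>) (symbol (dot D w0 \<xi>)) - (sm (coef \<xi> * ?c) (symbol \<xi>) + ?g) \<in> N"
    by (simp only: sm_simps)
  then have "barF (symbol \<xi>) - (symbol \<xi> + ?g) \<in> N" by (simp only: coef_prod sm_simps(4) barF_simps(6))
  then have e: "cls (barF (symbol \<xi>)) = cls (symbol \<xi> + ?g)" by (simp only: cls_eq_iff)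
  have gl: "Poly_Mapping.keys ?g \<subseteq> lower \<xi>" by (rule keys_sm_X[OF h(1)])
  have sX: "symbol \<xi> \<in> FX" "?g \<in> FX" using xi DX lX gl by (auto simp: keys_symbol)
  have "cls ?g = (\<Oplus>\<^bsub>Q\<^esub> \<nu>\<in>lower \<xi>. Poly_Mapping.lookup ?g \<nu> \<odot>\<^bsub>Q\<^esub> cls (symbol \<nu>))"
    unfolding finsum_symbols[OF fin lX] using poly_mapping_expand[OF fin gl] by simp
  then show ?thesis
    using e barQ_cls[OF sX(1)] cls_add[OF sX] by (intro exI[of _ "Poly_Mapping.lookup ?g"]) simp
qed

lemma kets_basis: "is_basis laurent_ring Q (dominant D) (\<lambda>\<mu>. cls (symbol \<mu>))"
  by (rule is_basis_cls) (use dominant_span dominant_independent in \<open>auto simp: dominant_alt\<close>)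

lemma fock_space_theorem:
  "is_basis laurent_ring (fock D l) (ket D l ` dominant D) (\<lambda>x. x) \<and>
    (\<exists>!b. is_fock_bar D l b) \<and>
    KL_module (dominant D) (dominance_order D) (fock D l) (ket D l) (fock_bar D l)"
proof (intro conjI)
  have ket: "ket D l = (\<lambda>\<mu>. cls (symbol \<mu>))" by (simp add: fun_eq_iff ket_alt)
  interpret QM: Module.module laurent_ring Q by (rule module_Q)
  show "is_basis laurent_ring (fock D l) (ket D l ` dominant D) (\<lambda>x. x)"
    unfolding fock_alt ket
    by (rule is_basis_image[OF QM.abelian_group_axioms kets_basis])
      (use cls_symbol_inj dominant_independent QM.smult_closed in auto)
  show "\<exists>!b. is_fock_bar D l b" by (rule fock_bar_unique)
  note fb = barQ_is_fock_bar[unfolded is_fock_bar_alt]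
  show "KL_module (dominant D) (dominance_order D) (fock D l) (ket D l) (fock_bar D l)"
    unfolding KL_module_def fock_alt ket fock_bar_eq
  proof (intro conjI ballI)
    show "barQ (barQ m) = m" if "m \<in> carrier Q" for m
      using that barF_X barF_barF by (auto simp: carrier_Q barQ_cls)
    show "\<exists>a. barQ (cls (symbol \<xi>)) = cls (symbol \<xi>) \<oplus>\<^bsub>Q\<^esub>
        (\<Oplus>\<^bsub>Q\<^esub> \<nu>\<in>{\<nu> \<in> dominant D. (\<nu>, \<xi>) \<in> dominance_order D \<and> \<nu> \<noteq> \<xi>}. a \<nu> \<odot>\<^bsub>Q\<^esub> cls (symbol \<nu>))"
      if "\<xi> \<in> dominant D" for \<xi>
      using bar_triangular[OF that] unfolding lower_def .
  qed (use fb partial_order_dominance finite_dominance_interval module_Q kets_basis in auto)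
qed

end

theorem theorem1p1:
  fixes D :: "'v::real_vector root_data" and l :: nat
  assumes "root_datum D" and "l > 0"
  shows "is_basis laurent_ring (fock D l) (ket D l ` dominant D) (\<lambda>x. x) \<and>
    (\<exists>!b. is_fock_bar D l b) \<and>
    KL_module (dominant D) (dominance_order D) (fock D l) (ket D l) (fock_bar D l)"
proof -
  interpret root_datum D by (rule assms(1))
  interpret fock_space D l by unfold_locales (rule assms(2))
  show ?thesis by (rule fock_space_theorem)
qed

end
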